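(* Let $P(D)=\partial_1^2-\partial_2^2$ and let $F\subset\mathbb{R}^2$, $F\neq\mathbb{R}^2$, be closed with continuous boundary such that for each $\xi\in\partial F$ and every neighborhood $U$ of $\xi$ in $\mathbb{R}^2$ it holds $$U\cap\partial F\cap\{x\in\mathbb{R}^2:x_1+x_2<\xi_1+\xi_2\}\neq\emptyset\ \text{ and }\ U\cap\partial F\cap\{x\in\mathbb{R}^2:x_1-x_2<\xi_1-\xi_2\}\neq\emptyset$$ as well as $$U\cap\partial F\cap\{x\in\mathbb{R}^2:x_1+x_2>\xi_1+\xi_2\}\neq\emptyset\ \text{ and }\ U\cap\partial F\cap\{x\in\mathbb{R}^2:x_1-x_2>\xi_1-\xi_2\}\neq\emptyset.$$ Then the following are equivalent. (i) $(F,\mathbb{R}^2)$ is a $P$-Runge pair (for smooth Whitney jets). (ii) There is no characteristic line for $P(D)$ for which its intersection with $\mathbb{R}^2\setminus F$ has a bounded connected component.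
   Context: Smooth Whitney jets. For a compact set $K\subset\mathbb{R}^d$ (here $d=2$), $\mathscr{E}(K)$ is the space of families $f=(f^{(\alpha)})_{\alpha\in\mathbb{N}_0^d}$ of continuous complex-valued functions on $K$ such that, with $T^n_xf(y)=\sum_{|\alpha|\le n}\frac{f^{(\alpha)}(x)}{\alpha!}(y-x)^\alpha$ and $$q_{K,n,t}(f)=\sup\Big\{\tfrac{|f^{(\alpha)}(y)-\partial^\alpha T^n_xf(y)|}{|x-y|^{n-|\alpha|}}: |\alpha|\le n,\ x,y\in K,\ 0<|x-y|<t\Big\},$$ one has $\lim_{t\to0}q_{K,n,t}(f)=0$ for all $n\in\mathbb{N}_0$. It is a Fréchet space with the seminorms $\|f\|_{n,K}=\sup\{|f^{(\alpha)}(x)|:x\in K,|\alpha|\le n\}+\sup_{t>0}q_{K,n,t}(f)$. For a closed set $F\subset\mathbb{R}^d$, $\mathscr{E}(F)$ is the projective limit of the spaces $\mathscr{E}(K_l)$ along a compact exhaustion $(K_l)_l$ of $F$, i.e. the space of families $(f^{(\alpha)})_\alpha$ of continuous functions on $F$ whose restriction to every compact $K\subset F$ lies in $\mathscr{E}(K)$, with the topology given by the seminorms $f\mapsto\|f|_K\|_{n,K}$. Operators. $\partial_j$ acts on jets by $\partial_jf=(f^{(\alpha+e_j)})_\alpha$; $P(D)$ acts on $\mathscr{E}(F)$ accordingly. Put $\mathscr{E}_P(F)=\{f\in\mathscr{E}(F):P(D)f=0\}$. $P$-Runge pair. For closed $F_1\subset F_2$, $(F_1,F_2)$ is a $P$-Runge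 pair if the image of $\mathscr{E}_P(F_2)$ under the restriction map $f\mapsto(f^{(\alpha)}|_{F_1})_\alpha$ is dense in $\mathscr{E}_P(F_1)$ (with the topology of $\mathscr{E}(F_1)$). Characteristic lines for $P(D)=\partial_1^2-\partial_2^2$ are the lines $\{x\in\mathbb{R}^2:x_1N_1+x_2N_2=c\}$ with $c\in\mathbb{R}$, $N\in\mathbb{R}^2\setminus\{0\}$ and $N_1^2=N_2^2$. Continuous boundary. A closed set $F\subset\mathbb{R}^2$ has continuous boundary if for each $\xi\in\partial F$ there are an open neighborhood $U_\xi$ of $\xi$ in $\mathbb{R}^2$ and a homeomorphism $h_\xi:B(0,1)\to U_\xi$ ($B(0,1)$ the open Euclidean unit ball) with $h_\xi(0)=\xi$ and $\partial F\cap U_\xi=h_\xi(\{x\in B(0,1):x_2=0\})$. *)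

theory Defs
  imports "HOL-Analysis.Analysis"
begin

definition mi_order :: "nat^2 \<Rightarrow> nat" where
  "mi_order \<alpha> = (\<Sum>j\<in>UNIV. \<alpha> $ j)"

definition mi_fact :: "nat^2 \<Rightarrow> nat" where
  "mi_fact \<alpha> = (\<Prod>j\<in>UNIV. fact (\<alpha> $ j))"

definition mi_power :: "real^2 \<Rightarrow> nat^2 \<Rightarrow> real" where
  "mi_power x \<alpha> = (\<Prod>j\<in>UNIV. (x $ j) ^ (\<alpha> $ j))"

text \<open>Without this fact, sums over all multi-indices of bounded order would default to zero.\<close>

lemma finite_mi_order_le: "finite {\<alpha>. mi_order \<alpha> \<le> n}"
proof (rule finite_subset)
  show "{\<alpha>. mi_order \<alpha> \<le> n} \<subseteq> (\<lambda>(a, b). vector [a, b]) ` ({..n} \<times> {..n})"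
  proof
    fix \<alpha> :: "nat^2"
    assume "\<alpha> \<in> {\<alpha>. mi_order \<alpha> \<le> n}"
    then have "\<alpha> $ 1 \<le> n" "\<alpha> $ 2 \<le> n"
      by (auto simp: mi_order_def sum_2)
    moreover have "\<alpha> = vector [\<alpha> $ 1, \<alpha> $ 2]"
      by (simp add: vec_eq_iff forall_2)
    ultimately show "\<alpha> \<in> (\<lambda>(a, b). vector [a, b]) ` ({..n} \<times> {..n})"
      by (intro image_eqI[of _ _ "(\<alpha> $ 1, \<alpha> $ 2)"]) auto
  qed
qed auto

definition partial :: "2 \<Rightarrow> (real^2 \<Rightarrow> complex) \<Rightarrow> real^2 \<Rightarrow> complex" where
  "partial j g x = vector_derivative (\<lambda>t. g (x + t *\<^sub>R axis j 1)) (at 0)"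

definition mi_deriv :: "nat^2 \<Rightarrow> (real^2 \<Rightarrow> complex) \<Rightarrow> real^2 \<Rightarrow> complex" where
  "mi_deriv \<alpha> g = (partial 1 ^^ (\<alpha> $ 1)) ((partial 2 ^^ (\<alpha> $ 2)) g)"

text \<open>
  A family of functions on a set \<open>F\<close> is represented by total functions vanishing outside \<open>F\<close>.
  This makes the representation unique, so that equations between jets are plain equalities.
\<close>

type_synonym jet = "nat^2 \<Rightarrow> real^2 \<Rightarrow> complex"

definition jet_restrict :: "(real^2) set \<Rightarrow> jet \<Rightarrow> jet" where
  "jet_restrict F f = (\<lambda>\<alpha> x. if x \<in> F then f \<alpha> x else 0)"

definition continuous_jets :: "(real^2) set \<Rightarrow> jet set" where
  "continuous_jets F = {f. \<forall>\<alpha>. continuous_on F (f \<alpha>) \<and> (\<forall>x. x \<notin> F \<longrightarrow> f \<alpha> x = 0)}"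

definition taylor_jet :: "nat \<Rightarrow> jet \<Rightarrow> real^2 \<Rightarrow> real^2 \<Rightarrow> complex" where
  "taylor_jet n f x y =
     (\<Sum>\<alpha> | mi_order \<alpha> \<le> n. f \<alpha> x / of_nat (mi_fact \<alpha>) * of_real (mi_power (y - x) \<alpha>))"

text \<open>Suprema are taken in \<open>ennreal\<close>: the empty supremum is \<open>0\<close>, an unbounded one is \<open>\<infinity>\<close>.\<close>

definition whitney_q :: "(real^2) set \<Rightarrow> nat \<Rightarrow> real \<Rightarrow> jet \<Rightarrow> ennreal" where
  "whitney_q K n t f =
     Sup {ennreal (norm (f \<alpha> y - mi_deriv \<alpha> (taylor_jet n f x) y)
                     / norm (x - y) ^ (n - mi_order \<alpha>)) | \<alpha> x y.
          mi_order \<alpha> \<le> n \<and> x \<in> K \<and> y \<in> K \<and> 0 < norm (x - y) \<and> norm (x - y) < t}"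

definition whitney_norm :: "nat \<Rightarrow> (real^2) set \<Rightarrow> jet \<Rightarrow> ennreal" where
  "whitney_norm n K f =
     Sup {ennreal (norm (f \<alpha> x)) | \<alpha> x. x \<in> K \<and> mi_order \<alpha> \<le> n}
     + (SUP t\<in>{0<..}. whitney_q K n t f)"

definition whitney_compact :: "(real^2) set \<Rightarrow> jet set" where
  "whitney_compact K =
     {f \<in> continuous_jets K. \<forall>n. ((\<lambda>t. whitney_q K n t f) \<longlongrightarrow> 0) (at_right 0)}"

definition whitney :: "(real^2) set \<Rightarrow> jet set" where
  "whitney F =
     {f \<in> continuous_jets F. \<forall>K. compact K \<and> K \<subseteq> F \<longrightarrow> jet_restrict K f \<in> whitney_compact K}"

definition whitney_topology :: "(real^2) set \<Rightarrow> jet topology" where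
  "whitney_topology F = topology_generated_by
     {{g \<in> whitney F. whitney_norm n K (jet_restrict K (\<lambda>\<alpha> x. g \<alpha> x - f \<alpha> x)) < ennreal e} | f n K e.
        f \<in> whitney F \<and> compact K \<and> K \<subseteq> F \<and> 0 < e}"

definition jet_partial :: "2 \<Rightarrow> jet \<Rightarrow> jet" where
  "jet_partial j f = (\<lambda>\<alpha>. f (\<alpha> + axis j 1))"

definition wave_operator :: "jet \<Rightarrow> jet" where
  "wave_operator f =
     (\<lambda>\<alpha> x. jet_partial 1 (jet_partial 1 f) \<alpha> x - jet_partial 2 (jet_partial 2 f) \<alpha> x)"

definition whitney_kernel :: "(jet \<Rightarrow> jet) \<Rightarrow> (real^2) set \<Rightarrow> jet set" where
  "whitney_kernel P F = {f \<in> whitney F. P f = (\<lambda>\<alpha> x. 0)}"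

definition Runge_pair :: "(jet \<Rightarrow> jet) \<Rightarrow> (real^2) set \<Rightarrow> (real^2) set \<Rightarrow> bool" where
  "Runge_pair P F1 F2 \<longleftrightarrow>
     closed F1 \<and> closed F2 \<and> F1 \<subseteq> F2 \<and>
     whitney_kernel P F1 \<subseteq> whitney_topology F1 closure_of (jet_restrict F1 ` whitney_kernel P F2)"

definition wave_characteristic_line :: "(real^2) set \<Rightarrow> bool" where
  "wave_characteristic_line L \<longleftrightarrow>
     (\<exists>c (N :: real^2). N \<noteq> 0 \<and> (N $ 1)\<^sup>2 = (N $ 2)\<^sup>2 \<and>
       L = {x. x $ 1 * N $ 1 + x $ 2 * N $ 2 = c})"

definition continuous_boundary :: "(real^2) set \<Rightarrow> bool" where
  "continuous_boundary F \<longleftrightarrow>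
     (\<forall>\<xi>\<in>frontier F. \<exists>U (h :: real^2 \<Rightarrow> real^2) h'.
        open U \<and> \<xi> \<in> U \<and> homeomorphism (ball (0 :: real^2) 1) U h h' \<and> h 0 = \<xi> \<and>
        frontier F \<inter> U = h ` {x \<in> ball 0 1. x $ 2 = 0})"

end

theory Submission
  imports Defs
begin

text \<open>
  In the coordinates \<open>u = x\<^sub>1 + x\<^sub>2\<close>, \<open>v = x\<^sub>1 - x\<^sub>2\<close> the equation reads \<open>\<partial>\<^sub>u \<partial>\<^sub>v f = 0\<close> and the
  global solutions are \<open>G(u) + H(v)\<close>. Condition (ii) says that \<open>F\<close> meets every characteristic line
  in a convex set.

  If \<open>F\<close> leaves a gap between two of its points on such a line, a solution supported in a thin strip
  around the line can be set to zero on one side of the gap. Its derivative transversal to the line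
  then differs at the two points, whereas for global solutions it is constant along the line.

  Conversely, let the sections be convex and let \<open>f\<close> be a solution on \<open>F\<close>. Gluing the Taylor
  polynomials of \<open>f\<close> (which are solutions) with a partition of unity at scale \<open>d\<close> gives a function
  that solves the equation near a compact part \<open>K\<close> of \<open>F\<close> up to an error of high order in \<open>d\<close>.
  Integrating the cut-off error twice gives a small correction, hence an exact solution near \<open>K\<close>.
  As \<open>K\<close> has convex sections, this one has the form \<open>G(u) + H(v)\<close> near \<open>K\<close> with smooth \<open>G\<close> and \<open>H\<close>
  on the line, so it extends to a global solution.
\<close>

subsection \<open>Derivative sequences in one variable\<close>

text \<open>The topology of \<open>whitney F\<close> tests finitely many orders on one compact set
  at a time, so gluing at a single scale \<open>d\<close> is enough once the loss of powers of
  \<open>d\<close> is under control. Taylor polynomials of order N based at points at distance O(d)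
  differ by O(d^N), each derivative of the glued function costs a factor 1/d, and the mixed
  derivative to be corrected costs two. Taking N about twice the order to be approximated leaves a
  positive power of \<open>d\<close>. Two geometric points shape the converse. The compact set
  supplied by the topology need not have convex sections, so it is enlarged to the part of F in a
  square in the coordinates u, v. And the corrected solution must be exact on an open set around it,
  whose sections need not be convex: the open set is used to integrate, the convexity of the compact
  sections to identify the constants. In the necessity part first order derivatives are used because
  the values of G(u) + H(v) along a single line are unrestricted. Smooth functions are carried
  together with all their derivatives as data, so every estimate is about given sequences.\<close>

definition deriv_seq :: "(nat \<Rightarrow> real \<Rightarrow> complex) \<Rightarrow> bool" where
  "deriv_seq h \<longleftrightarrow> (\<forall>n t. (h n has_vector_derivative h (Suc n) t) (at t))"

definition const_seq :: "complex \<Rightarrow> nat \<Rightarrow> real \<Rightarrow> complex" where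
  "const_seq c n t = (if n = 0 then c else 0)"

definition leibniz :: "(nat \<Rightarrow> real \<Rightarrow> complex) \<Rightarrow> (nat \<Rightarrow> real \<Rightarrow> complex) \<Rightarrow> nat \<Rightarrow> real \<Rightarrow> complex" where
  "leibniz a h n t = (\<Sum>k\<le>n. of_nat (n choose k) * a k t * h (n - k) t)"

definition taylor_seq :: "nat \<Rightarrow> (nat \<Rightarrow> complex) \<Rightarrow> real \<Rightarrow> nat \<Rightarrow> real \<Rightarrow> complex" where
  "taylor_seq n c a i t = (\<Sum>k\<le>n. if i \<le> k then c k * of_real ((t - a) ^ (k - i) / fact (k - i)) else 0)"

lemma deriv_seqD: "deriv_seq h \<Longrightarrow> (h n has_vector_derivative h (Suc n) t) (at t)"
  by (simp add: deriv_seq_def)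

lemma deriv_seq_isCont: "deriv_seq h \<Longrightarrow> isCont (h n) t"
  by (meson deriv_seqD has_vector_derivative_continuous)

lemma deriv_seq_const: "deriv_seq (const_seq c)"
  by (auto simp: deriv_seq_def const_seq_def[abs_def] intro!: derivative_eq_intros)

lemma deriv_seq_diff: "deriv_seq a \<Longrightarrow> deriv_seq b \<Longrightarrow> deriv_seq (\<lambda>n t. a n t - b n t)"
  by (auto simp: deriv_seq_def intro!: has_vector_derivative_diff)

lemma deriv_seq_sum: "(\<And>i. i \<in> I \<Longrightarrow> deriv_seq (h i)) \<Longrightarrow> deriv_seq (\<lambda>n t. \<Sum>i\<in>I. h i n t)"
  by (auto simp: deriv_seq_def intro!: has_vector_derivative_sum)

lemma deriv_seq_shift: "deriv_seq h \<Longrightarrow> deriv_seq (\<lambda>n. h (Suc n))"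
  by (auto simp: deriv_seq_def)

lemma deriv_seq_affine:
  assumes "deriv_seq h"
  shows "deriv_seq (\<lambda>n t. of_real (c ^ n) * h n (c * t + b))"
  unfolding deriv_seq_def
proof (intro allI)
  fix n t
  have "((\<lambda>t. c * t + b) has_vector_derivative c) (at t)"
    by (auto intro!: derivative_eq_intros simp: has_vector_derivative_def)
  then have "((h n \<circ> (\<lambda>t. c * t + b)) has_vector_derivative c *\<^sub>R h (Suc n) (c * t + b)) (at t)"
    by (rule vector_diff_chain_at) (rule deriv_seqD[OF assms])
  then have "((\<lambda>t. of_real (c ^ n) * h n (c * t + b)) has_vector_derivative
      of_real (c ^ n) * (c *\<^sub>R h (Suc n) (c * t + b))) (at t)"
    by (intro has_vector_derivative_mult_right) (simp add: o_def)
  then show "((\<lambda>t. of_real (c ^ n) * h n (c * t + b)) has_vector_derivative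
      of_real (c ^ Suc n) * h (Suc n) (c * t + b)) (at t)"
    by (simp add: scaleR_conv_of_real mult_ac)
qed

text \<open>With x i j standing for the product of an i-th and a j-th derivative, the left side is
  the derivative of the n-th Leibniz sum; Pascal's rule regroups it.\<close>

lemma binomial_sum_Suc:
  fixes x :: "nat \<Rightarrow> nat \<Rightarrow> 'a::comm_semiring_1"
  shows "(\<Sum>k\<le>n. of_nat (n choose k) * (x (Suc k) (n - k) + x k (Suc (n - k))))
       = (\<Sum>k\<le>Suc n. of_nat (Suc n choose k) * x k (Suc n - k))"
proof -
  have A: "(\<Sum>k\<le>n. of_nat (n choose k) * x k (Suc (n - k)))
      = x 0 (Suc n) + (\<Sum>k\<le>n. of_nat (n choose Suc k) * x (Suc k) (n - k))"
  proof -
    have "(\<Sum>k\<le>n. of_nat (n choose k) * x k (Suc (n - k))) = (\<Sum>k\<le>n. of_nat (n choose k) * x k (Suc n - k))"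
      by (intro sum.cong) (auto simp: Suc_diff_le)
    also have "\<dots> = (\<Sum>k\<le>Suc n. of_nat (n choose k) * x k (Suc n - k))"
      by (simp add: binomial_eq_0)
    also have "\<dots> = x 0 (Suc n) + (\<Sum>k\<le>n. of_nat (n choose Suc k) * x (Suc k) (n - k))"
      by (subst sum.atMost_Suc_shift) simp
    finally show ?thesis .
  qed
  show ?thesis
    by (subst sum.atMost_Suc_shift) (simp add: A distrib_left distrib_right sum.distrib add_ac)
qed

lemma deriv_seq_leibniz:
  assumes "deriv_seq a" "deriv_seq h"
  shows "deriv_seq (leibniz a h)"
  unfolding deriv_seq_def
proof (intro allI)
  fix n t
  have "((\<lambda>t. \<Sum>k\<le>n. of_nat (n choose k) * (a k t * h (n - k) t)) has_vector_derivative
     (\<Sum>k\<le>n. of_nat (n choose k) * (a k t * h (Suc (n - k)) t + a (Suc k) t * h (n - k) t))) (at t)"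
    by (intro has_vector_derivative_sum has_vector_derivative_mult_right has_vector_derivative_mult
         deriv_seqD assms)
  also have "(\<Sum>k\<le>n. of_nat (n choose k) * (a k t * h (Suc (n - k)) t + a (Suc k) t * h (n - k) t))
     = leibniz a h (Suc n) t"
    using binomial_sum_Suc[of n "\<lambda>i j. a i t * h j t"]
    by (simp add: leibniz_def add_ac mult_ac del: sum.atMost_Suc)
  finally show "(leibniz a h n has_vector_derivative leibniz a h (Suc n) t) (at t)"
    by (simp add: leibniz_def[abs_def] mult.assoc)
qed

lemma leibniz_sum_left: "leibniz (\<lambda>n t. \<Sum>i\<in>I. a i n t) h n t = (\<Sum>i\<in>I. leibniz (a i) h n t)"
  unfolding leibniz_def by (simp add: sum_distrib_left sum_distrib_right) (rule sum.swap)

lemma leibniz_const_left: "leibniz (const_seq c) h n t = c * h n t"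
proof -
  have "leibniz (const_seq c) h n t = (\<Sum>k\<le>n. if k = 0 then c * h n t else 0)"
    unfolding leibniz_def const_seq_def by (intro sum.cong) auto
  then show ?thesis by simp
qed

text \<open>The value 0 at 0 fixes the constant, so that primitives of products vanish on the
  coordinate axes in \<open>tensor_antiderivative\<close>.\<close>

lemma deriv_seq_antiderivative:
  assumes "deriv_seq h"
  obtains H where "deriv_seq H" "\<And>n. H (Suc n) = h n" "H 0 0 = 0"
proof -
  have "\<exists>F. \<forall>x. - \<infinity> < ereal x \<longrightarrow> ereal x < \<infinity> \<longrightarrow> (F has_vector_derivative h 0 x) (at x)"
    by (rule einterval_antiderivative) (auto intro: deriv_seq_isCont[OF assms])
  then obtain F where F: "\<And>x. (F has_vector_derivative h 0 x) (at x)" by auto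
  define H where "H = (\<lambda>n t. case n of 0 \<Rightarrow> F t - F 0 | Suc m \<Rightarrow> h m t)"
  have "(H n has_vector_derivative H (Suc n) t) (at t)" for n t
  proof (cases n)
    case 0
    have "((\<lambda>t. F t - F 0) has_vector_derivative h 0 t - 0) (at t)"
      by (intro has_vector_derivative_diff F has_vector_derivative_const)
    with 0 show ?thesis by (simp add: H_def)
  next
    case (Suc m)
    then show ?thesis using deriv_seqD[OF assms, of m t] by (simp add: H_def)
  qed
  then show ?thesis by (intro that[of H]) (auto simp: deriv_seq_def H_def fun_eq_iff)
qed

lemma deriv_seq_taylor_seq: "deriv_seq (taylor_seq n c a)"
  unfolding deriv_seq_def
proof (intro allI)
  fix i t
  have "((\<lambda>t. if i \<le> k then c k * of_real ((t - a) ^ (k - i) / fact (k - i)) else 0) has_vector_derivative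
     (if Suc i \<le> k then c k * of_real ((t - a) ^ (k - Suc i) / fact (k - Suc i)) else 0)) (at t)" for k
  proof (cases "Suc i \<le> k")
    case True
    then obtain m where m: "k - i = Suc m" "k - Suc i = m"
      by (metis Suc_diff_Suc Suc_le_eq)
    have "((\<lambda>t. (t - a) ^ Suc m / fact (Suc m)) has_real_derivative (t - a) ^ m / fact m) (at t)"
      by (rule derivative_eq_intros refl | simp)+
    then have "((\<lambda>t. c k * of_real ((t - a) ^ Suc m / fact (Suc m))) has_vector_derivative
        c k * of_real ((t - a) ^ m / fact m)) (at t)"
      by (intro has_vector_derivative_mult_right has_vector_derivative_of_real)
    with True m show ?thesis by simp
  next
    case False
    then have "k = i \<or> k < i" by auto
    with False show ?thesis by (auto intro!: derivative_eq_intros)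
  qed
  then show "(taylor_seq n c a i has_vector_derivative taylor_seq n c a (Suc i) t) (at t)"
    unfolding taylor_seq_def[abs_def] by (intro has_vector_derivative_sum)
qed

lemma taylor_seq_eq_0: "n < i \<Longrightarrow> taylor_seq n c a i t = 0"
  unfolding taylor_seq_def by (intro sum.neutral) auto

lemma taylor_seq_shift:
  assumes "i \<le> n"
  shows "taylor_seq n c a i t = (\<Sum>k\<le>n - i. c (i + k) * of_real ((t - a) ^ k / fact k))"
proof -
  have "taylor_seq n c a i t = (\<Sum>k\<in>{i..n}. c k * of_real ((t - a) ^ (k - i) / fact (k - i)))"
    unfolding taylor_seq_def by (rule sum.mono_neutral_cong_right) auto
  also have "\<dots> = (\<Sum>k\<in>{..n - i}. c (i + k) * of_real ((t - a) ^ k / fact k))"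
    by (rule sum.reindex_bij_witness[of _ "\<lambda>k. i + k" "\<lambda>k. k - i"]) (use assms in auto)
  finally show ?thesis .
qed

lemma taylor_seq_at: "taylor_seq n c a i a = (if i \<le> n then c i else 0)"
proof -
  have "taylor_seq n c a i a = (\<Sum>k\<le>n. if k = i then c i else 0)"
    unfolding taylor_seq_def by (intro sum.cong) auto
  then show ?thesis by auto
qed

lemma mean_value_bound:
  fixes h :: "real \<Rightarrow> complex"
  assumes "\<And>t. t \<in> closed_segment a b \<Longrightarrow> (h has_vector_derivative h' t) (at t)"
    and "\<And>t. t \<in> closed_segment a b \<Longrightarrow> norm (h' t) \<le> M"
  shows "norm (h b - h a) \<le> M * \<bar>b - a\<bar>"
proof -
  have "norm (h b - h a) \<le> M * norm (b - a)"
  proof (rule differentiable_bound[where S = "closed_segment a b" and f' = "\<lambda>t s. s *\<^sub>R h' t"])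
    show "(h has_derivative (\<lambda>s. s *\<^sub>R h' t)) (at t within closed_segment a b)"
      if "t \<in> closed_segment a b" for t
      using assms(1)[OF that] by (auto simp: has_vector_derivative_def intro: has_derivative_at_withinI)
    show "onorm (\<lambda>s. s *\<^sub>R h' t) \<le> M" if "t \<in> closed_segment a b" for t
      using assms(2)[OF that] norm_ge_zero[of "h' t"]
      by (intro onorm_le) (auto simp: mult.commute[of M] intro!: mult_left_mono)
  qed auto
  then show ?thesis by simp
qed

text \<open>Induction on n: the bound for the remainder of the derivative holds on the whole
  segment, and the mean value inequality integrates it once. The factor 1/(n+1)! is lost, which
  affects constants only.\<close>

lemma taylor_bound_1:
  fixes h :: "nat \<Rightarrow> real \<Rightarrow> complex"
  assumes "\<And>k t. (h k has_vector_derivative h (Suc k) t) (at t)"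
    and "\<And>t. t \<in> closed_segment a b \<Longrightarrow> norm (h (Suc n) t) \<le> M"
  shows "norm (h 0 b - (\<Sum>k\<le>n. h k a * of_real ((b - a) ^ k / fact k))) \<le> M * \<bar>b - a\<bar> ^ Suc n"
  using assms
proof (induction n arbitrary: h b)
  case 0
  then show ?case using mean_value_bound[of a b "h 0" "h (Suc 0)" M] by simp
next
  case (Suc n)
  have M: "0 \<le> M" using Suc.prems(2)[of a] norm_ge_zero order_trans by blast
  define c where "c = (\<lambda>k. h k a)"
  define r where "r = (\<lambda>i t. h i t - taylor_seq (Suc n) c a i t)"
  have *: "norm (r 1 t) \<le> M * \<bar>b - a\<bar> ^ Suc n" if t: "t \<in> closed_segment a b" for t
  proof -
    have sub: "closed_segment a t \<subseteq> closed_segment a b"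
      using t by (simp add: subset_closed_segment)
    have "norm (h (Suc 0) t - (\<Sum>k\<le>n. h (Suc k) a * of_real ((t - a) ^ k / fact k))) \<le> M * \<bar>t - a\<bar> ^ Suc n"
      using Suc.prems sub by (intro Suc.IH) auto
    also have "\<dots> \<le> M * \<bar>b - a\<bar> ^ Suc n"
    proof -
      have "\<bar>t - a\<bar> \<le> \<bar>b - a\<bar>" using t by (auto simp: closed_segment_eq_real_ivl split: if_splits)
      then show ?thesis using M by (intro mult_left_mono power_mono) auto
    qed
    finally show ?thesis by (simp add: r_def taylor_seq_shift c_def)
  qed
  have "norm (r 0 b - r 0 a) \<le> (M * \<bar>b - a\<bar> ^ Suc n) * \<bar>b - a\<bar>"
  proof (rule mean_value_bound[where h' = "r 1"])
    show "(r 0 has_vector_derivative r 1 t) (at t)" for t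
      unfolding r_def using has_vector_derivative_diff[OF Suc.prems(1)[of 0 t] deriv_seqD[OF deriv_seq_taylor_seq, of "Suc n" c a 0 t]]
      by simp
  qed (use * in auto)
  moreover have "r 0 a = 0" by (simp add: r_def taylor_seq_at c_def)
  ultimately show ?case by (simp add: r_def taylor_seq_shift c_def mult_ac del: sum.atMost_Suc)
qed

subsection \<open>A smooth step and a partition of unity on a grid\<close>

text \<open>The flat function exp(-1/t) with a polynomial in 1/t in front. This class is closed
  under differentiation, so all derivatives arise by iterating one map on polynomials.\<close>

definition exp_tail :: "real poly \<Rightarrow> real \<Rightarrow> real" where
  "exp_tail p t = (if t > 0 then poly p (1 / t) * exp (- (1 / t)) else 0)"

lemma poly_times_exp_tendsto_0: "((\<lambda>x::real. poly p x * exp (- x)) \<longlongrightarrow> 0) at_top"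
proof -
  have "((\<lambda>x::real. \<Sum>i\<le>degree p. coeff p i * (x ^ i / exp x)) \<longlongrightarrow> (\<Sum>i\<le>degree p. coeff p i * 0)) at_top"
    by (intro tendsto_intros tendsto_power_div_exp_0)
  then show ?thesis
    by (simp add: poly_altdef sum_distrib_right exp_minus divide_inverse mult.assoc)
qed

lemma exp_tail_tendsto_0: "(exp_tail p \<longlongrightarrow> 0) (at 0)"
proof -
  have "((\<lambda>t. poly p (inverse t) * exp (- (inverse t))) \<longlongrightarrow> 0) (at_right (0::real))"
    by (rule filterlim_compose[OF poly_times_exp_tendsto_0 filterlim_inverse_at_top_right])
  then have R: "(exp_tail p \<longlongrightarrow> 0) (at_right 0)"
    by (rule Lim_transform_eventually)
      (auto simp: eventually_at_filter exp_tail_def inverse_eq_divide)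
  have L: "(exp_tail p \<longlongrightarrow> 0) (at_left 0)"
    by (rule Lim_transform_eventually[OF tendsto_const]) (auto simp: eventually_at_filter exp_tail_def)
  show ?thesis using L R by (simp add: filterlim_split_at)
qed

text \<open>For t > 0 the chain rule gives the factor 1/t^2, encoded by \<open>[:0, 0, 1:]\<close>,
  times p - p' at 1/t.\<close>

lemma exp_tail_has_real_derivative:
  "(exp_tail p has_real_derivative exp_tail ([:0, 0, 1:] * (p - pderiv p)) t) (at t)"
proof -
  consider "t < 0" | "t = 0" | "t > 0" by linarith
  then show ?thesis
  proof cases
    case 1
    have "((\<lambda>_. 0) has_real_derivative 0) (at t)" by simp
    then have "(exp_tail p has_real_derivative 0) (at t)"
      by (rule has_field_derivative_transform_within_open[of _ _ _ "{..<0}"]) (use 1 in \<open>auto simp: exp_tail_def\<close>)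
    with 1 show ?thesis by (simp add: exp_tail_def)
  next
    case 2
    \<comment> \<open>Dividing by h multiplies the polynomial by 1/h, which is
      \<open>pCons 0 p\<close>, so the difference quotient at 0 stays in the class.\<close>
    have "((\<lambda>h. exp_tail p h / h) \<longlongrightarrow> 0) (at 0)"
    proof (rule Lim_transform_eventually[OF exp_tail_tendsto_0[of "pCons 0 p"]])
      show "\<forall>\<^sub>F x in at 0. exp_tail (pCons 0 p) x = exp_tail p x / x"
        by (auto simp: eventually_at_filter exp_tail_def)
    qed
    with 2 show ?thesis by (simp add: DERIV_def exp_tail_def)
  next
    case 3
    have "((\<lambda>t. poly p (1 / t) * exp (- (1 / t))) has_real_derivative
        poly (pderiv p) (1 / t) * (- 1 / t\<^sup>2) * exp (- (1 / t)) + exp (- (1 / t)) * (1 / t\<^sup>2) * poly p (1 / t)) (at t)"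
    proof -
      have d: "((\<lambda>t. 1 / t) has_real_derivative (- 1 / t\<^sup>2)) (at t)"
        using 3 by (auto intro!: derivative_eq_intros simp: power2_eq_square field_simps)
      have "((\<lambda>t. poly p (1 / t)) has_real_derivative poly (pderiv p) (1 / t) * (- 1 / t\<^sup>2)) (at t)"
        by (rule DERIV_chain2[OF poly_DERIV d])
      moreover have "((\<lambda>t. exp (- (1 / t))) has_real_derivative exp (- (1 / t)) * (1 / t\<^sup>2)) (at t)"
        using DERIV_chain2[OF DERIV_exp DERIV_minus[OF d]] by simp
      ultimately show ?thesis by (rule DERIV_mult)
    qed
    also have "poly (pderiv p) (1 / t) * (- 1 / t\<^sup>2) * exp (- (1 / t)) + exp (- (1 / t)) * (1 / t\<^sup>2) * poly p (1 / t)
       = exp_tail ([:0, 0, 1:] * (p - pderiv p)) t"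
      using 3 by (simp add: exp_tail_def power2_eq_square field_simps)
    finally show ?thesis
      by (rule has_field_derivative_transform_within_open[of _ _ _ "{0<..}"]) (use 3 in \<open>auto simp: exp_tail_def\<close>)
  qed
qed

definition exp_tail_seq :: "nat \<Rightarrow> real \<Rightarrow> complex" where
  "exp_tail_seq n t = of_real (exp_tail (((\<lambda>p. [:0, 0, 1:] * (p - pderiv p)) ^^ n) 1) t)"

lemma deriv_seq_exp_tail_seq: "deriv_seq exp_tail_seq"
  unfolding deriv_seq_def exp_tail_seq_def[abs_def] funpow.simps o_def
  by (intro allI has_vector_derivative_of_real)
    (simp only: has_real_derivative_iff_has_vector_derivative[symmetric] exp_tail_has_real_derivative)

text \<open>Derivatives within S are unique since S has no isolated points. This includes closed
  half-lines, so all derivatives are known at their end points as well.\<close>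

lemma deriv_seq_const_on:
  assumes "deriv_seq h" "\<And>t. t \<in> S \<Longrightarrow> h 0 t = c" "\<And>t. t \<in> S \<Longrightarrow> t islimpt S" "t \<in> S"
  shows "h n t = const_seq c n t"
proof -
  have "\<forall>t\<in>S. h n t = const_seq c n t"
  proof (induction n)
    case 0
    then show ?case using assms by (simp add: const_seq_def)
  next
    case (Suc n)
    show ?case
    proof
      fix t assume t: "t \<in> S"
      have "(const_seq c n has_vector_derivative const_seq c (Suc n) t) (at t within S)"
        using deriv_seqD[OF deriv_seq_const] has_vector_derivative_at_within by blast
      then have "(h n has_vector_derivative const_seq c (Suc n) t) (at t within S)"
        by (rule has_vector_derivative_transform[rotated 2]) (use Suc t in auto)
      moreover have "(h n has_vector_derivative h (Suc n) t) (at t within S)"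
        using deriv_seqD[OF assms(1)] has_vector_derivative_at_within by blast
      ultimately show "h (Suc n) t = const_seq c (Suc n) t"
        using vector_derivative_unique_within trivial_limit_within assms(3)[OF t] by blast
    qed
  qed
  with assms show ?thesis by blast
qed

text \<open>The normalised primitive of the bump exp(-1/t) exp(-1/(1-t)) on (0, 1). The nonzero
  slope at 1/2 is recorded for the solution in a thin strip, whose derivative on the central line
  must not vanish.\<close>

lemma smooth_step_exists:
  "\<exists>s. deriv_seq s \<and> (\<forall>t\<le>0. s 0 t = 0) \<and> (\<forall>t\<ge>1. s 0 t = 1) \<and> s 1 (1/2) \<noteq> 0"
proof -
  define b where "b = leibniz exp_tail_seq (\<lambda>n t. of_real ((-1) ^ n) * exp_tail_seq n ((-1) * t + 1))"
  have "deriv_seq b"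
    unfolding b_def by (intro deriv_seq_leibniz deriv_seq_exp_tail_seq deriv_seq_affine)
  then obtain B where B: "deriv_seq B" "\<And>n. B (Suc n) = b n" "B 0 0 = 0"
    using deriv_seq_antiderivative by metis
  define b0 where "b0 = (\<lambda>t. exp_tail 1 t * exp_tail 1 (1 - t))"
  have b0: "b 0 t = of_real (b0 t)" for t
    by (simp add: b_def leibniz_def exp_tail_seq_def b0_def)
  have b0_pos: "0 < t \<Longrightarrow> t < 1 \<Longrightarrow> b0 t > 0" and b0_zero: "t \<le> 0 \<or> 1 \<le> t \<Longrightarrow> b0 t = 0" for t
    by (auto simp: b0_def exp_tail_def)
  have dB: "(B 0 has_vector_derivative of_real (b0 t)) (at t)" for t
    using deriv_seqD[OF B(1), of 0 t] by (simp add: B(2) b0)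
  have Bneg: "B 0 t = 0" if "t \<le> 0" for t
    using mean_value_bound[of t 0 "B 0" "\<lambda>t. of_real (b0 t)" 0, OF dB] b0_zero that B(3)
    by (auto simp: closed_segment_eq_real_ivl)
  have Bpos: "B 0 t = B 0 1" if "1 \<le> t" for t
    using mean_value_bound[of 1 t "B 0" "\<lambda>t. of_real (b0 t)" 0, OF dB] b0_zero that
    by (auto simp: closed_segment_eq_real_ivl split: if_splits)
  have "((\<lambda>t. Re (B 0 t)) has_real_derivative b0 t) (at t)" for t
    using bounded_linear.has_vector_derivative[OF bounded_linear_Re dB, of t] by (simp add: has_real_derivative_iff_has_vector_derivative)
  then have "Re (B 0 0) < Re (B 0 1)"
    by (intro DERIV_pos_imp_increasing_open[of 0 1 "\<lambda>t. Re (B 0 t)"])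
      (auto intro!: exI b0_pos DERIV_continuous_on intro: has_field_derivative_at_within)
  then have nz: "B 0 1 \<noteq> 0" using B(3) by auto
  define s where "s = (\<lambda>n t. inverse (B 0 1) * B n t)"
  have "deriv_seq s"
    using B(1) unfolding s_def deriv_seq_def by (auto intro!: has_vector_derivative_mult_right)
  moreover have "s 1 (1/2) \<noteq> 0"
    using b0_pos[of "1/2"] nz by (simp add: s_def B(2) b0 flip: One_nat_def) (simp add: B(2) b0)
  moreover have "s 0 t = 0" if "t \<le> 0" for t
    using Bneg[OF that] by (simp add: s_def)
  moreover have "s 0 t = 1" if "1 \<le> t" for t
    unfolding s_def Bpos[OF that] using nz by simp
  ultimately show ?thesis by blast
qed

definition smooth_step :: "nat \<Rightarrow> real \<Rightarrow> complex" where
  "smooth_step = (SOME s. deriv_seq s \<and> (\<forall>t\<le>0. s 0 t = 0) \<and> (\<forall>t\<ge>1. s 0 t = 1) \<and> s 1 (1/2) \<noteq> 0)"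

lemma smooth_step_props:
  "deriv_seq smooth_step \<and> (\<forall>t\<le>0. smooth_step 0 t = 0) \<and> (\<forall>t\<ge>1. smooth_step 0 t = 1) \<and> smooth_step 1 (1/2) \<noteq> 0"
  using someI_ex[OF smooth_step_exists] unfolding smooth_step_def by simp

lemma deriv_seq_smooth_step: "deriv_seq smooth_step"
  using smooth_step_props by blast

lemma islimpt_atMost_real: "t \<le> a \<Longrightarrow> t islimpt {..a::real}"
  by (rule islimpt_subset[OF islimpt_greaterThanLessThan2[of "t - 1" t]]) auto

lemma islimpt_atLeast_real: "a \<le> t \<Longrightarrow> t islimpt {a::real..}"
  by (rule islimpt_subset[OF islimpt_greaterThanLessThan1[of t "t + 1"]]) auto

lemma smooth_step_nonpos: "t \<le> 0 \<Longrightarrow> smooth_step n t = 0"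
  using deriv_seq_const_on[OF deriv_seq_smooth_step, of "{..0}" 0 t n] smooth_step_props islimpt_atMost_real
  by (auto simp: const_seq_def)

lemma smooth_step_ge_1: "1 \<le> t \<Longrightarrow> smooth_step n t = const_seq 1 n t"
  using deriv_seq_const_on[OF deriv_seq_smooth_step, of "{1..}" 1 t n] smooth_step_props islimpt_atLeast_real
  by auto

text \<open>Consecutive differences of the step telescope, so the integer translates of
  \<open>hat\<close> add up to 1 and their derivatives add up to 0.\<close>

definition hat :: "nat \<Rightarrow> real \<Rightarrow> complex" where
  "hat n t = smooth_step n (t + 1) - smooth_step n t"

lemma deriv_seq_hat: "deriv_seq hat"
  using deriv_seq_diff[OF deriv_seq_affine[OF deriv_seq_smooth_step, of 1 1] deriv_seq_smooth_step]
  by (simp add: hat_def[abs_def])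

lemma hat_eq_0: "1 \<le> \<bar>t\<bar> \<Longrightarrow> hat n t = 0"
proof -
  assume "1 \<le> \<bar>t\<bar>"
  then consider "t \<le> -1" | "1 \<le> t" by linarith
  then show ?thesis
    by cases (auto simp: hat_def smooth_step_nonpos smooth_step_ge_1 const_seq_def)
qed

lemma hat_deriv_nonzero: "hat 1 (1/2) \<noteq> 0"
  using smooth_step_props by (simp add: hat_def smooth_step_ge_1 const_seq_def)

lemma hat_bounded:
  obtains H where "0 \<le> H" "\<And>n t. n \<le> m \<Longrightarrow> norm (hat n t) \<le> H"
proof -
  have "\<exists>B. \<forall>t. norm (hat n t) \<le> B" for n
  proof -
    have "compact (hat n ` {-1..1})"
      by (intro compact_continuous_image continuous_at_imp_continuous_on ballI deriv_seq_isCont[OF deriv_seq_hat]) auto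
    then obtain B where B: "\<And>t. t \<in> {-1..1} \<Longrightarrow> norm (hat n t) \<le> B"
      by (meson bounded_iff compact_imp_bounded image_eqI)
    have "norm (hat n t) \<le> max B 0" for t
      by (cases "t \<in> {-1..1}") (use B in \<open>auto simp: hat_eq_0 max.coboundedI1\<close>)
    then show ?thesis by blast
  qed
  then obtain B where B: "\<And>n t. norm (hat n t) \<le> B n" by metis
  have "norm (hat n t) \<le> (\<Sum>k\<le>m. \<bar>B k\<bar>)" if "n \<le> m" for n t
  proof -
    have "\<bar>B n\<bar> \<le> (\<Sum>k\<le>m. \<bar>B k\<bar>)" using that by (intro member_le_sum) auto
    with B[of n t] show ?thesis by linarith
  qed
  then show ?thesis by (intro that[of "\<Sum>k\<le>m. \<bar>B k\<bar>"]) (auto intro: sum_nonneg)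
qed

lemma sum_hat:
  assumes "\<bar>t\<bar> \<le> real M"
  shows "(\<Sum>i\<in>{- int M..int M}. hat n (t - of_int i)) = const_seq 1 n t"
proof -
  have "(\<Sum>i\<in>{- int M..int M}. hat n (t - of_int i)) = smooth_step n (t + real M + 1) - smooth_step n (t - real M)"
  proof (induction M)
    case 0
    then show ?case by (simp add: hat_def)
  next
    case (Suc M)
    have "{- int (Suc M)..int (Suc M)} = insert (- int M - 1) (insert (int M + 1) {- int M..int M})"
      by auto
    then have "(\<Sum>i\<in>{- int (Suc M)..int (Suc M)}. hat n (t - of_int i))
      = hat n (t - of_int (- int M - 1)) + (hat n (t - of_int (int M + 1)) + (\<Sum>i\<in>{- int M..int M}. hat n (t - of_int i)))"
      by (simp only:) simp
    moreover have "t - of_int (- int M - 1) = t + real M + 1" "t - of_int (int M + 1) = t - real M - 1"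
      by simp_all
    moreover have "t + real (Suc M) + 1 = t + real M + 1 + 1" "t - real (Suc M) = t - real M - 1"
      by simp_all
    ultimately show ?case
      by (simp only: Suc.IH) (simp add: hat_def)
  qed
  then show ?thesis
    using assms by (simp add: smooth_step_nonpos smooth_step_ge_1 const_seq_def)
qed

text \<open>The argument is left in the form c * t + b and the powers of c = 1/d are explicit
  because \<open>deriv_seq_affine\<close> delivers them so; each derivative costs a factor
  1/d.\<close>

definition cell :: "real \<Rightarrow> int \<Rightarrow> nat \<Rightarrow> real \<Rightarrow> complex" where
  "cell d i n t = of_real ((1 / d) ^ n) * hat n (1 / d * t + (- of_int i))"

lemma deriv_seq_cell: "deriv_seq (cell d i)"
  unfolding cell_def[abs_def] by (rule deriv_seq_affine[OF deriv_seq_hat])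

lemma cell_arg: "d > 0 \<Longrightarrow> \<bar>1 / d * t + (- of_int i)\<bar> = \<bar>t - d * of_int i\<bar> / d" for t d :: real
proof -
  assume "d > 0"
  then have "1 / d * t + (- of_int i) = (t - d * of_int i) / d" by (simp add: field_simps)
  then show ?thesis using \<open>d > 0\<close> by simp
qed

lemma cell_eq_0:
  assumes "d > 0" "d \<le> \<bar>t - d * of_int i\<bar>"
  shows "cell d i n t = 0"
proof -
  have "1 \<le> \<bar>1 / d * t + (- of_int i)\<bar>"
    unfolding cell_arg[OF assms(1)] using assms by simp
  then show ?thesis unfolding cell_def using hat_eq_0 by simp
qed

lemma sum_cell:
  assumes "d > 0" "\<bar>t\<bar> \<le> d * real M"
  shows "(\<Sum>i\<in>{- int M..int M}. cell d i n t) = const_seq 1 n t"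
proof -
  have "\<bar>1 / d * t\<bar> \<le> real M" using assms by (simp add: abs_mult pos_divide_le_eq mult.commute)
  from sum_hat[OF this, of n] have "(\<Sum>i\<in>{- int M..int M}. hat n (1 / d * t + (- of_int i))) = const_seq 1 n (1 / d * t)"
    by (simp only: diff_conv_add_uminus)
  then show ?thesis
    unfolding cell_def sum_distrib_left[symmetric] by (simp add: const_seq_def)
qed

lemma norm_cell_le:
  assumes "d > 0" "\<And>t. norm (hat n t) \<le> H"
  shows "norm (cell d i n t) \<le> H / d ^ n"
proof -
  have "norm (cell d i n t) = norm (hat n (1 / d * t + (- of_int i))) / d ^ n"
    using assms(1) unfolding cell_def norm_mult norm_of_real by (simp add: power_divide)
  then show ?thesis using assms by (simp add: divide_right_mono)
qed

subsection \<open>Families of mixed partial derivatives in two variables\<close>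

type_synonym deriv_family = "nat \<Rightarrow> nat \<Rightarrow> real \<Rightarrow> real \<Rightarrow> complex"

text \<open>
  Restricting to finite sums of products reduces mixed antiderivatives to antiderivatives in one
  variable, so no differentiation under the integral sign is needed.
\<close>

inductive tensor :: "deriv_family \<Rightarrow> bool" where
  tensor_prod: "deriv_seq a \<Longrightarrow> deriv_seq b \<Longrightarrow> tensor (\<lambda>i j u v. a i u * b j v)"
| tensor_add: "tensor f \<Longrightarrow> tensor g \<Longrightarrow> tensor (\<lambda>i j u v. f i j u v + g i j u v)"

definition mulU :: "(nat \<Rightarrow> real \<Rightarrow> complex) \<Rightarrow> deriv_family \<Rightarrow> deriv_family" where
  "mulU a f = (\<lambda>i j u v. leibniz a (\<lambda>i u. f i j u v) i u)"

definition mulV :: "(nat \<Rightarrow> real \<Rightarrow> complex) \<Rightarrow> deriv_family \<Rightarrow> deriv_family" where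
  "mulV b f = (\<lambda>i j u v. leibniz b (\<lambda>j v. f i j u v) j v)"

lemma tensor_derivU: "tensor f \<Longrightarrow> ((\<lambda>s. f i j s v) has_vector_derivative f (Suc i) j u v) (at u)"
  by (induction rule: tensor.induct)
    (auto intro!: has_vector_derivative_add has_vector_derivative_mult_left simp: deriv_seqD)

lemma tensor_derivV: "tensor f \<Longrightarrow> ((\<lambda>t. f i j u t) has_vector_derivative f i (Suc j) u v) (at v)"
  by (induction rule: tensor.induct)
    (auto intro!: has_vector_derivative_add has_vector_derivative_mult_right simp: deriv_seqD)

lemma deriv_seq_tensorV: "tensor f \<Longrightarrow> deriv_seq (\<lambda>j v. f i j u v)"
  by (simp add: deriv_seq_def tensor_derivV)

lemma tensor_swap: "tensor f \<Longrightarrow> tensor (\<lambda>i j u v. f j i v u)"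
proof (induction rule: tensor.induct)
  case (tensor_prod a b)
  then show ?case using tensor.tensor_prod[of b a] by (simp add: mult.commute)
qed (rule tensor.tensor_add)

lemma tensor_uminus: "tensor f \<Longrightarrow> tensor (\<lambda>i j u v. - f i j u v)"
proof (induction rule: tensor.induct)
  case (tensor_prod a b)
  have "deriv_seq (\<lambda>i u. - a i u)"
    using tensor_prod by (auto simp: deriv_seq_def intro!: has_vector_derivative_minus)
  from tensor.tensor_prod[OF this tensor_prod(2)] show ?case by simp
next
  case (tensor_add f g)
  from tensor.tensor_add[OF tensor_add.IH] show ?case by simp
qed

lemma tensor_diff: "tensor f \<Longrightarrow> tensor g \<Longrightarrow> tensor (\<lambda>i j u v. f i j u v - g i j u v)"
  using tensor_add[OF _ tensor_uminus] by simp

lemma tensor_zero: "tensor (\<lambda>i j u v. 0)"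
  using tensor_prod[OF deriv_seq_const[of 0] deriv_seq_const[of 0]] by (simp add: const_seq_def)

lemma tensor_sum: "(\<And>p. p \<in> I \<Longrightarrow> tensor (S p)) \<Longrightarrow> tensor (\<lambda>i j u v. \<Sum>p\<in>I. S p i j u v)"
  by (induction I rule: infinite_finite_induct) (auto intro: tensor_zero tensor_add)

lemma tensor_fun_of_u: "deriv_seq a \<Longrightarrow> tensor (\<lambda>i j u v. a i u * const_seq 1 j v)"
  and tensor_fun_of_v: "deriv_seq b \<Longrightarrow> tensor (\<lambda>i j u v. const_seq 1 i u * b j v)"
  using tensor_prod deriv_seq_const by blast+

lemma tensor_shiftU: "tensor f \<Longrightarrow> tensor (\<lambda>i. f (Suc i))"
proof (induction rule: tensor.induct)
  case (tensor_prod a b)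
  from tensor.tensor_prod[OF deriv_seq_shift[OF tensor_prod(1)] tensor_prod(2)] show ?case .
next
  case (tensor_add f g)
  from tensor.tensor_add[OF tensor_add.IH] show ?case .
qed

lemma tensor_shiftV: "tensor f \<Longrightarrow> tensor (\<lambda>i j. f i (Suc j))"
proof (induction rule: tensor.induct)
  case (tensor_prod a b)
  from tensor.tensor_prod[OF tensor_prod(1) deriv_seq_shift[OF tensor_prod(2)]] show ?case .
next
  case (tensor_add f g)
  from tensor.tensor_add[OF tensor_add.IH] show ?case .
qed

lemma leibniz_add_right: "leibniz a (\<lambda>n t. f n t + g n t) n t = leibniz a f n t + leibniz a g n t"
  by (simp add: leibniz_def distrib_left sum.distrib)

lemma leibniz_diff_right: "leibniz a (\<lambda>n t. f n t - g n t) n t = leibniz a f n t - leibniz a g n t"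
  by (simp add: leibniz_def right_diff_distrib sum_subtractf)

lemma tensor_mulU:
  assumes "deriv_seq a"
  shows "tensor f \<Longrightarrow> tensor (mulU a f)"
proof (induction rule: tensor.induct)
  case (tensor_prod \<alpha> \<beta>)
  have "mulU a (\<lambda>i j u v. \<alpha> i u * \<beta> j v) = (\<lambda>i j u v. leibniz a \<alpha> i u * \<beta> j v)"
    by (simp add: mulU_def leibniz_def sum_distrib_right mult.assoc)
  with tensor.tensor_prod[OF deriv_seq_leibniz[OF assms tensor_prod(1)] tensor_prod(2)] show ?case by simp
next
  case (tensor_add f g)
  from tensor.tensor_add[OF tensor_add.IH] show ?case
    by (simp add: mulU_def leibniz_add_right)
qed

lemma tensor_mulV:
  assumes "deriv_seq a"
  shows "tensor f \<Longrightarrow> tensor (mulV a f)"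
proof (induction rule: tensor.induct)
  case (tensor_prod \<alpha> \<beta>)
  have "mulV a (\<lambda>i j u v. \<alpha> i u * \<beta> j v) = (\<lambda>i j u v. \<alpha> i u * leibniz a \<beta> j v)"
    by (simp add: mulV_def leibniz_def sum_distrib_left mult_ac)
  with tensor.tensor_prod[OF tensor_prod(1) deriv_seq_leibniz[OF assms tensor_prod(2)]] show ?case by simp
next
  case (tensor_add f g)
  from tensor.tensor_add[OF tensor_add.IH] show ?case
    by (simp add: mulV_def leibniz_add_right)
qed

text \<open>Each product is integrated factor by factor, with primitives that vanish at 0. Hence
  \<open>z\<close> and its derivatives along an axis vanish on that axis, and bounds for f turn into
  bounds for \<open>z\<close> by integrating from the axes.\<close>

lemma tensor_antiderivative:
  "tensor f \<Longrightarrow> \<exists>z. tensor z \<and> (\<forall>i j. z (Suc i) (Suc j) = f i j) \<and>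
     (\<forall>i u. z i 0 u 0 = 0) \<and> (\<forall>j v. z 0 j 0 v = 0)"
proof (induction rule: tensor.induct)
  case (tensor_prod a b)
  obtain A where A: "deriv_seq A" "\<And>n. A (Suc n) = a n" "A 0 0 = 0"
    using deriv_seq_antiderivative[OF tensor_prod(1)] by metis
  obtain B where B: "deriv_seq B" "\<And>n. B (Suc n) = b n" "B 0 0 = 0"
    using deriv_seq_antiderivative[OF tensor_prod(2)] by metis
  show ?case
    by (rule exI[of _ "\<lambda>i j u v. A i u * B j v"]) (simp add: tensor.tensor_prod A B)
next
  case (tensor_add f g)
  then obtain y z where
    "tensor y" "\<forall>i j. y (Suc i) (Suc j) = f i j" "\<forall>i u. y i 0 u 0 = 0" "\<forall>j v. y 0 j 0 v = 0"
    "tensor z" "\<forall>i j. z (Suc i) (Suc j) = g i j" "\<forall>i u. z i 0 u 0 = 0" "\<forall>j v. z 0 j 0 v = 0"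
    by blast
  then show ?case
    by (intro exI[of _ "\<lambda>i j u v. y i j u v + z i j u v"]) (simp add: tensor.tensor_add)
qed

lemma open_section_fst: "open N \<Longrightarrow> open {s. (s, v) \<in> N}"
  using open_vimage[of N "\<lambda>s. (s, v)"] by (simp add: vimage_def continuous_intros)

lemma open_section_snd: "open N \<Longrightarrow> open {t. (u, t) \<in> N}"
  using open_vimage[of N "\<lambda>t. (u, t)"] by (simp add: vimage_def continuous_intros)

lemma tensor_vanish_open:
  assumes "tensor f" "open N" "\<And>u v. (u, v) \<in> N \<Longrightarrow> f i0 j0 u v = 0" "(u, v) \<in> N"
  shows "f (i0 + i) (j0 + j) u v = 0"
proof -
  have lim: "t islimpt S" if "open S" "t \<in> S" for t :: real and S
    using interior_limit_point[of t S] that by (simp add: interior_open)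
  have 1: "f (i0 + i) j0 u v = 0" if "(u, v) \<in> N" for u v
  proof -
    have "deriv_seq (\<lambda>i u. f (i0 + i) j0 u v)"
      by (simp add: deriv_seq_def tensor_derivU[OF assms(1)])
    from deriv_seq_const_on[OF this, of "{s. (s, v) \<in> N}" 0 u i] show ?thesis
      using assms(3) lim[OF open_section_fst[OF assms(2)]] that by (simp add: const_seq_def)
  qed
  have "deriv_seq (\<lambda>j v. f (i0 + i) (j0 + j) u v)"
    by (simp add: deriv_seq_def tensor_derivV[OF assms(1)])
  from deriv_seq_const_on[OF this, of "{t. (u, t) \<in> N}" 0 v j] show ?thesis
    using 1 lim[OF open_section_snd[OF assms(2)]] assms(4) by (simp add: const_seq_def)
qed

text \<open>Expansion in v at b first, then of each coefficient in u at a, which gives the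
  triangular sum. The factor m + 2 in the proof counts one remainder in v and m + 1 remainders in u,
  each at most M r^(m+1).\<close>

lemma taylor_bound_2:
  assumes "tensor w" "i + j \<le> n" "\<bar>u - a\<bar> \<le> r" "\<bar>v - b\<bar> \<le> r"
    and M: "\<And>k l s t. k + l = Suc n \<Longrightarrow> s \<in> closed_segment a u \<Longrightarrow> t \<in> closed_segment b v \<Longrightarrow>
      norm (w k l s t) \<le> M"
  shows "norm (w i j u v - (\<Sum>l\<le>n - (i + j). \<Sum>k\<le>n - (i + j) - l.
      w (i + k) (j + l) a b * of_real ((u - a) ^ k / fact k) * of_real ((v - b) ^ l / fact l)))
    \<le> (real n + 2) * M * r ^ (Suc n - (i + j))"
proof -
  define m where "m = n - (i + j)"
  have nm: "n = i + j + m" using assms(2) by (simp add: m_def)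
  have M0: "0 \<le> M" by (rule order_trans[OF norm_ge_zero M[of 0 "Suc n" a b]]) auto
  have r0: "0 \<le> r" using assms(3) by linarith
  let ?p = "\<lambda>l. complex_of_real ((v - b) ^ l / fact l)"
  define W where "W = (\<lambda>l. \<Sum>k\<le>m - l. w (i + k) (j + l) a b * of_real ((u - a) ^ k / fact k))"
  have "norm (w i j u v - (\<Sum>l\<le>m. w i (j + l) u b * ?p l)) \<le> M * \<bar>v - b\<bar> ^ Suc m"
    using taylor_bound_1[of "\<lambda>l t. w i (j + l) u t" b v m M] M nm
    by (simp add: tensor_derivV[OF assms(1)])
  also have "\<dots> \<le> M * r ^ Suc m"
    using assms M0 by (intro mult_left_mono power_mono) auto
  finally have 1: "norm (w i j u v - (\<Sum>l\<le>m. w i (j + l) u b * ?p l)) \<le> M * r ^ Suc m" .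
  \<comment> \<open>The remainder in u has only the power r^(m - l + 1); the monomial of degree l in
    v supplies the missing r^l.\<close>
  have 2: "norm ((w i (j + l) u b - W l) * ?p l) \<le> M * r ^ Suc m" if "l \<le> m" for l
  proof -
    have "norm (w i (j + l) u b - W l) \<le> M * \<bar>u - a\<bar> ^ Suc (m - l)"
      using taylor_bound_1[of "\<lambda>k s. w (i + k) (j + l) s b" a u "m - l" M] M nm that
      by (simp add: tensor_derivU[OF assms(1)] W_def)
    also have "\<dots> \<le> M * r ^ Suc (m - l)"
      using assms M0 by (intro mult_left_mono power_mono) auto
    finally have A: "norm (w i (j + l) u b - W l) \<le> M * r ^ Suc (m - l)" .
    have "\<bar>v - b\<bar> ^ l / fact l \<le> \<bar>v - b\<bar> ^ l / 1"
      by (intro divide_left_mono) auto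
    also have "\<dots> \<le> r ^ l" using assms by (simp add: power_mono)
    finally have B: "norm (?p l) \<le> r ^ l"
      unfolding norm_of_real by (simp add: power_abs)
    have "norm ((w i (j + l) u b - W l) * ?p l) \<le> (M * r ^ Suc (m - l)) * r ^ l"
      unfolding norm_mult by (intro mult_mono A B) (use M0 r0 in auto)
    also have "\<dots> = M * r ^ Suc m"
      using that by (simp flip: power_add add: mult.assoc del: power_Suc)
    finally show ?thesis .
  qed
  have "norm (w i j u v - (\<Sum>l\<le>m. W l * ?p l))
    = norm ((w i j u v - (\<Sum>l\<le>m. w i (j + l) u b * ?p l)) + (\<Sum>l\<le>m. (w i (j + l) u b - W l) * ?p l))"
    by (simp only: left_diff_distrib sum_subtractf) (simp only: diff_add_eq_diff_diff_swap diff_add_cancel add_diff_eq)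
  also have "\<dots> \<le> M * r ^ Suc m + (\<Sum>l\<le>m. M * r ^ Suc m)"
    by (intro order_trans[OF norm_triangle_ineq] add_mono 1 order_trans[OF norm_sum] sum_mono 2) auto
  also have "\<dots> = (real m + 2) * (M * r ^ Suc m)" by (simp add: algebra_simps)
  also have "\<dots> \<le> (real n + 2) * (M * r ^ Suc m)"
    using M0 r0 nm by (intro mult_right_mono) auto
  finally have "norm (w i j u v - (\<Sum>l\<le>m. W l * ?p l)) \<le> (real n + 2) * M * r ^ Suc m"
    by (simp only: mult.assoc)
  moreover have "Suc n - (i + j) = Suc m" using nm by simp
  ultimately show ?thesis
    by (simp only: W_def sum_distrib_right m_def[symmetric])
qed

subsection \<open>Gluing with the grid partition of unity\<close>

definition glue :: "real \<Rightarrow> (int \<times> int) set \<Rightarrow> (int \<times> int \<Rightarrow> deriv_family) \<Rightarrow> deriv_family" where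
  "glue d I S = (\<lambda>i j u v. \<Sum>p\<in>I. mulU (cell d (fst p)) (mulV (cell d (snd p)) (S p)) i j u v)"

text \<open>The grid indices whose cells can be nonzero at (u, v). There are at most four of them
  for every \<open>d\<close>, so the constant in \<open>glue_bound\<close> does not depend on the
  scale.\<close>

definition active :: "real \<Rightarrow> real \<Rightarrow> real \<Rightarrow> (int \<times> int) set" where
  "active d u v = {p. \<bar>u - d * of_int (fst p)\<bar> < d \<and> \<bar>v - d * of_int (snd p)\<bar> < d}"

lemma tensor_glue: "(\<And>p. p \<in> I \<Longrightarrow> tensor (S p)) \<Longrightarrow> tensor (glue d I S)"
  unfolding glue_def by (intro tensor_sum tensor_mulU tensor_mulV deriv_seq_cell)

lemma glue_diff: "glue d I (\<lambda>p i j u v. S p i j u v - T p i j u v) i j u v = glue d I S i j u v - glue d I T i j u v"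
  by (simp add: glue_def mulU_def mulV_def leibniz_diff_right sum_subtractf)

lemma leibniz_zero_left: "(\<And>k. a k t = 0) \<Longrightarrow> leibniz a h n t = 0"
  and leibniz_zero_right: "(\<And>k. h k t = 0) \<Longrightarrow> leibniz a h n t = 0"
  by (simp_all add: leibniz_def)

lemma mul_cell_inactive:
  assumes "d > 0" "p \<notin> active d u v"
  shows "mulU (cell d (fst p)) (mulV (cell d (snd p)) f) i j u v = 0"
proof -
  consider "d \<le> \<bar>u - d * of_int (fst p)\<bar>" | "d \<le> \<bar>v - d * of_int (snd p)\<bar>"
    using assms(2) unfolding active_def by force
  then show ?thesis
  proof cases
    case 1
    then show ?thesis unfolding mulU_def by (intro leibniz_zero_left cell_eq_0 assms)
  next
    case 2
    then show ?thesis unfolding mulU_def mulV_def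
      by (intro leibniz_zero_right leibniz_zero_left cell_eq_0 assms)
  qed
qed

lemma glue_active: "d > 0 \<Longrightarrow> finite I \<Longrightarrow> glue d I S i j u v = glue d (I \<inter> active d u v) S i j u v"
  unfolding glue_def by (rule sum.mono_neutral_right) (auto simp: mul_cell_inactive)

lemma finite_active: "d > 0 \<Longrightarrow> finite (active d u v)"
  and card_active: "d > 0 \<Longrightarrow> card (active d u v) \<le> 4"
proof -
  assume d: "d > 0"
  define X where "X = (\<lambda>t. {i :: int. \<bar>t - d * of_int i\<bar> < d})"
  have *: "finite (X t) \<and> card (X t) \<le> 2" for t
  proof -
    have "X t \<subseteq> {\<lfloor>t / d\<rfloor>, \<lfloor>t / d\<rfloor> + 1}"
    proof
      fix i assume "i \<in> X t"
      then have "\<bar>t / d - of_int i\<bar> < 1"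
        using d cell_arg[of d t i] by (simp add: X_def)
      then show "i \<in> {\<lfloor>t / d\<rfloor>, \<lfloor>t / d\<rfloor> + 1}" by (simp; linarith)
    qed
    moreover have "card {\<lfloor>t / d\<rfloor>, \<lfloor>t / d\<rfloor> + 1} \<le> 2" by (simp add: card_insert_if)
    ultimately show ?thesis
      by (meson card_mono finite.emptyI finite_insert finite_subset order_trans)
  qed
  have A: "active d u v = X u \<times> X v" by (auto simp: active_def X_def)
  show "finite (active d u v)" using * A by simp
  have "card (X u) * card (X v) \<le> 2 * 2" using * by (intro mult_le_mono) auto
  then show "card (active d u v) \<le> 4" using A by (simp add: card_cartesian_product)
qed

text \<open>Bounds of the form M/d^k are stable under products: the powers of d in every Leibniz
  term add up to d^n and the binomial coefficients to 2^n.\<close>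

lemma leibniz_bound:
  assumes "d > 0" "0 \<le> H" "\<And>k. k \<le> n \<Longrightarrow> norm (a k t) \<le> H / d ^ k" "\<And>k. k \<le> n \<Longrightarrow> norm (h k t) \<le> M / d ^ k"
  shows "norm (leibniz a h n t) \<le> 2 ^ n * (H * M) / d ^ n"
proof -
  have "norm (leibniz a h n t) \<le> (\<Sum>k\<le>n. of_nat (n choose k) * ((H / d ^ k) * (M / d ^ (n - k))))"
    unfolding leibniz_def
  proof (intro order_trans[OF norm_sum] sum_mono)
    fix k assume "k \<in> {..n}"
    then have "norm (a k t) * norm (h (n - k) t) \<le> (H / d ^ k) * (M / d ^ (n - k))"
      using assms by (intro mult_mono) auto
    then have "of_nat (n choose k) * (norm (a k t) * norm (h (n - k) t)) \<le> of_nat (n choose k) * ((H / d ^ k) * (M / d ^ (n - k)))"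
      by (rule mult_left_mono) simp
    then show "norm (of_nat (n choose k) * a k t * h (n - k) t) \<le> of_nat (n choose k) * ((H / d ^ k) * (M / d ^ (n - k)))"
      by (simp only: norm_mult mult.assoc norm_of_nat)
  qed
  also have "\<dots> = (\<Sum>k\<le>n. of_nat (n choose k) * (H * M / d ^ n))"
    by (intro sum.cong refl) (simp flip: power_add)
  also have "\<dots> = of_nat (\<Sum>k\<le>n. n choose k) * (H * M / d ^ n)"
    by (simp only: of_nat_sum sum_distrib_right)
  also have "\<dots> = 2 ^ n * (H * M) / d ^ n"
    by (simp only: choose_row_sum) simp
  finally show ?thesis .
qed

text \<open>The cut-offs lose a factor 1/d per derivative, the same as the pieces are allowed to
  lose, so gluing changes the constant only. A piece is tested only where its own cell is active,
  which makes local estimates sufficient.\<close>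

lemma glue_bound:
  assumes d: "d > 0" and fin: "finite I" and H: "0 \<le> H" "\<And>n t. n \<le> m \<Longrightarrow> norm (hat n t) \<le> H"
    and M: "0 \<le> M" "\<And>p i j. p \<in> I \<Longrightarrow> p \<in> active d u v \<Longrightarrow> i + j \<le> m \<Longrightarrow> norm (S p i j u v) \<le> M / d ^ (i + j)"
    and ij: "i + j \<le> m"
  shows "norm (glue d I S i j u v) \<le> 4 * (2 ^ m * H)\<^sup>2 * M / d ^ (i + j)"
proof -
  let ?B = "(2 ^ m * H)\<^sup>2 * M / d ^ (i + j)"
  have B0: "0 \<le> ?B" using d M(1) by simp
  have V: "norm (mulV (cell d (snd p)) (S p) k j u v) \<le> (2 ^ m * (H * M) / d ^ j) / d ^ k"
    if p: "p \<in> I \<inter> active d u v" and k: "k \<le> i" for p k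
  proof -
    have "norm (mulV (cell d (snd p)) (S p) k j u v) \<le> 2 ^ j * (H * (M / d ^ k)) / d ^ j"
      unfolding mulV_def
      by (rule leibniz_bound[OF d H(1)])
        (use p k ij M(2)[of p k] in \<open>auto intro!: norm_cell_le[OF d] H(2) simp: power_add mult.commute\<close>)
    also have "\<dots> \<le> 2 ^ m * (H * (M / d ^ k)) / d ^ j"
      using ij H M d by (intro divide_right_mono mult_right_mono power_increasing) auto
    also have "\<dots> = (2 ^ m * (H * M) / d ^ j) / d ^ k" by simp
    finally show ?thesis .
  qed
  have U: "norm (mulU (cell d (fst p)) (mulV (cell d (snd p)) (S p)) i j u v) \<le> ?B"
    if p: "p \<in> I \<inter> active d u v" for p
  proof -
    have "norm (mulU (cell d (fst p)) (mulV (cell d (snd p)) (S p)) i j u v)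
      \<le> 2 ^ i * (H * (2 ^ m * (H * M) / d ^ j)) / d ^ i"
      unfolding mulU_def
      by (rule leibniz_bound[OF d H(1)]) (use V[OF p] ij in \<open>auto intro!: norm_cell_le[OF d] H(2)\<close>)
    also have "\<dots> \<le> 2 ^ m * (H * (2 ^ m * (H * M) / d ^ j)) / d ^ i"
      using ij H M d by (intro divide_right_mono mult_right_mono power_increasing) auto
    also have "\<dots> = ?B" by (simp add: power2_eq_square power_add mult_ac)
    finally show ?thesis .
  qed
  have "norm (glue d (I \<inter> active d u v) S i j u v) \<le> (\<Sum>p\<in>I \<inter> active d u v. ?B)"
    unfolding glue_def by (intro order_trans[OF norm_sum] sum_mono U)
  then have "norm (glue d I S i j u v) \<le> (\<Sum>p\<in>I \<inter> active d u v. ?B)"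
    by (simp only: glue_active[OF d fin, symmetric])
  also have "\<dots> = card (I \<inter> active d u v) * ?B" by simp
  also have "\<dots> \<le> 4 * ?B"
  proof (intro mult_right_mono B0)
    have "card (I \<inter> active d u v) \<le> card (active d u v)"
      by (intro card_mono finite_active[OF d]) auto
    with card_active[OF d, of u v] show "real (card (I \<inter> active d u v)) \<le> 4" by linarith
  qed
  finally show ?thesis by simp
qed

text \<open>Only active cells count, so I may be exchanged for a large symmetric box of indices.
  There the cells in each variable sum to 1 with all derivatives, and the Leibniz sums
  collapse.\<close>

lemma glue_const:
  assumes d: "d > 0" and fin: "finite I" and act: "active d u v \<subseteq> I"
  shows "glue d I (\<lambda>_. f) i j u v = f i j u v"
proof -
  obtain M :: nat where M: "\<bar>u\<bar> / d + \<bar>v\<bar> / d + 1 \<le> real M" using real_arch_simple by blast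
  have uv: "\<bar>u\<bar> \<le> d * real M" "\<bar>v\<bar> \<le> d * real M"
  proof -
    have "\<bar>u\<bar> / d \<le> real M" "\<bar>v\<bar> / d \<le> real M"
      using M d by (smt (verit) divide_nonneg_pos)+
    then show "\<bar>u\<bar> \<le> d * real M" "\<bar>v\<bar> \<le> d * real M" using d by (simp_all add: pos_divide_le_eq mult.commute)
  qed
  let ?Z = "{- int M..int M}"
  have "active d u v \<subseteq> ?Z \<times> ?Z"
  proof -
    have *: "i \<in> ?Z" if "\<bar>t - d * of_int i\<bar> < d" "\<bar>t\<bar> / d + 1 \<le> real M" for t i
    proof -
      have "\<bar>t / d - of_int i\<bar> < 1" using d cell_arg[of d t i] that by simp
      moreover have "\<bar>t / d\<bar> + 1 \<le> real M" using that d by simp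
      ultimately have "\<bar>real_of_int i\<bar> \<le> real M" by linarith
      then show ?thesis by simp linarith
    qed
    have "0 \<le> \<bar>u\<bar> / d" "0 \<le> \<bar>v\<bar> / d" using d by auto
    with M have "\<bar>u\<bar> / d + 1 \<le> real M" "\<bar>v\<bar> / d + 1 \<le> real M" by linarith+
    then show ?thesis using * unfolding active_def by fastforce
  qed
  then have "glue d (?Z \<times> ?Z) (\<lambda>_. f) i j u v = glue d (active d u v) (\<lambda>_. f) i j u v"
    using glue_active[OF d, of "?Z \<times> ?Z"] by (simp add: Int_absorb1)
  also have "\<dots> = glue d I (\<lambda>_. f) i j u v"
    using glue_active[OF d fin] act by (simp add: Int_absorb1)
  finally have "glue d I (\<lambda>_. f) i j u v = glue d (?Z \<times> ?Z) (\<lambda>_. f) i j u v" by simp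
  also have "\<dots> = (\<Sum>p\<in>?Z. \<Sum>q\<in>?Z. mulU (cell d p) (mulV (cell d q) f) i j u v)"
    by (simp add: glue_def sum.cartesian_product case_prod_unfold)
  also have "\<dots> = (\<Sum>p\<in>?Z. leibniz (cell d p) (\<lambda>i u. (\<Sum>q\<in>?Z. mulV (cell d q) f i j u v)) i u)"
    unfolding mulU_def leibniz_def sum_distrib_left by (intro sum.cong refl sum.swap)
  also have "\<dots> = leibniz (\<lambda>n t. \<Sum>p\<in>?Z. cell d p n t) (\<lambda>i u. (\<Sum>q\<in>?Z. mulV (cell d q) f i j u v)) i u"
    by (simp only: leibniz_sum_left)
  also have "\<dots> = leibniz (const_seq 1) (\<lambda>i u. (\<Sum>q\<in>?Z. mulV (cell d q) f i j u v)) i u"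
    unfolding leibniz_def using sum_cell[OF d uv(1)] by simp
  also have "\<dots> = (\<Sum>q\<in>?Z. mulV (cell d q) f i j u v)"
    by (simp add: leibniz_const_left)
  also have "\<dots> = leibniz (\<lambda>n t. \<Sum>q\<in>?Z. cell d q n t) (\<lambda>j v. f i j u v) j v"
    by (simp only: leibniz_sum_left mulV_def)
  also have "\<dots> = leibniz (const_seq 1) (\<lambda>j v. f i j u v) j v"
    unfolding leibniz_def using sum_cell[OF d uv(2)] by simp
  finally show ?thesis by (simp add: leibniz_const_left)
qed

subsection \<open>Solutions of the wave equation near a compact set\<close>

text \<open>Sections of a compact set vary upper semicontinuously: near the height c they stay in a
  small convex neighbourhood of the section at c. A Lebesgue number makes the height of the tubes
  uniform.\<close>

lemma compact_tubes:
  fixes K N :: "(real \<times> real) set"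
  assumes K: "compact K" and N: "open N" "K \<subseteq> N" and conv: "\<And>v. convex {u. (u, v) \<in> K}"
  obtains e where "e > 0" "\<And>c. c \<in> snd ` K \<Longrightarrow> \<exists>J. open J \<and> convex J \<and>
    (\<forall>u\<in>J. \<forall>v. \<bar>v - c\<bar> < e \<longrightarrow> (u, v) \<in> N) \<and> (\<forall>u v. (u, v) \<in> K \<longrightarrow> \<bar>v - c\<bar> < e \<longrightarrow> u \<in> J)"
proof -
  obtain d where d: "d > 0" "(\<Union>x\<in>K. ball x d) \<subseteq> N"
    using compact_subset_open_imp_ball_epsilon_subset[OF K N] .
  define J where "J = (\<lambda>c. \<Union>u\<in>{u. (u, c) \<in> K}. \<Union>s\<in>ball 0 (d / 2). {u + s})"
  have J_open: "open (J c)" for c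
    unfolding J_def by (rule open_sums) auto
  have J_convex: "convex (J c)" for c
    unfolding J_def by (rule convex_sums[OF conv convex_ball])
  have J_N: "(u, v) \<in> N" if uJ: "u \<in> J c" "\<bar>v - c\<bar> < d / 2" for u v c
  proof -
    obtain u' t where "(u', c) \<in> K" "t \<in> ball 0 (d / 2)" "u = u' + t" using uJ(1) unfolding J_def by blast
    then have u': "(u', c) \<in> K" "\<bar>u - u'\<bar> < d / 2" by simp_all
    have "dist (u', c) (u, v) \<le> dist u' u + dist c v"
      unfolding dist_Pair_Pair by (rule sqrt_sum_squares_le_sum) auto
    also have "\<dots> < d" using u' uJ unfolding dist_real_def by linarith
    finally have "(u, v) \<in> ball (u', c) d" by (simp only: mem_ball)
    then show ?thesis using u'(1) d(2) by blast
  qed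
  have "\<exists>r>0. \<forall>u v. (u, v) \<in> K \<longrightarrow> \<bar>v - c\<bar> < r \<longrightarrow> u \<in> J c" for c
  proof -
    \<comment> \<open>Heights at which K has a point outside \<open>J c\<close>; a closed set that
      misses c.\<close>
    define B where "B = snd ` (K - J c \<times> UNIV)"
    have "compact (K - J c \<times> UNIV)"
      by (intro compact_diff K open_Times J_open open_UNIV)
    then have "closed B"
      unfolding B_def by (intro compact_imp_closed compact_continuous_image continuous_intros)
    moreover have "c \<notin> B"
    proof
      assume "c \<in> B"
      then obtain p where "p \<in> K - J c \<times> UNIV" "c = snd p" unfolding B_def by blast
      then obtain u where u: "(u, c) \<in> K" "u \<notin> J c" by (cases p) auto
      have "\<exists>t\<in>ball 0 (d / 2). u = u + t" using d by (intro bexI[of _ 0]) auto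
      then have "u \<in> J c" using u(1) unfolding J_def by blast
      with u show False by simp
    qed
    ultimately obtain r where r: "r > 0" "ball c r \<subseteq> - B"
      using open_contains_ball[of "- B"] by (auto simp: closed_def)
    show ?thesis
    proof (intro exI[of _ r] conjI allI impI \<open>r > 0\<close>)
      fix u v assume uv: "(u, v) \<in> K" "\<bar>v - c\<bar> < r"
      then have "v \<notin> B" using r by (auto simp: dist_real_def abs_minus_commute)
      with uv show "u \<in> J c" unfolding B_def by force
    qed
  qed
  then obtain r where r: "\<And>c. r c > 0" "\<And>c u v. (u, v) \<in> K \<Longrightarrow> \<bar>v - c\<bar> < r c \<Longrightarrow> u \<in> J c"
    by metis
  have "compact (snd ` K)" by (intro compact_continuous_image continuous_intros K)
  \<comment> \<open>The tube around x is the one of a centre c whose ball contains the ball of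
    radius e about x, so its interval is \<open>J c\<close> and not \<open>J x\<close>.\<close>
  then obtain e where e: "e > 0" "\<And>x. x \<in> snd ` K \<Longrightarrow> \<exists>G\<in>(\<lambda>c. ball c (min (r c) (d / 2))) ` snd ` K. ball x e \<subseteq> G"
    by (rule Heine_Borel_lemma[of _ "(\<lambda>c. ball c (min (r c) (d / 2))) ` snd ` K"]) (use r d in force)+
  show ?thesis
  proof (rule that[OF e(1)])
    fix x assume "x \<in> snd ` K"
    then obtain c where c: "ball x e \<subseteq> ball c (min (r c) (d / 2))" using e(2) by blast
    have *: "\<bar>v - c\<bar> < r c" "\<bar>v - c\<bar> < d / 2" if "\<bar>v - x\<bar> < e" for v
    proof -
      have "v \<in> ball x e" using that by (simp add: dist_real_def abs_minus_commute)
      then have "v \<in> ball c (min (r c) (d / 2))" using c by blast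
      then show "\<bar>v - c\<bar> < r c" "\<bar>v - c\<bar> < d / 2" by (auto simp: dist_real_def abs_minus_commute)
    qed
    show "\<exists>J. open J \<and> convex J \<and>
       (\<forall>u\<in>J. \<forall>v. \<bar>v - x\<bar> < e \<longrightarrow> (u, v) \<in> N) \<and> (\<forall>u v. (u, v) \<in> K \<longrightarrow> \<bar>v - x\<bar> < e \<longrightarrow> u \<in> J)"
      using * J_open J_convex J_N r(2) by (intro exI[of _ "J c"]) blast
  qed
qed

lemma finite_int_bounded: "finite {j::int. \<bar>of_int j\<bar> \<le> (B::real)}"
proof -
  have "{j::int. \<bar>of_int j\<bar> \<le> B} \<subseteq> {- \<lceil>B\<rceil>..\<lceil>B\<rceil>}"
    by (auto simp: abs_le_iff) linarith+
  then show ?thesis using finite_subset by blast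
qed

text \<open>
  Locally near \<open>K\<close> the family depends on \<open>v\<close> only, and since the slices of \<open>K\<close> are intervals it
  does so through one function on each tube. A partition of unity in \<open>v\<close> at the scale of the tubes
  puts these functions together; no compatibility off \<open>K\<close> is needed because near a point of \<open>K\<close>
  all tubes that meet the support give the same value.
\<close>

lemma function_of_v_near:
  assumes f: "tensor f" and K: "compact K" and N: "open N" "K \<subseteq> N"
    and conv: "\<And>v. convex {u. (u, v) \<in> K}" and zero: "\<And>u v. (u, v) \<in> N \<Longrightarrow> f 1 0 u v = 0"
  obtains h N' where "deriv_seq h" "open N'" "K \<subseteq> N'" "\<And>u v. (u, v) \<in> N' \<Longrightarrow> f 0 0 u v = h 0 v"
proof -
  obtain e where e: "e > 0" and "\<forall>c\<in>snd ` K. \<exists>J. open J \<and> convex J \<and>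
    (\<forall>u\<in>J. \<forall>v. \<bar>v - c\<bar> < e \<longrightarrow> (u, v) \<in> N) \<and> (\<forall>u v. (u, v) \<in> K \<longrightarrow> \<bar>v - c\<bar> < e \<longrightarrow> u \<in> J)"
    using compact_tubes[OF K N conv] by metis
  from this(2) obtain J where "\<forall>c\<in>snd ` K. open (J c) \<and> convex (J c) \<and>
    (\<forall>u\<in>J c. \<forall>v. \<bar>v - c\<bar> < e \<longrightarrow> (u, v) \<in> N) \<and> (\<forall>u v. (u, v) \<in> K \<longrightarrow> \<bar>v - c\<bar> < e \<longrightarrow> u \<in> J c)"
    by (rule bchoice[THEN exE])
  then have J: "\<And>c. c \<in> snd ` K \<Longrightarrow> open (J c)" "\<And>c. c \<in> snd ` K \<Longrightarrow> convex (J c)"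
    "\<And>c u v. c \<in> snd ` K \<Longrightarrow> u \<in> J c \<Longrightarrow> \<bar>v - c\<bar> < e \<Longrightarrow> (u, v) \<in> N"
    "\<And>c u v. c \<in> snd ` K \<Longrightarrow> (u, v) \<in> K \<Longrightarrow> \<bar>v - c\<bar> < e \<Longrightarrow> u \<in> J c"
    by blast+
  \<comment> \<open>A quarter, because a height within 2 s of a grid point and a centre within 2 s
    of the same grid point must differ by less than e.\<close>
  define s where "s = e / 4"
  have s: "s > 0" "e = 4 * s" using e by (auto simp: s_def)
  define Z where "Z = {j::int. \<exists>c\<in>snd ` K. \<bar>c - s * of_int j\<bar> \<le> 2 * s}"
  have "finite Z"
  proof -
    have "bounded (snd ` K)"
      by (intro compact_imp_bounded compact_continuous_image continuous_intros K)
    then obtain B where B: "\<And>c. c \<in> snd ` K \<Longrightarrow> \<bar>c\<bar> \<le> B" unfolding bounded_iff by auto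
    have "Z \<subseteq> {j. \<bar>of_int j\<bar> \<le> (B + 2 * s) / s}"
    proof
      fix j assume "j \<in> Z"
      then obtain c where "c \<in> snd ` K" "\<bar>c - s * of_int j\<bar> \<le> 2 * s" by (auto simp: Z_def)
      with B[of c] have "\<bar>s * of_int j\<bar> \<le> B + 2 * s" by linarith
      then show "j \<in> {j. \<bar>of_int j\<bar> \<le> (B + 2 * s) / s}"
        using s by (simp add: abs_mult pos_le_divide_eq mult.commute)
    qed
    then show ?thesis using finite_int_bounded finite_subset by blast
  qed
  have "\<forall>j\<in>Z. \<exists>c\<in>snd ` K. \<bar>c - s * of_int j\<bar> \<le> 2 * s" by (simp add: Z_def)
  then obtain c where c: "\<And>j. j \<in> Z \<Longrightarrow> c j \<in> snd ` K" "\<And>j. j \<in> Z \<Longrightarrow> \<bar>c j - s * of_int j\<bar> \<le> 2 * s"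
    by metis
  have "\<exists>u. u \<in> J (c j)" if j: "j \<in> Z" for j
  proof -
    obtain u where u: "(u, c j) \<in> K" using c(1)[OF j] by fastforce
    show ?thesis using J(4)[OF c(1)[OF j] u] e by auto
  qed
  then obtain m where m: "\<And>j. j \<in> Z \<Longrightarrow> m j \<in> J (c j)" by metis
  define h where "h = (\<lambda>n v. \<Sum>j\<in>Z. leibniz (cell s j) (\<lambda>n v. f 0 n (m j) v) n v)"
  \<comment> \<open>Heights within s of that of x meet only cells whose grid point lies within 2 s
    of it; \<open>V x\<close> asks u to lie in the tubes of all those cells.\<close>
  define V where "V = (\<lambda>x::real \<times> real. (\<Inter>j\<in>{j\<in>Z. \<bar>snd x - s * of_int j\<bar> < 2 * s}. J (c j)) \<times> {v. \<bar>v - snd x\<bar> < s})"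
  show ?thesis
  proof (rule that[of h "\<Union>x\<in>K. V x"])
    show "deriv_seq h"
      unfolding h_def by (intro deriv_seq_sum deriv_seq_leibniz deriv_seq_cell deriv_seq_tensorV f)
    have "open {v. \<bar>v - y\<bar> < s}" for y :: real
      by (intro open_Collect_less continuous_intros)
    then show "open (\<Union>x\<in>K. V x)"
      unfolding V_def using \<open>finite Z\<close> J(1) c(1) by (intro open_UN ballI open_Times open_INT) auto
    show "K \<subseteq> (\<Union>x\<in>K. V x)"
    proof
      fix x assume x: "x \<in> K"
      have "fst x \<in> J (c j)" if j: "j \<in> Z" "\<bar>snd x - s * of_int j\<bar> < 2 * s" for j
        using J(4)[OF c(1)[OF j(1)], of "fst x" "snd x"] x c(2)[OF j(1)] j(2) s by auto
      then have "x \<in> V x" using s by (cases x) (auto simp: V_def)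
      with x show "x \<in> (\<Union>x\<in>K. V x)" by blast
    qed
    fix u v assume "(u, v) \<in> (\<Union>x\<in>K. V x)"
    then obtain x where x: "x \<in> K" "(u, v) \<in> V x" by blast
    have near: "j \<in> Z \<and> u \<in> J (c j)" if "\<bar>v - s * of_int j\<bar> < s" for j
    proof -
      have "\<bar>snd x - s * of_int j\<bar> < 2 * s" using that x(2) by (auto simp: V_def)
      then show ?thesis using x by (force simp: Z_def V_def)
    qed
    have eq: "cell s j 0 v * f 0 0 (m j) v = cell s j 0 v * f 0 0 u v" if j: "j \<in> Z" for j
    proof (cases "\<bar>v - s * of_int j\<bar> < s")
      case True
      then have "\<bar>v - c j\<bar> < e" using c(2)[OF j] s by linarith
      then have in_N: "(t, v) \<in> N" if "t \<in> J (c j)" for t using J(3) c(1) j that by blast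
      \<comment> \<open>The segment from \<open>m j\<close> to u stays in the convex interval
        \<open>J (c j)\<close>, whose slice at height v lies in N, where the u-derivative is
        zero.\<close>
      have "norm (f 0 0 u v - f 0 0 (m j) v) \<le> 0 * \<bar>u - m j\<bar>"
      proof (rule mean_value_bound[OF tensor_derivU[OF f]])
        fix t assume "t \<in> closed_segment (m j) u"
        then have "t \<in> J (c j)"
          using closed_segment_subset[OF m[OF j] _ J(2)[OF c(1)[OF j]]] near True by blast
        then show "norm (f (Suc 0) 0 t v) \<le> 0" using zero in_N by simp
      qed
      then show ?thesis by simp
    qed (simp add: cell_eq_0 s)
    obtain M :: nat where M: "(\<Sum>j\<in>Z. \<bar>of_int j\<bar>) + \<bar>v\<bar> / s \<le> real M" using real_arch_simple by blast
    have Msplit: "(\<Sum>j\<in>Z. \<bar>real_of_int j\<bar>) \<le> real M" "\<bar>v\<bar> / s \<le> real M"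
    proof -
      have "0 \<le> (\<Sum>j\<in>Z. \<bar>real_of_int j\<bar>)" "0 \<le> \<bar>v\<bar> / s" using s by (auto intro: sum_nonneg)
      with M show "(\<Sum>j\<in>Z. \<bar>real_of_int j\<bar>) \<le> real M" "\<bar>v\<bar> / s \<le> real M" by linarith+
    qed
    have "Z \<subseteq> {- int M..int M}"
    proof
      fix j assume "j \<in> Z"
      then have "\<bar>real_of_int j\<bar> \<le> (\<Sum>j\<in>Z. \<bar>real_of_int j\<bar>)" using \<open>finite Z\<close> by (intro member_le_sum) auto
      then have "\<bar>real_of_int j\<bar> \<le> real M" using Msplit by linarith
      then show "j \<in> {- int M..int M}" by simp linarith
    qed
    then have "(\<Sum>j\<in>Z. cell s j 0 v) = (\<Sum>j\<in>{- int M..int M}. cell s j 0 v)"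
      using near by (intro sum.mono_neutral_left) (auto intro!: cell_eq_0 s simp: not_less[symmetric])
    also have "\<dots> = 1"
      using sum_cell[OF s(1), of v M 0] Msplit s by (simp add: pos_divide_le_eq mult.commute const_seq_def)
    finally have one: "(\<Sum>j\<in>Z. cell s j 0 v) = 1" .
    have "h 0 v = (\<Sum>j\<in>Z. cell s j 0 v * f 0 0 (m j) v)" by (simp add: h_def leibniz_def)
    also have "\<dots> = (\<Sum>j\<in>Z. cell s j 0 v) * f 0 0 u v" by (simp add: eq sum_distrib_right)
    finally show "f 0 0 u v = h 0 v" by (simp add: one)
  qed
qed

text \<open>As g has no mixed derivative, its u-derivative depends on u alone near K; this uses the
  vertical sections, hence the swapped coordinates. After subtracting a primitive G, the rest has no
  u-derivative and depends on v alone by the horizontal sections. Equality on an open set around K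
  then gives all derivatives on K.\<close>

lemma wave_split_near:
  assumes g: "tensor g" and K: "compact K" and N: "open N" "K \<subseteq> N"
    and convU: "\<And>v. convex {u. (u, v) \<in> K}" and convV: "\<And>u. convex {v. (u, v) \<in> K}"
    and wave: "\<And>u v. (u, v) \<in> N \<Longrightarrow> g 1 1 u v = 0"
  obtains G H where "deriv_seq G" "deriv_seq H"
    "\<And>u v i j. (u, v) \<in> K \<Longrightarrow> g i j u v = G i u * const_seq 1 j v + const_seq 1 i u * H j v"
proof -
  have sw: "prod.swap ` A = prod.swap -` A" for A :: "(real \<times> real) set"
    by force
  have swo: "open (prod.swap ` A)" if "open A" for A :: "(real \<times> real) set"
    unfolding sw using that by (intro open_vimage) (auto simp: prod.swap_def intro!: continuous_intros)
  have swc: "compact (prod.swap ` K)"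
    by (intro compact_continuous_image K) (auto simp: prod.swap_def intro!: continuous_intros)
  obtain G1 N1 where G1: "deriv_seq G1" "open N1" "prod.swap ` K \<subseteq> N1"
    and eq1: "\<And>a b. (a, b) \<in> N1 \<Longrightarrow> g 1 0 b a = G1 0 b"
  proof (rule function_of_v_near[of "\<lambda>i j a b. g (Suc j) i b a" "prod.swap ` K" "prod.swap ` N"])
    show "tensor (\<lambda>i j a b. g (Suc j) i b a)"
      using tensor_swap[OF tensor_shiftU[OF g]] .
    show "convex {v. (v, u) \<in> prod.swap ` K}" for u
      using convV[of u] unfolding sw by simp
  qed (use swo swc N wave in \<open>auto simp: image_iff\<close>)
  obtain G where G: "deriv_seq G" "\<And>n. G (Suc n) = G1 n" using deriv_seq_antiderivative[OF G1(1)] by metis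
  define f where "f = (\<lambda>i j u v. g i j u v - G i u * const_seq 1 j v)"
  have f: "tensor f" unfolding f_def by (intro tensor_diff g tensor_fun_of_u G)
  obtain H N2 where H: "deriv_seq H" "open N2" "K \<subseteq> N2"
    and eq2: "\<And>u v. (u, v) \<in> N2 \<Longrightarrow> f 0 0 u v = H 0 v"
  proof (rule function_of_v_near[OF f K, of "prod.swap ` N1"])
    show "K \<subseteq> prod.swap ` N1" using G1(3) unfolding sw by force
    show "f 1 0 u v = 0" if "(u, v) \<in> prod.swap ` N1" for u v
      using that eq1[of v u] G(2)[of 0] by (auto simp: f_def const_seq_def)
  qed (use swo G1 convU in auto)
  define w where "w = (\<lambda>i j u v. f i j u v - const_seq 1 i u * H j v)"
  have w: "tensor w" unfolding w_def by (intro tensor_diff f tensor_fun_of_v H)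
  have "w (0 + i) (0 + j) u v = 0" if "(u, v) \<in> N2" for i j u v
    by (rule tensor_vanish_open[OF w H(2) _ that]) (simp add: w_def eq2 const_seq_def)
  then show ?thesis
    using H(3) G(1) H(1) by (intro that[of G H]) (auto simp: w_def f_def algebra_simps subset_iff)
qed

section \<open>Estimates for glued Taylor polynomials, in the maximum distance of u and v\<close>

definition maxdist :: "real \<times> real \<Rightarrow> real \<times> real \<Rightarrow> real" where
  "maxdist p q = max \<bar>fst p - fst q\<bar> \<bar>snd p - snd q\<bar>"

lemma maxdist_commute: "maxdist p q = maxdist q p"
  by (simp add: maxdist_def abs_minus_commute)

lemma maxdist_triangle: "maxdist p r \<le> maxdist p q + maxdist q r"
  by (auto simp: maxdist_def max_def)

lemma maxdist_nonneg: "0 \<le> maxdist p q"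
  by (simp add: maxdist_def)

lemma maxdist_le_iff: "maxdist p q \<le> r \<longleftrightarrow> \<bar>fst p - fst q\<bar> \<le> r \<and> \<bar>snd p - snd q\<bar> \<le> r"
  by (simp add: maxdist_def)

lemma active_maxdist: "active d u v = {p. maxdist (u, v) (d * of_int (fst p), d * of_int (snd p)) < d}"
  by (auto simp: active_def maxdist_def)

text \<open>A polynomial of degree at most N equals its Taylor expansion at (a, b), so a jet bound
  that scales like r^(N - k) in order k carries over to the whole square of radius r.\<close>

lemma polynomial_bound:
  assumes w: "tensor w" and deg: "\<And>i j u v. N < i + j \<Longrightarrow> w i j u v = 0"
    and jet: "\<And>i j. i + j \<le> N \<Longrightarrow> norm (w i j a b) \<le> M * r ^ (N - (i + j))"
    and M: "0 \<le> M"
    and uv: "\<bar>u - a\<bar> \<le> r" "\<bar>v - b\<bar> \<le> r" and ij: "i + j \<le> N"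
  shows "norm (w i j u v) \<le> (real N + 1)\<^sup>2 * (M * r ^ (N - (i + j)))"
proof -
  define m where "m = N - (i + j)"
  have r: "0 \<le> r" using uv by linarith
  let ?t = "\<lambda>k l. w (i + k) (j + l) a b * of_real ((u - a) ^ k / fact k) * of_real ((v - b) ^ l / fact l)"
  have pw: "norm (complex_of_real (x ^ k / fact k)) \<le> r ^ k" if "\<bar>x\<bar> \<le> r" for x k
  proof -
    have "\<bar>x\<bar> ^ k / fact k \<le> \<bar>x\<bar> ^ k / 1" by (intro divide_left_mono) auto
    also have "\<dots> \<le> r ^ k" using that by (simp add: power_mono)
    finally show ?thesis unfolding norm_of_real by (simp add: power_abs)
  qed
  have t: "norm (?t k l) \<le> M * r ^ m" if "l \<le> m" "k \<le> m - l" for k l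
  proof -
    have "norm (?t k l) \<le> (M * r ^ (m - (k + l))) * r ^ k * r ^ l"
      unfolding norm_mult
      by (intro mult_mono pw uv order_trans[OF jet]) (use that ij r M in \<open>auto simp: m_def add_ac\<close>)
    also have "\<dots> = M * r ^ m" using that by (simp flip: power_add add: mult.assoc)
    finally show ?thesis .
  qed
  \<comment> \<open>With all derivatives of order N + 1 zero, \<open>taylor_bound_2\<close> applies
    with bound 0 and gives equality.\<close>
  have "norm (w i j u v - (\<Sum>l\<le>m. \<Sum>k\<le>m - l. ?t k l)) \<le> (real N + 2) * 0 * r ^ (Suc N - (i + j))"
    unfolding m_def by (rule taylor_bound_2[OF w ij uv]) (simp add: deg)
  then have "w i j u v = (\<Sum>l\<le>m. \<Sum>k\<le>m - l. ?t k l)" by simp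
  also have "norm \<dots> \<le> (\<Sum>l\<le>m. \<Sum>k\<le>m - l. M * r ^ m)"
    by (intro order_trans[OF norm_sum] sum_mono t) auto
  also have "\<dots> \<le> (\<Sum>l\<le>m. (real N + 1) * (M * r ^ m))"
    using r M by (intro sum_mono) (auto simp: m_def intro!: mult_right_mono)
  also have "\<dots> = (real m + 1) * ((real N + 1) * (M * r ^ m))" by (simp add: add.commute)
  also have "\<dots> \<le> (real N + 1) * ((real N + 1) * (M * r ^ m))"
    using r M by (intro mult_right_mono) (auto simp: m_def)
  finally show ?thesis by (simp add: m_def power2_eq_square mult.assoc)
qed

lemma finite_grid_near:
  assumes "0 < d" "\<And>x. x \<in> K \<Longrightarrow> \<bar>fst x\<bar> \<le> R \<and> \<bar>snd x\<bar> \<le> R"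
  shows "finite {p. \<exists>y\<in>K. maxdist y (d * of_int (fst p), d * of_int (snd p)) \<le> r}"
proof (rule finite_subset)
  let ?X = "{j::int. \<bar>of_int j\<bar> \<le> (R + r) / d}"
  have *: "j \<in> ?X" if "\<bar>t\<bar> \<le> R" "\<bar>t - d * of_int j\<bar> \<le> r" for t j
  proof -
    have "\<bar>d * of_int j\<bar> \<le> R + r" using that by linarith
    then show ?thesis using assms(1) by (simp add: abs_mult pos_le_divide_eq mult.commute)
  qed
  show "{p. \<exists>y\<in>K. maxdist y (d * of_int (fst p), d * of_int (snd p)) \<le> r} \<subseteq> ?X \<times> ?X"
    using * assms(2) by (force simp: maxdist_le_iff)
  show "finite (?X \<times> ?X)" by (intro finite_cartesian_product finite_int_bounded)
qed

text \<open>Near y in K the glued function differs from the polynomial \<open>T y\<close> by O(d^(N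
  - k)) in order k. As \<open>T y\<close> has no mixed derivative, the error to be removed is O(d^(N
  - 2 - k)), and this is the rate in the conclusion: integrating twice over a bounded region changes
  only the constant.\<close>

lemma wave_approx_near:
  fixes K :: "(real \<times> real) set" and T :: "real \<times> real \<Rightarrow> deriv_family"
  assumes N: "2 \<le> N" and R: "\<And>x. x \<in> K \<Longrightarrow> \<bar>fst x\<bar> \<le> R \<and> \<bar>snd x\<bar> \<le> R"
    and T: "\<And>x. x \<in> K \<Longrightarrow> tensor (T x)"
    and T_deg: "\<And>x i j u v. x \<in> K \<Longrightarrow> N < i + j \<Longrightarrow> T x i j u v = 0"
    and T_wave: "\<And>x i j u v. x \<in> K \<Longrightarrow> T x (Suc i) (Suc j) u v = 0"
    and T_jet: "\<And>x y i j. x \<in> K \<Longrightarrow> y \<in> K \<Longrightarrow> maxdist x y < t0 \<Longrightarrow> i + j \<le> N \<Longrightarrow>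
      norm (T x i j (fst y) (snd y) - T y i j (fst y) (snd y)) \<le> maxdist x y ^ (N - (i + j))"
  obtains C where "0 \<le> C" "\<And>d. 0 < d \<Longrightarrow> d \<le> 1 \<Longrightarrow> 8 * d < t0 \<Longrightarrow> \<exists>g. tensor g \<and>
      (\<forall>y\<in>K. \<forall>u v. maxdist y (u, v) < d \<longrightarrow> g 1 1 u v = 0) \<and>
      (\<forall>y\<in>K. \<forall>u v i j. maxdist y (u, v) \<le> d \<longrightarrow> i + j \<le> N - 2 \<longrightarrow>
         norm (g i j u v - T y i j u v) \<le> C * d ^ (N - 2) / d ^ (i + j))"
proof -
  obtain H where H: "0 \<le> H" "\<And>n t. n \<le> N \<Longrightarrow> norm (hat n t) \<le> H" using hat_bounded by metis
  define C1 where "C1 = 4 * (2 ^ N * H)\<^sup>2 * ((real N + 1)\<^sup>2 * 8 ^ N)"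
  define C2 where "C2 = 4 * (2 ^ (N - 2) * H)\<^sup>2 * C1"
  define R1 where "R1 = \<bar>R\<bar> + 1"
  define C where "C = C1 + C2 * R1\<^sup>2"
  have C1: "0 \<le> C1" and C2: "0 \<le> C2" and R1: "1 \<le> R1" using H by (auto simp: C1_def C2_def R1_def)
  show ?thesis
  proof (rule that[of C])
    show "0 \<le> C" using C1 C2 by (simp add: C_def)
    fix d :: real assume d: "0 < d" and d1: "d \<le> 1" and dt: "8 * d < t0"
    define G where "G = (\<lambda>p::int \<times> int. (d * of_int (fst p), d * of_int (snd p)))"
    have act: "active d u v = {p. maxdist (u, v) (G p) < d}" for u v
      by (simp add: active_maxdist G_def)
    \<comment> \<open>\<open>I r\<close> collects the grid points within r * d of K. Cells active
      within d of K have their index in \<open>I 2\<close>; points where such cells are active lie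
      within 3 d of some y in K; cells active within 3 d of K have their index in
      \<open>I 4\<close>. Their base points \<open>x p\<close> are then within 4 + 1 + 3 = 8 scales
      of y.\<close>
    define I where "I = (\<lambda>r. {p. \<exists>y\<in>K. maxdist y (G p) \<le> r * d})"
    have fin: "finite (I r)" for r
      unfolding I_def G_def by (rule finite_grid_near[OF d R])
    have "\<forall>p\<in>I 4. \<exists>x\<in>K. maxdist x (G p) \<le> 4 * d" by (simp add: I_def)
    then obtain x where x: "\<And>p. p \<in> I 4 \<Longrightarrow> x p \<in> K" "\<And>p. p \<in> I 4 \<Longrightarrow> maxdist (x p) (G p) \<le> 4 * d"
      by metis
    have pd: "d ^ (n - k) = d ^ n / d ^ k" if "k \<le> n" for n k
      using d that by (simp add: power_diff)

    define g where "g = glue d (I 4) (\<lambda>p. T (x p))"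
    have g: "tensor g" unfolding g_def by (intro tensor_glue T x)
    have g_near: "norm (g i j u v - T y i j u v) \<le> C1 * d ^ N / d ^ (i + j)"
      if y: "y \<in> K" and yu: "maxdist y (u, v) \<le> 3 * d" and ij: "i + j \<le> N" for y u v i j
    proof -
      have sub: "active d u v \<subseteq> I 4"
      proof
        fix p assume "p \<in> active d u v"
        then have "maxdist y (G p) \<le> 4 * d"
          using maxdist_triangle[of y "G p" "(u, v)"] yu by (simp add: act)
        then show "p \<in> I 4" using y by (auto simp: I_def)
      qed
      have "norm (glue d (I 4) (\<lambda>p i j u v. T (x p) i j u v - T y i j u v) i j u v)
        \<le> 4 * (2 ^ N * H)\<^sup>2 * ((real N + 1)\<^sup>2 * 8 ^ N * d ^ N) / d ^ (i + j)"
      proof (rule glue_bound[OF d fin H _ _ ij])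
        fix p i j assume p: "p \<in> I 4" "p \<in> active d u v" and ij: "i + j \<le> N"
        have xy: "maxdist (x p) y \<le> 8 * d"
          using maxdist_triangle[of "x p" y "G p"] maxdist_triangle[of "G p" y "(u, v)"] x(2)[OF p(1)] p(2) yu
          by (simp add: act maxdist_commute)
        have "norm (T (x p) i j u v - T y i j u v) \<le> (real N + 1)\<^sup>2 * (1 * (8 * d) ^ (N - (i + j)))"
        proof (rule polynomial_bound[of "\<lambda>i j u v. T (x p) i j u v - T y i j u v" N "fst y" "snd y"])
          show "tensor (\<lambda>i j u v. T (x p) i j u v - T y i j u v)"
            by (intro tensor_diff T x p y)
          show "T (x p) i j u v - T y i j u v = 0" if "N < i + j" for i j u v
            using that T_deg x(1)[OF p(1)] y by simp
          show "norm (T (x p) i j (fst y) (snd y) - T y i j (fst y) (snd y)) \<le> 1 * (8 * d) ^ (N - (i + j))"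
            if "i + j \<le> N" for i j
          proof -
            have "norm (T (x p) i j (fst y) (snd y) - T y i j (fst y) (snd y)) \<le> maxdist (x p) y ^ (N - (i + j))"
              using xy dt by (intro T_jet x p y that) auto
            also have "\<dots> \<le> (8 * d) ^ (N - (i + j))"
              using xy by (intro power_mono maxdist_nonneg)
            finally show ?thesis by simp
          qed
          show "\<bar>u - fst y\<bar> \<le> 8 * d" "\<bar>v - snd y\<bar> \<le> 8 * d"
            using yu d unfolding maxdist_le_iff by (auto simp: abs_minus_commute)
        qed (use ij in auto)
        also have "\<dots> \<le> (real N + 1)\<^sup>2 * (8 ^ N * d ^ N / d ^ (i + j))"
        proof (intro mult_left_mono)
          have "(8 * d) ^ (N - (i + j)) = 8 ^ (N - (i + j)) * (d ^ N / d ^ (i + j))"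
            unfolding power_mult_distrib pd[OF ij] ..
          also have "\<dots> \<le> 8 ^ N * (d ^ N / d ^ (i + j))"
            using d by (intro mult_right_mono power_increasing) auto
          finally show "1 * (8 * d) ^ (N - (i + j)) \<le> 8 ^ N * d ^ N / d ^ (i + j)" by simp
        qed auto
        finally show "norm (T (x p) i j u v - T y i j u v) \<le> (real N + 1)\<^sup>2 * 8 ^ N * d ^ N / d ^ (i + j)"
          by (simp add: mult.assoc)
      qed (use d in auto)
      then show ?thesis
        unfolding glue_diff glue_const[OF d fin sub] g_def C1_def by (simp add: mult.assoc)
    qed

    \<comment> \<open>The mixed derivative of g times a cut-off that is 1 within d of K. Its bound
      holds in the whole plane, as integration from the axes passes through points far from
      K.\<close>
    define \<rho> where "\<rho> = glue d (I 2) (\<lambda>_ i j. g (Suc i) (Suc j))"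
    have \<rho>: "tensor \<rho>"
      unfolding \<rho>_def by (intro tensor_glue tensor_shiftU[OF tensor_shiftV[OF g]])
    have \<rho>_bound: "norm (\<rho> i j u v) \<le> C2 * d ^ (N - 2) / d ^ (i + j)" if ij: "i + j \<le> N - 2" for i j u v
    proof -
      have "norm (\<rho> i j u v) \<le> 4 * (2 ^ (N - 2) * H)\<^sup>2 * (C1 * d ^ (N - 2)) / d ^ (i + j)"
        unfolding \<rho>_def
      proof (rule glue_bound[OF d fin H(1) _ _ _ ij])
        fix p i j assume p: "p \<in> I 2" "p \<in> active d u v" and ij: "i + j \<le> N - 2"
        obtain y where y: "y \<in> K" "maxdist y (G p) \<le> 2 * d" using p(1) by (auto simp: I_def)
        have "maxdist y (u, v) \<le> 3 * d"
          using maxdist_triangle[of y "(u, v)" "G p"] y(2) p(2) by (simp add: act maxdist_commute)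
        from g_near[OF y(1) this, of "Suc i" "Suc j"] T_wave[OF y(1)] ij N
        have "norm (g (Suc i) (Suc j) u v) \<le> C1 * d ^ N / d ^ (Suc i + Suc j)" by simp
        also have "\<dots> = C1 * d ^ (N - 2) / d ^ (i + j)"
          using pd[OF N] d by (simp add: power2_eq_square)
        finally show "norm (g (Suc i) (Suc j) u v) \<le> C1 * d ^ (N - 2) / d ^ (i + j)" .
      qed (use H C1 d N in auto)
      then show ?thesis by (simp add: C2_def mult.assoc)
    qed
    obtain z where z: "tensor z" "\<And>i j. z (Suc i) (Suc j) = \<rho> i j" "\<And>i u. z i 0 u 0 = 0" "\<And>j v. z 0 j 0 v = 0"
      using tensor_antiderivative[OF \<rho>] by metis
    let ?D = "\<lambda>k. C2 * d ^ (N - 2) / d ^ k"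
    have D0: "0 \<le> ?D k" for k using C2 d by simp
    have D_mono: "?D k \<le> ?D l" if "k \<le> l" for k l
      using that d d1 C2 by (intro divide_left_mono power_decreasing) auto
    \<comment> \<open>Mixed derivatives of \<open>z\<close> are those of \<open>\<rho>\<close>, pure
      ones need one integration from an axis and \<open>z\<close> itself two. Since d \<le> 1 and R1
      \<ge> 1, all cases fit under one bound.\<close>
    have z_bound: "norm (z i j u v) \<le> ?D (i + j) * R1\<^sup>2"
      if ij: "i + j \<le> N - 2" and uv: "\<bar>u\<bar> \<le> R1" "\<bar>v\<bar> \<le> R1" for i j u v
    proof -
      have step: "a \<le> ?D (i + j) * R1\<^sup>2" if "a \<le> ?D k * R1 ^ l" "k \<le> i + j" "l \<le> 2" for a k l
        by (rule order_trans[OF that(1)], intro mult_mono D_mono power_increasing) (use that R1 D0 in auto)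
      have zi0: "norm (z (Suc i) 0 u v) \<le> ?D i * R1" if "i \<le> N - 2" "\<bar>v\<bar> \<le> R1" for i u v
      proof -
        have "norm (z (Suc i) 0 u v - z (Suc i) 0 u 0) \<le> ?D i * \<bar>v - 0\<bar>"
        proof (rule mean_value_bound[OF tensor_derivV[OF z(1)]])
          show "norm (z (Suc i) (Suc 0) u t) \<le> ?D i" for t
            using \<rho>_bound[of i 0 u t] that by (simp add: z(2))
        qed
        also have "\<dots> \<le> ?D i * R1" using that by (intro mult_left_mono D0) auto
        finally show ?thesis by (simp add: z(3))
      qed
      have z0j: "norm (z 0 (Suc j) u v) \<le> ?D j * R1" if "j \<le> N - 2" "\<bar>u\<bar> \<le> R1" for j u v
      proof -
        have "norm (z 0 (Suc j) u v - z 0 (Suc j) 0 v) \<le> ?D j * \<bar>u - 0\<bar>"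
        proof (rule mean_value_bound[OF tensor_derivU[OF z(1)]])
          show "norm (z (Suc 0) (Suc j) t v) \<le> ?D j" for t
            using \<rho>_bound[of 0 j t v] that by (simp add: z(2))
        qed
        also have "\<dots> \<le> ?D j * R1" using that by (intro mult_left_mono D0) auto
        finally show ?thesis by (simp add: z(4))
      qed
      have z00: "norm (z 0 0 u v) \<le> ?D 0 * R1\<^sup>2"
      proof -
        have "norm (z 0 0 u v - z 0 0 0 v) \<le> (?D 0 * R1) * \<bar>u - 0\<bar>"
        proof (rule mean_value_bound[OF tensor_derivU[OF z(1)]])
          show "norm (z (Suc 0) 0 t v) \<le> ?D 0 * R1" for t
            using zi0[of 0 v t] uv by simp
        qed
        also have "\<dots> \<le> (?D 0 * R1) * R1" using uv D0[of 0] R1 by (intro mult_left_mono) auto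
        finally show ?thesis by (simp add: z(4) power2_eq_square)
      qed
      consider "i = 0" "j = 0" | k where "i = Suc k" "j = 0" | l where "i = 0" "j = Suc l"
        | k l where "i = Suc k" "j = Suc l"
        by (metis not0_implies_Suc)
      then show ?thesis
      proof cases
        case 1
        then show ?thesis using z00 by simp
      next
        case 2
        then show ?thesis using zi0[of k v u] ij uv by (intro step[of _ k 1]) auto
      next
        case 3
        then show ?thesis using z0j[of l u v] ij uv by (intro step[of _ l 1]) auto
      next
        case 4
        then show ?thesis using \<rho>_bound[of k l u v] ij by (intro step[of _ "k + l" 0]) (auto simp: z(2))
      qed
    qed
    show "\<exists>g. tensor g \<and>
      (\<forall>y\<in>K. \<forall>u v. maxdist y (u, v) < d \<longrightarrow> g 1 1 u v = 0) \<and>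
      (\<forall>y\<in>K. \<forall>u v i j. maxdist y (u, v) \<le> d \<longrightarrow> i + j \<le> N - 2 \<longrightarrow>
         norm (g i j u v - T y i j u v) \<le> C * d ^ (N - 2) / d ^ (i + j))"
    proof (intro exI[of _ "\<lambda>i j u v. g i j u v - z i j u v"] conjI ballI allI impI)
      show "tensor (\<lambda>i j u v. g i j u v - z i j u v)" by (intro tensor_diff g z)
    next
      fix y u v assume y: "y \<in> K" "maxdist y (u, v) < d"
      have "active d u v \<subseteq> I 2"
      proof
        fix p assume "p \<in> active d u v"
        then have "maxdist y (G p) \<le> 2 * d"
          using maxdist_triangle[of y "G p" "(u, v)"] y by (simp add: act)
        then show "p \<in> I 2" using y by (auto simp: I_def)
      qed
      from glue_const[OF d fin this, of "\<lambda>i j. g (Suc i) (Suc j)" 0 0] z(2)[of 0 0]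
      show "g 1 1 u v - z 1 1 u v = 0" by (simp add: \<rho>_def)
    next
      fix y u v i j assume y: "y \<in> K" "maxdist y (u, v) \<le> d" and ij: "i + j \<le> N - 2"
      have "norm (g i j u v - T y i j u v) \<le> C1 * d ^ N / d ^ (i + j)"
        using y d ij by (intro g_near) auto
      also have "\<dots> \<le> C1 * d ^ (N - 2) / d ^ (i + j)"
        using d d1 C1 by (intro divide_right_mono mult_left_mono power_decreasing) auto
      finally have "norm (g i j u v - T y i j u v) \<le> C1 * d ^ (N - 2) / d ^ (i + j)" .
      moreover have "norm (z i j u v) \<le> ?D (i + j) * R1\<^sup>2"
      proof (rule z_bound[OF ij])
        have "\<bar>fst y - u\<bar> \<le> d" "\<bar>snd y - v\<bar> \<le> d" using y(2) by (simp_all add: maxdist_le_iff)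
        then show "\<bar>u\<bar> \<le> R1" "\<bar>v\<bar> \<le> R1" using R[OF y(1)] d1 unfolding R1_def by linarith+
      qed
      ultimately have "norm ((g i j u v - T y i j u v) - z i j u v)
         \<le> C1 * d ^ (N - 2) / d ^ (i + j) + ?D (i + j) * R1\<^sup>2"
        by (rule order_trans[OF norm_triangle_ineq4 add_mono])
      also have "\<dots> = C * d ^ (N - 2) / d ^ (i + j)" by (simp add: C_def distrib_right distrib_left add_divide_distrib mult_ac)
      finally show "norm (g i j u v - z i j u v - T y i j u v) \<le> C * d ^ (N - 2) / d ^ (i + j)"
        by (simp add: algebra_simps)
    qed
  qed
qed

text \<open>Only the sum \<open>a 0 + b 0\<close> of the two coefficients of order 0 is meaningful.\<close>

definition wave_taylor :: "nat \<Rightarrow> (nat \<Rightarrow> complex) \<Rightarrow> (nat \<Rightarrow> complex) \<Rightarrow> real \<times> real \<Rightarrow> deriv_family" where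
  "wave_taylor n a b x = (\<lambda>i j u v. taylor_seq n a (fst x) i u * const_seq 1 j v + const_seq 1 i u * taylor_seq n b (snd x) j v)"

lemma tensor_wave_taylor: "tensor (wave_taylor n a b x)"
  unfolding wave_taylor_def by (intro tensor_add tensor_fun_of_u tensor_fun_of_v deriv_seq_taylor_seq)

lemma wave_taylor_eq_0: "n < i + j \<Longrightarrow> wave_taylor n a b x i j u v = 0"
  by (auto simp: wave_taylor_def const_seq_def taylor_seq_eq_0)

lemma wave_taylor_mixed: "wave_taylor n a b x (Suc i) (Suc j) u v = 0"
  by (simp add: wave_taylor_def const_seq_def)

text \<open>At points of K, G + H has the derivatives of g, so the jets in the conclusion are those
  of T x - g. For points closer than \<open>d\<close> the Taylor remainder of T x - g brings one
  factor r < d beyond the required power. For points at distance at least \<open>d\<close> the two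
  jets are estimated separately: they have size d^(n0 + 1), and d^n0 is absorbed by the power of the
  distance.\<close>

lemma wave_jet_approx:
  fixes K :: "(real \<times> real) set" and A B :: "nat \<Rightarrow> real \<times> real \<Rightarrow> complex"
  assumes K: "compact K"
    and convU: "\<And>v. convex {u. (u, v) \<in> K}" and convV: "\<And>u. convex {v. (u, v) \<in> K}"
    and jet: "\<And>N. \<exists>t0>0. \<forall>x\<in>K. \<forall>y\<in>K. maxdist x y < t0 \<longrightarrow> (\<forall>i j. i + j \<le> N \<longrightarrow>
      norm (wave_taylor N (\<lambda>k. A k x) (\<lambda>k. B k x) x i j (fst y) (snd y)
        - wave_taylor N (\<lambda>k. A k y) (\<lambda>k. B k y) y i j (fst y) (snd y)) \<le> maxdist x y ^ (N - (i + j)))"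
    and e: "e > 0"
  obtains G H where "deriv_seq G" "deriv_seq H"
    "\<And>x i j. x \<in> K \<Longrightarrow> i + j \<le> n0 \<Longrightarrow>
      norm (wave_taylor n0 (\<lambda>k. A k x - G k (fst x)) (\<lambda>k. B k x - H k (snd x)) x i j (fst x) (snd x)) \<le> e"
    "\<And>n x y i j. n \<le> n0 \<Longrightarrow> x \<in> K \<Longrightarrow> y \<in> K \<Longrightarrow> i + j \<le> n \<Longrightarrow>
      norm (wave_taylor n (\<lambda>k. A k y - G k (fst y)) (\<lambda>k. B k y - H k (snd y)) y i j (fst y) (snd y)
        - wave_taylor n (\<lambda>k. A k x - G k (fst x)) (\<lambda>k. B k x - H k (snd x)) x i j (fst y) (snd y))
      \<le> e * maxdist x y ^ (n - (i + j))"
proof -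
  \<comment> \<open>Then N - 2 - n0 = n0 + 2, so the error up to order n0 is at most a constant
    times d^(n0 + 1), and derivatives of the error of order up to n0 + 1 stay bounded.\<close>
  define N where "N = 2 * n0 + 4"
  define T where "T = (\<lambda>x. wave_taylor N (\<lambda>k. A k x) (\<lambda>k. B k x) x)"
  obtain t0 where t0: "t0 > 0" and T_jet: "\<And>x y i j. x \<in> K \<Longrightarrow> y \<in> K \<Longrightarrow> maxdist x y < t0 \<Longrightarrow> i + j \<le> N \<Longrightarrow>
      norm (T x i j (fst y) (snd y) - T y i j (fst y) (snd y)) \<le> maxdist x y ^ (N - (i + j))"
    using jet[of N] unfolding T_def by blast
  obtain R where R: "\<And>x. x \<in> K \<Longrightarrow> \<bar>fst x\<bar> \<le> R \<and> \<bar>snd x\<bar> \<le> R"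
  proof -
    obtain R where "\<And>x. x \<in> K \<Longrightarrow> norm x \<le> R"
      using compact_imp_bounded[OF K] unfolding bounded_iff by auto
    then show ?thesis
      by (intro that[of R]) (metis norm_fst_le norm_snd_le order_trans prod.collapse real_norm_def)
  qed
  obtain C where C: "0 \<le> C" and approx: "\<And>d. 0 < d \<Longrightarrow> d \<le> 1 \<Longrightarrow> 8 * d < t0 \<Longrightarrow> \<exists>g. tensor g \<and>
      (\<forall>y\<in>K. \<forall>u v. maxdist y (u, v) < d \<longrightarrow> g 1 1 u v = 0) \<and>
      (\<forall>y\<in>K. \<forall>u v i j. maxdist y (u, v) \<le> d \<longrightarrow> i + j \<le> N - 2 \<longrightarrow>
         norm (g i j u v - T y i j u v) \<le> C * d ^ (N - 2) / d ^ (i + j))"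
    by (rule wave_approx_near[of N K R T t0])
      (use R T_jet in \<open>auto simp: T_def N_def tensor_wave_taylor wave_taylor_eq_0 wave_taylor_mixed\<close>)
  define D where "D = 2 * \<bar>R\<bar> + 1"
  \<comment> \<open>Collects the factors of \<open>d\<close> in the estimates for near pairs and for
    far pairs, so that Q * d \<le> e settles both; D bounds the coordinate differences in K.\<close>
  define Q where "Q = 1 + (real n0 + 2) * C + C * (1 + (real n0 + 1)\<^sup>2 * D ^ n0)"
  have D: "1 \<le> D" by (simp add: D_def)
  have Q: "1 \<le> Q" using C D by (simp add: Q_def)
  define d where "d = min (1 / 2) (min (t0 / 9) (e / Q))"
  have d: "0 < d" "d \<le> 1" "8 * d < t0" and dQ: "Q * d \<le> e"
  proof -
    show "0 < d" using t0 e Q by (simp add: d_def)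
    have *: "d \<le> 1 / 2" "d \<le> t0 / 9" "d \<le> e / Q"
      unfolding d_def by (rule min.cobounded1, rule min.coboundedI2, rule min.cobounded1,
        rule min.coboundedI2, rule min.cobounded2)
    then show "d \<le> 1" "8 * d < t0" using t0 by linarith+
    show "Q * d \<le> e" using *(3) Q by (simp add: pos_le_divide_eq mult.commute)
  qed
  obtain g where g: "tensor g" and g_wave: "\<And>y u v. y \<in> K \<Longrightarrow> maxdist y (u, v) < d \<Longrightarrow> g 1 1 u v = 0"
    and g_near: "\<And>y u v i j. y \<in> K \<Longrightarrow> maxdist y (u, v) \<le> d \<Longrightarrow> i + j \<le> N - 2 \<Longrightarrow>
         norm (g i j u v - T y i j u v) \<le> C * d ^ (N - 2) / d ^ (i + j)"
    using approx[OF d] by blast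
  have g_close: "norm (g i j u v - T y i j u v) \<le> C * d ^ (N - 2 - k)"
    if "y \<in> K" "maxdist y (u, v) \<le> d" "i + j \<le> k" "k \<le> N - 2" for y u v i j k
  proof -
    have "norm (g i j u v - T y i j u v) \<le> C * d ^ (N - 2) / d ^ (i + j)"
      using that by (intro g_near) auto
    also have "\<dots> \<le> C * d ^ (N - 2) / d ^ k"
      using d C that by (intro divide_left_mono power_decreasing) auto
    also have "\<dots> = C * d ^ (N - 2 - k)" using d that
      by (subst power_diff) (auto simp only: times_divide_eq_right)
    finally show ?thesis .
  qed
  define W where "W = (\<Union>y\<in>K. {z. maxdist y z < d})"
  have "open W"
    unfolding W_def maxdist_def by (intro open_UN ballI open_Collect_less continuous_intros)
  moreover have "K \<subseteq> W" using d by (auto simp: W_def maxdist_def)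
  ultimately obtain G H where G: "deriv_seq G" and H: "deriv_seq H"
    and gGH: "\<And>u v i j. (u, v) \<in> K \<Longrightarrow> g i j u v = G i u * const_seq 1 j v + const_seq 1 i u * H j v"
    by (rule wave_split_near[OF g K _ _ convU convV]) (use g_wave in \<open>auto simp: W_def\<close>)
  define a where "a = (\<lambda>x k. A k x - G k (fst x))"
  define b where "b = (\<lambda>x k. B k x - H k (snd x))"
  define P where "P = (\<lambda>n x. wave_taylor n (a x) (b x) x)"
  have jet_at: "P n x i j (fst x) (snd x) = T x i j (fst x) (snd x) - g i j (fst x) (snd x)"
    if "x \<in> K" "i + j \<le> n" "n \<le> n0" for n x i j
    using that by (auto simp: P_def T_def N_def wave_taylor_def taylor_seq_at gGH a_def b_def algebra_simps const_seq_def)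
  have small: "norm (P n x i j (fst x) (snd x)) \<le> C * d ^ Suc n0"
    if "x \<in> K" "i + j \<le> n" "n \<le> n0" for n x i j
  proof -
    have "norm (g i j (fst x) (snd x) - T x i j (fst x) (snd x)) \<le> C * d ^ (N - 2 - n0)"
      using that d by (intro g_close) (auto simp: maxdist_def N_def)
    also have "\<dots> \<le> C * d ^ Suc n0"
      using d C by (intro mult_left_mono power_decreasing) (auto simp: N_def)
    finally show ?thesis unfolding jet_at[OF that] by (simp add: norm_minus_commute)
  qed
  show ?thesis
  proof (rule that[OF G H])
    fix x i j assume x: "x \<in> K" "i + j \<le> n0"
    have "norm (P n0 x i j (fst x) (snd x)) \<le> C * d ^ Suc n0" by (intro small x order_refl)
    also have "\<dots> \<le> C * d ^ 1" using d C by (intro mult_left_mono power_decreasing) auto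
    also have "\<dots> \<le> Q * d ^ 1"
    proof (rule mult_right_mono)
      have "0 \<le> (real n0 + 2) * C" "0 \<le> C * ((real n0 + 1)\<^sup>2 * D ^ n0)" using C D by auto
      then show "C \<le> Q" unfolding Q_def distrib_left by linarith
    qed (use d in auto)
    finally show "norm (wave_taylor n0 (\<lambda>k. A k x - G k (fst x)) (\<lambda>k. B k x - H k (snd x)) x i j (fst x) (snd x)) \<le> e"
      using dQ by (simp add: P_def a_def b_def)
  next
    fix n x y i j assume n: "n \<le> n0" and x: "x \<in> K" and y: "y \<in> K" and ij: "i + j \<le> n"
    define r where "r = maxdist x y"
    have r0: "0 \<le> r" by (simp add: r_def maxdist_nonneg)
    have "norm (P n y i j (fst y) (snd y) - P n x i j (fst y) (snd y)) \<le> Q * d * r ^ (n - (i + j))"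
    proof (cases "r < d")
      case True
      \<comment> \<open>\<open>P n x\<close> is the Taylor polynomial of order n at x of T x - g, so
        v vanishes at x to order n. At y it is what remains of \<open>P n y - P n x\<close> after
        the difference of T y and T x.\<close>
      define v where "v = (\<lambda>i j u v. (T x i j u v - g i j u v) - P n x i j u v)"
      have v: "tensor v"
        unfolding v_def P_def T_def by (intro tensor_diff tensor_wave_taylor g)
      have "norm (v i j (fst y) (snd y) - (\<Sum>l\<le>n - (i + j). \<Sum>k\<le>n - (i + j) - l.
          v (i + k) (j + l) (fst x) (snd x) * of_real ((fst y - fst x) ^ k / fact k) * of_real ((snd y - snd x) ^ l / fact l)))
        \<le> (real n + 2) * C * r ^ (Suc n - (i + j))"
      proof (rule taylor_bound_2[OF v ij])
        show "\<bar>fst y - fst x\<bar> \<le> r" "\<bar>snd y - snd x\<bar> \<le> r"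
          by (auto simp: r_def maxdist_def abs_minus_commute)
        fix k l s t assume kl: "k + l = Suc n"
          and st: "s \<in> closed_segment (fst x) (fst y)" "t \<in> closed_segment (snd x) (snd y)"
        have "\<bar>fst x - s\<bar> \<le> \<bar>fst x - fst y\<bar>" "\<bar>snd x - t\<bar> \<le> \<bar>snd x - snd y\<bar>"
          using st by (auto simp: closed_segment_eq_real_ivl split: if_splits)
        then have "maxdist x (s, t) \<le> r" unfolding r_def maxdist_def by auto
        then have "norm (g k l s t - T x k l s t) \<le> C * d ^ (N - 2 - Suc n)"
          using True kl n by (intro g_close x) (auto simp: N_def)
        also have "\<dots> \<le> C * 1" using d C by (intro mult_left_mono power_le_one) auto
        finally show "norm (v k l s t) \<le> C"
          using kl by (simp add: v_def P_def wave_taylor_eq_0 norm_minus_commute)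
      qed
      also have "(\<Sum>l\<le>n - (i + j). \<Sum>k\<le>n - (i + j) - l.
          v (i + k) (j + l) (fst x) (snd x) * of_real ((fst y - fst x) ^ k / fact k) * of_real ((snd y - snd x) ^ l / fact l)) = 0"
      proof (intro sum.neutral ballI)
        fix l k assume "l \<in> {..n - (i + j)}" "k \<in> {..n - (i + j) - l}"
        then have "v (i + k) (j + l) (fst x) (snd x) = 0"
          using ij n x by (simp add: v_def jet_at)
        then show "v (i + k) (j + l) (fst x) (snd x) * of_real ((fst y - fst x) ^ k / fact k) * of_real ((snd y - snd x) ^ l / fact l) = 0"
          by simp
      qed
      finally have 1: "norm (v i j (fst y) (snd y)) \<le> (real n + 2) * C * r ^ (Suc n - (i + j))" by simp
      also have "\<dots> = (real n + 2) * C * (r * r ^ (n - (i + j)))"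
        using ij by (simp add: Suc_diff_le)
      also have "\<dots> \<le> (real n0 + 2) * C * (d * r ^ (n - (i + j)))"
        using True C r0 n by (intro mult_mono mult_right_mono) auto
      finally have 1: "norm (v i j (fst y) (snd y)) \<le> ((real n0 + 2) * C) * (d * r ^ (n - (i + j)))" .
      have "norm (T y i j (fst y) (snd y) - T x i j (fst y) (snd y)) \<le> r ^ (N - (i + j))"
        using T_jet[OF x y, of i j] True d ij n by (simp add: r_def N_def norm_minus_commute)
      also have "\<dots> = r ^ (N - n) * r ^ (n - (i + j))"
        using ij n by (simp flip: power_add add: N_def)
      also have "\<dots> \<le> r ^ 1 * r ^ (n - (i + j))"
        using True d r0 n by (intro mult_right_mono power_decreasing) (auto simp: N_def)
      also have "\<dots> \<le> d * r ^ (n - (i + j))" using True r0 by (intro mult_right_mono) auto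
      finally have 2: "norm (T y i j (fst y) (snd y) - T x i j (fst y) (snd y)) \<le> d * r ^ (n - (i + j))" .
      have "P n y i j (fst y) (snd y) - P n x i j (fst y) (snd y)
        = (T y i j (fst y) (snd y) - T x i j (fst y) (snd y)) + v i j (fst y) (snd y)"
        using jet_at[OF y ij n] by (simp add: v_def)
      then have "norm (P n y i j (fst y) (snd y) - P n x i j (fst y) (snd y))
        \<le> d * r ^ (n - (i + j)) + ((real n0 + 2) * C) * (d * r ^ (n - (i + j)))"
        using 1 2 norm_triangle_mono by metis
      also have "\<dots> = (1 + (real n0 + 2) * C) * (d * r ^ (n - (i + j)))" by (simp add: distrib_right)
      also have "\<dots> \<le> Q * (d * r ^ (n - (i + j)))"
        using d r0 C D by (intro mult_right_mono) (auto simp: Q_def)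
      finally show ?thesis by (simp add: mult.assoc)
    next
      case False
      have "norm (P n x i j (fst y) (snd y)) \<le> (real n + 1)\<^sup>2 * ((C * d ^ Suc n0) * D ^ (n - (i + j)))"
      proof (rule polynomial_bound[where a = "fst x" and b = "snd x"])
        show "norm (P n x i j (fst x) (snd x)) \<le> (C * d ^ Suc n0) * D ^ (n - (i + j))" if "i + j \<le> n" for i j
        proof -
          have "norm (P n x i j (fst x) (snd x)) \<le> (C * d ^ Suc n0) * 1" using small[OF x that n] by simp
          also have "\<dots> \<le> (C * d ^ Suc n0) * D ^ (n - (i + j))"
            using C d D by (intro mult_left_mono one_le_power) auto
          finally show ?thesis .
        qed
        show "\<bar>fst y - fst x\<bar> \<le> D" "\<bar>snd y - snd x\<bar> \<le> D"
          using R[OF x] R[OF y] unfolding D_def by linarith+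
      qed (use ij C d in \<open>auto simp: P_def tensor_wave_taylor wave_taylor_eq_0\<close>)
      also have "\<dots> \<le> (real n0 + 1)\<^sup>2 * ((C * d ^ Suc n0) * D ^ n0)"
        using n C d D by (intro mult_mono power_mono mult_left_mono power_increasing) auto
      finally have 1: "norm (P n x i j (fst y) (snd y)) \<le> (real n0 + 1)\<^sup>2 * ((C * d ^ Suc n0) * D ^ n0)" .
      have "norm (P n y i j (fst y) (snd y) - P n x i j (fst y) (snd y))
        \<le> C * d ^ Suc n0 + (real n0 + 1)\<^sup>2 * ((C * d ^ Suc n0) * D ^ n0)"
        by (rule order_trans[OF norm_triangle_ineq4 add_mono[OF small[OF y ij n] 1]])
      also have "\<dots> = (C * (1 + (real n0 + 1)\<^sup>2 * D ^ n0)) * (d * d ^ n0)" by (simp add: algebra_simps)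
      also have "\<dots> \<le> Q * (d * r ^ (n - (i + j)))"
      proof (intro mult_mono)
        show "C * (1 + (real n0 + 1)\<^sup>2 * D ^ n0) \<le> Q" using C by (simp add: Q_def)
        have "d ^ n0 \<le> d ^ (n - (i + j))" using d n by (intro power_decreasing) auto
        also have "\<dots> \<le> r ^ (n - (i + j))" using False d by (intro power_mono) auto
        finally show "d ^ n0 \<le> r ^ (n - (i + j))" .
      qed (use d Q in auto)
      finally show ?thesis by (simp add: mult.assoc)
    qed
    also have "\<dots> \<le> e * r ^ (n - (i + j))" using dQ r0 by (intro mult_right_mono) auto
    finally show "norm (wave_taylor n (\<lambda>k. A k y - G k (fst y)) (\<lambda>k. B k y - H k (snd y)) y i j (fst y) (snd y)
        - wave_taylor n (\<lambda>k. A k x - G k (fst x)) (\<lambda>k. B k x - H k (snd x)) x i j (fst y) (snd y))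
      \<le> e * maxdist x y ^ (n - (i + j))"
      by (simp add: P_def a_def b_def r_def)
  qed
qed

subsection \<open>Taylor remainders of jets in the plane\<close>

definition mi :: "nat \<Rightarrow> nat \<Rightarrow> nat^2" where
  "mi i j = vector [i, j]"

lemma mi_nth [simp]: "mi i j $ 1 = i" "mi i j $ 2 = j"
  by (simp_all add: mi_def)

lemma mi_eta: "mi (\<alpha> $ 1) (\<alpha> $ 2) = \<alpha>"
  by (simp add: vec_eq_iff forall_2)

lemma mi_add_axis: "mi i j + axis 1 1 = mi (Suc i) j" "mi i j + axis 2 1 = mi i (Suc j)"
  by (simp_all add: vec_eq_iff forall_2 axis_def)

lemma mi_order_eq: "mi_order \<alpha> = \<alpha> $ 1 + \<alpha> $ 2"
  by (simp add: mi_order_def sum_2)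

lemma mi_fact_eq: "mi_fact \<alpha> = fact (\<alpha> $ 1) * fact (\<alpha> $ 2)"
  by (simp add: mi_fact_def UNIV_2)

lemma mi_power_eq: "mi_power x \<alpha> = x $ 1 ^ \<alpha> $ 1 * x $ 2 ^ \<alpha> $ 2"
  by (simp add: mi_power_def UNIV_2)

lemma sum_mi_order:
  "(\<Sum>\<beta> | mi_order \<beta> \<le> n. h \<beta>) = (\<Sum>k\<le>n. \<Sum>i\<le>k. h (mi i (k - i)))"
proof -
  have "(\<Sum>k\<le>n. \<Sum>i\<le>k. h (mi i (k - i))) = (\<Sum>(k, i)\<in>(SIGMA k:{..n}. {..k}). h (mi i (k - i)))"
    by (simp add: sum.Sigma)
  also have "\<dots> = (\<Sum>\<beta> | mi_order \<beta> \<le> n. h \<beta>)"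
    by (rule sum.reindex_bij_witness[of _ "\<lambda>\<beta>. (mi_order \<beta>, \<beta> $ 1)" "\<lambda>(k, i). mi i (k - i)"])
      (auto simp: mi_order_eq mi_eta)
  finally show ?thesis by simp
qed

definition mi_family :: "(nat^2 \<Rightarrow> real^2 \<Rightarrow> complex) \<Rightarrow> bool" where
  "mi_family P \<longleftrightarrow> (\<forall>\<alpha> j y. ((\<lambda>t. P \<alpha> (y + t *\<^sub>R axis j 1)) has_vector_derivative P (\<alpha> + axis j 1) y) (at 0))"

text \<open>\<open>partial\<close> is an unguarded \<open>vector_derivative\<close>; a family with
  genuine derivatives in both directions determines its values, and the iteration then climbs
  through the family.\<close>

lemma mi_deriv_family:
  assumes "mi_family P"
  shows "mi_deriv \<alpha> (P 0) = P \<alpha>"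
proof -
  have p: "partial j (P \<beta>) = P (\<beta> + axis j 1)" for j \<beta>
    using assms unfolding mi_family_def partial_def fun_eq_iff by (blast intro: vector_derivative_at)
  have "0 = mi 0 0" by (simp add: vec_eq_iff forall_2)
  then have 2: "(partial 2 ^^ j) (P 0) = P (mi 0 j)" for j
    by (induction j) (simp_all add: p mi_add_axis del: One_nat_def)
  have "(partial 1 ^^ i) (P (mi 0 j)) = P (mi i j)" for i j
    by (induction i) (simp_all add: p mi_add_axis del: One_nat_def)
  with 2 show ?thesis by (simp add: mi_deriv_def mi_eta)
qed

text \<open>Divided powers s^k / k!, for which differentiation only lowers the index; the factorials
  of the Taylor polynomial are absorbed.\<close>

definition monomial :: "nat \<Rightarrow> nat \<Rightarrow> real \<Rightarrow> complex" where
  "monomial k i s = (if i \<le> k then of_real (s ^ (k - i) / fact (k - i)) else 0)"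

lemma monomial_deriv: "(monomial k i has_vector_derivative monomial k (Suc i) s) (at s)"
proof -
  have eq: "taylor_seq k (\<lambda>l. if l = k then 1 else 0) 0 i s = monomial k i s" for i s
  proof -
    have "taylor_seq k (\<lambda>l. if l = k then 1 else 0) 0 i s = (\<Sum>l\<le>k. if l = k then monomial k i s else 0)"
      unfolding taylor_seq_def by (intro sum.cong) (auto simp: monomial_def)
    then show ?thesis by simp
  qed
  have "monomial k i = taylor_seq k (\<lambda>l. if l = k then 1 else 0) 0 i" for i
    by (simp add: fun_eq_iff eq)
  with deriv_seqD[OF deriv_seq_taylor_seq] show ?thesis by simp
qed

definition taylor_deriv :: "nat \<Rightarrow> jet \<Rightarrow> real^2 \<Rightarrow> nat^2 \<Rightarrow> real^2 \<Rightarrow> complex" where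
  "taylor_deriv n f x \<alpha> y = (\<Sum>\<beta> | mi_order \<beta> \<le> n.
     f \<beta> x * (monomial (\<beta> $ 1) (\<alpha> $ 1) (y $ 1 - x $ 1) * monomial (\<beta> $ 2) (\<alpha> $ 2) (y $ 2 - x $ 2)))"

lemma has_vector_derivative_line:
  fixes h :: "real \<Rightarrow> complex"
  assumes "\<And>s. (h has_vector_derivative h' s) (at s)"
  shows "((\<lambda>t. h (a + t * c)) has_vector_derivative of_real c * h' a) (at 0)"
proof -
  have "((\<lambda>t. a + t * c) has_vector_derivative c) (at 0)"
    by (auto intro!: derivative_eq_intros simp: has_vector_derivative_def)
  from vector_diff_chain_at[OF this, of h "h' a"] assms[of a] show ?thesis
    by (simp add: o_def scaleR_conv_of_real)
qed

lemma mi_family_taylor_deriv: "mi_family (taylor_deriv n f x)"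
  unfolding mi_family_def
proof (intro allI)
  fix \<alpha> :: "nat^2" and j :: 2 and y :: "real^2"
  consider "j = 1" | "j = 2" using exhaust_2 by blast
  then show "((\<lambda>t. taylor_deriv n f x \<alpha> (y + t *\<^sub>R axis j 1)) has_vector_derivative taylor_deriv n f x (\<alpha> + axis j 1) y) (at 0)"
  proof cases
    case 1
    have "((\<lambda>t. monomial k i ((y $ 1 - x $ 1) + t * 1)) has_vector_derivative of_real 1 * monomial k (Suc i) (y $ 1 - x $ 1)) (at 0)" for k i
      by (rule has_vector_derivative_line[OF monomial_deriv])
    then have d: "((\<lambda>t. monomial k i (y $ 1 + t - x $ 1)) has_vector_derivative monomial k (Suc i) (y $ 1 - x $ 1)) (at 0)" for k i
      by (simp add: algebra_simps)
    show ?thesis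
      unfolding taylor_deriv_def 1
      by (intro has_vector_derivative_sum has_vector_derivative_mult_right)
        (auto simp: axis_def intro!: has_vector_derivative_mult_left d)
  next
    case 2
    have "((\<lambda>t. monomial k i ((y $ 2 - x $ 2) + t * 1)) has_vector_derivative of_real 1 * monomial k (Suc i) (y $ 2 - x $ 2)) (at 0)" for k i
      by (rule has_vector_derivative_line[OF monomial_deriv])
    then have d: "((\<lambda>t. monomial k i (y $ 2 + t - x $ 2)) has_vector_derivative monomial k (Suc i) (y $ 2 - x $ 2)) (at 0)" for k i
      by (simp add: algebra_simps)
    show ?thesis
      unfolding taylor_deriv_def 2
      by (intro has_vector_derivative_sum has_vector_derivative_mult_right)
        (auto simp: axis_def intro!: has_vector_derivative_mult_right d)
  qed
qed

lemma taylor_deriv_0: "taylor_deriv n f x 0 = taylor_jet n f x"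
  by (simp add: fun_eq_iff taylor_deriv_def taylor_jet_def monomial_def mi_fact_eq mi_power_eq)

lemma mi_deriv_taylor_jet: "mi_deriv \<alpha> (taylor_jet n f x) = taylor_deriv n f x \<alpha>"
  using mi_deriv_family[OF mi_family_taylor_deriv] by (simp add: taylor_deriv_0)

lemma taylor_deriv_cong: "(\<And>\<beta>. f \<beta> x = g \<beta> x) \<Longrightarrow> taylor_deriv n f x = taylor_deriv n g x"
  by (simp add: taylor_deriv_def fun_eq_iff)

lemma binomial_taylor:
  fixes w1 w2 a :: complex
  shows "(\<Sum>i\<le>k. a / (fact i * fact (k - i)) * (w1 ^ i * w2 ^ (k - i))) = a * ((w1 + w2) ^ k / fact k)"
proof -
  have "a / (fact i * fact (k - i)) * (w1 ^ i * w2 ^ (k - i))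
    = a / fact k * (of_nat (k choose i) * w1 ^ i * w2 ^ (k - i))" if "i \<le> k" for i
    unfolding binomial_fact[OF that] by simp
  then have "(\<Sum>i\<le>k. a / (fact i * fact (k - i)) * (w1 ^ i * w2 ^ (k - i)))
    = (\<Sum>i\<le>k. a / fact k * (of_nat (k choose i) * w1 ^ i * w2 ^ (k - i)))"
    by (intro sum.cong) auto
  then show ?thesis by (simp only: sum_distrib_left[symmetric] binomial_ring[symmetric]) simp
qed

text \<open>By the binomial theorem the part of degree k collapses to a k (u - u0)^k / k! + b k (v -
  v0)^k / k!, where the sign reflects dv/dx2 = -1. So the Taylor polynomial in the plane is a sum of
  two Taylor polynomials in one variable. Its derivatives follow because the right side is a family
  closed under partial derivatives.\<close>

lemma taylor_deriv_wave:
  assumes f: "\<And>\<alpha>. f \<alpha> x = a (mi_order \<alpha>) + (-1) ^ (\<alpha> $ 2) * b (mi_order \<alpha>)"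
  shows "taylor_deriv n f x \<alpha> y = taylor_seq n a (x $ 1 + x $ 2) (mi_order \<alpha>) (y $ 1 + y $ 2)
    + (-1) ^ (\<alpha> $ 2) * taylor_seq n b (x $ 1 - x $ 2) (mi_order \<alpha>) (y $ 1 - y $ 2)"
proof -
  define P where "P = (\<lambda>\<alpha> (y :: real^2). taylor_seq n a (x $ 1 + x $ 2) (mi_order \<alpha>) (y $ 1 + y $ 2)
    + (-1) ^ (\<alpha> $ 2) * taylor_seq n b (x $ 1 - x $ 2) (mi_order \<alpha>) (y $ 1 - y $ 2))"
  have "mi_family P"
    unfolding mi_family_def
  proof (intro allI)
    fix \<alpha> :: "nat^2" and j :: 2 and y :: "real^2"
    define s where "s = (if j = 1 then 1 else -1 :: real)"
    have j: "j = 1 \<or> j = 2" using exhaust_2 by blast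
    have n1: "(y + t *\<^sub>R axis j 1) $ 1 + (y + t *\<^sub>R axis j 1) $ 2 = y $ 1 + y $ 2 + t * 1" for t
      using j by (auto simp: axis_def)
    have n2: "(y + t *\<^sub>R axis j 1) $ 1 - (y + t *\<^sub>R axis j 1) $ 2 = y $ 1 - y $ 2 + t * s" for t
      using j by (auto simp: axis_def s_def)
    have o: "mi_order (\<alpha> + axis j 1) = Suc (mi_order \<alpha>)"
      using j by (auto simp: mi_order_eq axis_def)
    have sg: "(-1) ^ ((\<alpha> + axis j 1) $ 2) = (-1) ^ (\<alpha> $ 2) * complex_of_real s"
      using j by (auto simp: axis_def s_def)
    have D: "((\<lambda>t. taylor_seq n c z i (r + t * q)) has_vector_derivative of_real q * taylor_seq n c z (Suc i) r) (at 0)" for c z i r q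
      by (rule has_vector_derivative_line[OF deriv_seqD[OF deriv_seq_taylor_seq]])
    have "((\<lambda>t. taylor_seq n a (x $ 1 + x $ 2) (mi_order \<alpha>) (y $ 1 + y $ 2 + t * 1)
        + (-1) ^ (\<alpha> $ 2) * taylor_seq n b (x $ 1 - x $ 2) (mi_order \<alpha>) (y $ 1 - y $ 2 + t * s))
      has_vector_derivative of_real 1 * taylor_seq n a (x $ 1 + x $ 2) (Suc (mi_order \<alpha>)) (y $ 1 + y $ 2)
        + (-1) ^ (\<alpha> $ 2) * (of_real s * taylor_seq n b (x $ 1 - x $ 2) (Suc (mi_order \<alpha>)) (y $ 1 - y $ 2))) (at 0)"
      by (intro has_vector_derivative_add has_vector_derivative_mult_right D)
    then show "((\<lambda>t. P \<alpha> (y + t *\<^sub>R axis j 1)) has_vector_derivative P (\<alpha> + axis j 1) y) (at 0)"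
      unfolding P_def n1 n2 o sg by (simp add: mult.assoc)
  qed
  from mi_deriv_family[OF this] have "mi_deriv \<alpha> (P 0) = P \<alpha>" .
  moreover have "P 0 = taylor_jet n f x"
  proof
    fix y :: "real^2"
    define w1 w2 where "w1 = complex_of_real (y $ 1 - x $ 1)" and "w2 = complex_of_real (y $ 2 - x $ 2)"
    have "taylor_jet n f x y = (\<Sum>k\<le>n. \<Sum>i\<le>k. (a k + (-1) ^ (k - i) * b k) / (fact i * fact (k - i)) * (w1 ^ i * w2 ^ (k - i)))"
      unfolding taylor_jet_def sum_mi_order
      by (intro sum.cong refl) (simp add: f mi_fact_eq mi_power_eq mi_order_eq w1_def w2_def)
    also have "\<dots> = (\<Sum>k\<le>n. (\<Sum>i\<le>k. a k / (fact i * fact (k - i)) * (w1 ^ i * w2 ^ (k - i)))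
        + (\<Sum>i\<le>k. b k / (fact i * fact (k - i)) * (w1 ^ i * (- w2) ^ (k - i))))"
      unfolding sum.distrib[symmetric]
      by (intro sum.cong refl) (simp add: power_minus[of w2] add_divide_distrib distrib_right distrib_left mult_ac)
    also have "\<dots> = (\<Sum>k\<le>n. a k * ((w1 + w2) ^ k / fact k) + b k * ((w1 + - w2) ^ k / fact k))"
      unfolding binomial_taylor ..
    also have "\<dots> = P 0 y"
      by (simp add: P_def taylor_seq_def mi_order_eq sum.distrib w1_def w2_def algebra_simps)
    finally show "P 0 y = taylor_jet n f x y" by simp
  qed
  ultimately show ?thesis by (simp add: mi_deriv_taylor_jet[symmetric] P_def)
qed

section \<open>Whitney remainders, quotients and norms\<close>

definition whitney_rem :: "nat \<Rightarrow> jet \<Rightarrow> real^2 \<Rightarrow> nat^2 \<Rightarrow> real^2 \<Rightarrow> complex" where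
  "whitney_rem n f x \<alpha> y = f \<alpha> y - taylor_deriv n f x \<alpha> y"

lemma whitney_rem_cong:
  "(\<And>\<beta>. f \<beta> x = g \<beta> x) \<Longrightarrow> f \<alpha> y = g \<alpha> y \<Longrightarrow> whitney_rem n f x \<alpha> y = whitney_rem n g x \<alpha> y"
  using taylor_deriv_cong[of f x g n] by (simp add: whitney_rem_def)

lemma whitney_rem_add: "whitney_rem n (\<lambda>\<alpha> x. f \<alpha> x + g \<alpha> x) x \<alpha> y = whitney_rem n f x \<alpha> y + whitney_rem n g x \<alpha> y"
  by (simp add: whitney_rem_def taylor_deriv_def distrib_right sum.distrib)

lemma whitney_rem_uminus: "whitney_rem n (\<lambda>\<alpha> x. - f \<alpha> x) x \<alpha> y = - whitney_rem n f x \<alpha> y"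
  by (simp add: whitney_rem_def taylor_deriv_def sum_negf)

lemma whitney_q_eq: "whitney_q K n t f =
     Sup {ennreal (norm (whitney_rem n f x \<alpha> y) / norm (x - y) ^ (n - mi_order \<alpha>)) | \<alpha> x y.
          mi_order \<alpha> \<le> n \<and> x \<in> K \<and> y \<in> K \<and> 0 < norm (x - y) \<and> norm (x - y) < t}"
  by (simp add: whitney_q_def whitney_rem_def mi_deriv_taylor_jet)

lemma whitney_q_le:
  assumes "\<And>\<alpha> x y. mi_order \<alpha> \<le> n \<Longrightarrow> x \<in> K \<Longrightarrow> y \<in> K \<Longrightarrow> 0 < norm (x - y) \<Longrightarrow> norm (x - y) < t \<Longrightarrow>
    norm (whitney_rem n f x \<alpha> y) \<le> c * norm (x - y) ^ (n - mi_order \<alpha>)"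
  shows "whitney_q K n t f \<le> ennreal c"
  unfolding whitney_q_eq
proof (rule Sup_least)
  fix z assume "z \<in> {ennreal (norm (whitney_rem n f x \<alpha> y) / norm (x - y) ^ (n - mi_order \<alpha>)) | \<alpha> x y.
          mi_order \<alpha> \<le> n \<and> x \<in> K \<and> y \<in> K \<and> 0 < norm (x - y) \<and> norm (x - y) < t}"
  then obtain \<alpha> x y where z: "z = ennreal (norm (whitney_rem n f x \<alpha> y) / norm (x - y) ^ (n - mi_order \<alpha>))"
    and xy: "mi_order \<alpha> \<le> n" "x \<in> K" "y \<in> K" "0 < norm (x - y)" "norm (x - y) < t" by blast
  have "norm (whitney_rem n f x \<alpha> y) / norm (x - y) ^ (n - mi_order \<alpha>) \<le> c"
    using assms[OF xy] xy(4) by (simp add: divide_le_eq del: zero_less_norm_iff)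
  then show "z \<le> ennreal c" unfolding z by (rule ennreal_leI)
qed

lemma whitney_q_bound:
  assumes "whitney_q K n t f \<le> ennreal c" "0 \<le> c"
    "mi_order \<alpha> \<le> n" "x \<in> K" "y \<in> K" "0 < norm (x - y)" "norm (x - y) < t"
  shows "norm (whitney_rem n f x \<alpha> y) \<le> c * norm (x - y) ^ (n - mi_order \<alpha>)"
proof -
  have "ennreal (norm (whitney_rem n f x \<alpha> y) / norm (x - y) ^ (n - mi_order \<alpha>)) \<le> whitney_q K n t f"
    unfolding whitney_q_eq by (rule Sup_upper) (use assms in blast)
  also note assms(1)
  finally have "norm (whitney_rem n f x \<alpha> y) / norm (x - y) ^ (n - mi_order \<alpha>) \<le> c"
    using assms(2) by (simp add: ennreal_le_iff)
  then show ?thesis using assms(6) by (simp add: divide_le_eq del: zero_less_norm_iff)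
qed

lemma whitney_norm_le:
  assumes "\<And>\<alpha> x. x \<in> K \<Longrightarrow> mi_order \<alpha> \<le> n \<Longrightarrow> norm (f \<alpha> x) \<le> b"
    and "\<And>\<alpha> x y. mi_order \<alpha> \<le> n \<Longrightarrow> x \<in> K \<Longrightarrow> y \<in> K \<Longrightarrow> 0 < norm (x - y) \<Longrightarrow>
      norm (whitney_rem n f x \<alpha> y) \<le> c * norm (x - y) ^ (n - mi_order \<alpha>)"
  shows "whitney_norm n K f \<le> ennreal b + ennreal c"
  unfolding whitney_norm_def
proof (rule add_mono)
  show "Sup {ennreal (norm (f \<alpha> x)) |\<alpha> x. x \<in> K \<and> mi_order \<alpha> \<le> n} \<le> ennreal b"
    using assms(1) by (intro Sup_least) (auto intro: ennreal_leI)
  show "(SUP t\<in>{0<..}. whitney_q K n t f) \<le> ennreal c"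
    using assms(2) by (intro SUP_least whitney_q_le) auto
qed

lemma whitney_norm_triangle:
  assumes h: "\<And>\<alpha> x. x \<in> K \<Longrightarrow> h \<alpha> x = f \<alpha> x + g \<alpha> x"
  shows "whitney_norm n K h \<le> whitney_norm n K f + whitney_norm n K g"
proof -
  let ?S = "\<lambda>f. Sup {ennreal (norm (f \<alpha> x)) |\<alpha> x. x \<in> K \<and> mi_order \<alpha> \<le> n}"
  have S: "?S h \<le> ?S f + ?S g"
  proof (rule Sup_least)
    fix z assume "z \<in> {ennreal (norm (h \<alpha> x)) |\<alpha> x. x \<in> K \<and> mi_order \<alpha> \<le> n}"
    then obtain \<alpha> x where x: "x \<in> K" "mi_order \<alpha> \<le> n" and z: "z = ennreal (norm (h \<alpha> x))" by blast
    have "z \<le> ennreal (norm (f \<alpha> x) + norm (g \<alpha> x))"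
      unfolding z h[OF x(1)] by (intro ennreal_leI norm_triangle_ineq)
    also have "\<dots> = ennreal (norm (f \<alpha> x)) + ennreal (norm (g \<alpha> x))" by simp
    also have "\<dots> \<le> ?S f + ?S g" using x by (intro add_mono Sup_upper) blast+
    finally show "z \<le> ?S f + ?S g" .
  qed
  have q: "whitney_q K n t h \<le> whitney_q K n t f + whitney_q K n t g" for t
    unfolding whitney_q_eq[of K n t h]
  proof (rule Sup_least)
    fix z assume "z \<in> {ennreal (norm (whitney_rem n h x \<alpha> y) / norm (x - y) ^ (n - mi_order \<alpha>)) | \<alpha> x y.
          mi_order \<alpha> \<le> n \<and> x \<in> K \<and> y \<in> K \<and> 0 < norm (x - y) \<and> norm (x - y) < t}"
    then obtain \<alpha> x y where z: "z = ennreal (norm (whitney_rem n h x \<alpha> y) / norm (x - y) ^ (n - mi_order \<alpha>))"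
      and xy: "mi_order \<alpha> \<le> n" "x \<in> K" "y \<in> K" "0 < norm (x - y)" "norm (x - y) < t" by blast
    have "whitney_rem n h x \<alpha> y = whitney_rem n f x \<alpha> y + whitney_rem n g x \<alpha> y"
      unfolding whitney_rem_add[symmetric] by (rule whitney_rem_cong) (auto simp: h xy)
    then have "z \<le> ennreal (norm (whitney_rem n f x \<alpha> y) / norm (x - y) ^ (n - mi_order \<alpha>)
       + norm (whitney_rem n g x \<alpha> y) / norm (x - y) ^ (n - mi_order \<alpha>))"
      unfolding z add_divide_distrib[symmetric]
      by (intro ennreal_leI divide_right_mono) (auto intro: norm_triangle_ineq)
    also have "\<dots> = ennreal (norm (whitney_rem n f x \<alpha> y) / norm (x - y) ^ (n - mi_order \<alpha>))
       + ennreal (norm (whitney_rem n g x \<alpha> y) / norm (x - y) ^ (n - mi_order \<alpha>))" by simp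
    also have "\<dots> \<le> whitney_q K n t f + whitney_q K n t g"
      unfolding whitney_q_eq using xy by (intro add_mono Sup_upper) blast+
    finally show "z \<le> whitney_q K n t f + whitney_q K n t g" .
  qed
  have "(SUP t\<in>{0<..}. whitney_q K n t h) \<le> (SUP t\<in>{0<..}. whitney_q K n t f) + (SUP t\<in>{0<..}. whitney_q K n t g)"
    by (intro SUP_least order_trans[OF q] add_mono SUP_upper)
  from add_mono[OF S this] show ?thesis
    unfolding whitney_norm_def by (simp only: add_ac)
qed

lemma whitney_norm_mono: "K \<subseteq> L \<Longrightarrow> whitney_norm n K f \<le> whitney_norm n L f"
  unfolding whitney_norm_def whitney_q_def
  by (intro add_mono SUP_mono' Sup_subset_mono) blast+

lemma whitney_norm_cong:
  assumes "\<And>\<alpha> x. x \<in> K \<Longrightarrow> f \<alpha> x = g \<alpha> x"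
  shows "whitney_norm n K f = whitney_norm n K g"
proof -
  have "whitney_norm n K f \<le> whitney_norm n K g" if "\<And>\<alpha> x. x \<in> K \<Longrightarrow> f \<alpha> x = g \<alpha> x" for f g
  proof -
    have "whitney_norm n K (\<lambda>_ _. 0) \<le> ennreal 0 + ennreal 0"
      by (rule whitney_norm_le) (auto simp: whitney_rem_def taylor_deriv_def)
    then show ?thesis using whitney_norm_triangle[of K f g "\<lambda>_ _. 0" n] that by simp
  qed
  then show ?thesis using assms by (simp add: antisym)
qed

subsection \<open>Solutions as pairs of functions of one variable\<close>

definition uv :: "real^2 \<Rightarrow> real \<times> real" where
  "uv x = (x $ 1 + x $ 2, x $ 1 - x $ 2)"

definition xy :: "real \<times> real \<Rightarrow> real^2" where
  "xy p = vector [(fst p + snd p) / 2, (fst p - snd p) / 2]"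

lemma uv_xy [simp]: "uv (xy p) = p" and xy_uv [simp]: "xy (uv x) = x"
  by (simp_all add: uv_def xy_def prod_eq_iff vec_eq_iff forall_2 field_simps)

lemma continuous_on_uv: "continuous_on S uv"
  unfolding uv_def by (intro continuous_intros)

lemma norm_le_maxdist: "norm (x - y) \<le> maxdist (uv x) (uv y)"
  and maxdist_le_norm: "maxdist (uv x) (uv y) \<le> 2 * norm (x - y)"
proof -
  have "norm (x - y) \<le> \<bar>(x - y) $ 1\<bar> + \<bar>(x - y) $ 2\<bar>"
    using norm_le_l1_cart[of "x - y"] by (simp add: sum_2)
  also have "\<dots> \<le> maxdist (uv x) (uv y)"
    by (auto simp: maxdist_def uv_def max_def abs_if)
  finally show "norm (x - y) \<le> maxdist (uv x) (uv y)" .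
  have "\<bar>(x - y) $ 1\<bar> \<le> norm (x - y)" "\<bar>(x - y) $ 2\<bar> \<le> norm (x - y)"
    by (rule component_le_norm_cart)+
  then show "maxdist (uv x) (uv y) \<le> 2 * norm (x - y)"
    unfolding maxdist_le_iff uv_def by simp linarith
qed

text \<open>
  A jet with \<open>P(D) f = 0\<close> has no mixed derivatives in \<open>u\<close> and \<open>v\<close>, so it is given by its pure
  derivatives \<open>a k\<close> along \<open>u\<close> and \<open>b k\<close> along \<open>v\<close>, with \<open>a 0 + b 0\<close> the function itself.
\<close>

definition wave_jet :: "(nat \<Rightarrow> real^2 \<Rightarrow> complex) \<Rightarrow> (nat \<Rightarrow> real^2 \<Rightarrow> complex) \<Rightarrow> jet" where
  "wave_jet a b = (\<lambda>\<alpha> x. a (mi_order \<alpha>) x + (-1) ^ (\<alpha> $ 2) * b (mi_order \<alpha>) x)"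

text \<open>For k > 0, \<open>jet_u\<close> and \<open>jet_v\<close> invert f^(k,0) = a k + b k and
  f^(k-1,1) = a k - b k. In order 0 the whole value is put into the u part.\<close>

definition jet_u :: "jet \<Rightarrow> nat \<Rightarrow> real^2 \<Rightarrow> complex" where
  "jet_u f k x = (if k = 0 then f (mi 0 0) x else (f (mi k 0) x + f (mi (k - 1) 1) x) / 2)"

definition jet_v :: "jet \<Rightarrow> nat \<Rightarrow> real^2 \<Rightarrow> complex" where
  "jet_v f k x = (if k = 0 then 0 else (f (mi k 0) x - f (mi (k - 1) 1) x) / 2)"

text \<open>The equation trades two derivatives in the second variable for two in the first, so in
  each order k > 0 everything is determined by the multi-indices (k, 0) and (k - 1, 1).\<close>

lemma wave_jet_eq:
  assumes "wave_operator f = (\<lambda>\<alpha> x. 0)"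
  shows "f = wave_jet (jet_u f) (jet_v f)"
proof (intro ext)
  fix \<alpha> :: "nat^2" and x
  have w: "f (mi i (Suc (Suc j))) x = f (mi (Suc (Suc i)) j) x" for i j
  proof -
    have "wave_operator f (mi i j) x = 0" using assms by simp
    then show ?thesis by (simp add: wave_operator_def jet_partial_def mi_add_axis del: One_nat_def)
  qed
  have "f (mi i j) x = jet_u f (i + j) x + (-1) ^ j * jet_v f (i + j) x" for i j
  proof (induction j arbitrary: i rule: nat_less_induct)
    case (1 j)
    consider "j = 0" | "j = 1" | k where "j = Suc (Suc k)" by (metis One_nat_def not0_implies_Suc)
    then show ?case
    proof cases
      case 1
      then show ?thesis by (simp add: jet_u_def jet_v_def field_simps)
    next
      case 2
      then show ?thesis by (simp add: jet_u_def jet_v_def field_simps)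
    next
      case 3
      with 1 have "f (mi (Suc (Suc i)) k) x = jet_u f (Suc (Suc i) + k) x + (-1) ^ k * jet_v f (Suc (Suc i) + k) x"
        by simp
      with 3 show ?thesis by (simp add: w)
    qed
  qed
  from this[of "\<alpha> $ 1" "\<alpha> $ 2"] show "f \<alpha> x = wave_jet (jet_u f) (jet_v f) \<alpha> x"
    by (simp add: wave_jet_def mi_order_eq mi_eta)
qed

lemma wave_operator_wave_jet: "wave_operator (wave_jet a b) = (\<lambda>\<alpha> x. 0)"
proof (intro ext)
  fix \<alpha> :: "nat^2" and x
  have "mi_order (\<alpha> + axis j 1 + axis j 1) = Suc (Suc (mi_order \<alpha>))" if "j = 1 \<or> j = 2" for j
    using that by (auto simp: mi_order_eq axis_def)
  then show "wave_operator (wave_jet a b) \<alpha> x = 0"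
    by (simp add: wave_operator_def jet_partial_def wave_jet_def axis_def)
qed

text \<open>The first term is expanded and evaluated at the same point y, so it reads off the jet at
  y. In this form the remainder is, up to sign, the quantity that \<open>wave_jet_approx\<close>
  assumes to be controlled and then makes small.\<close>

definition wave_rem :: "nat \<Rightarrow> (nat \<Rightarrow> real^2 \<Rightarrow> complex) \<Rightarrow> (nat \<Rightarrow> real^2 \<Rightarrow> complex) \<Rightarrow> real^2 \<Rightarrow> nat \<Rightarrow> nat \<Rightarrow> real^2 \<Rightarrow> complex" where
  "wave_rem n a b x i j y =
     wave_taylor n (\<lambda>k. a k y) (\<lambda>k. b k y) (uv y) i j (fst (uv y)) (snd (uv y))
     - wave_taylor n (\<lambda>k. a k x) (\<lambda>k. b k x) (uv x) i j (fst (uv y)) (snd (uv y))"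

lemma whitney_rem_wave_jet:
  assumes "mi_order \<alpha> \<le> n"
  shows "whitney_rem n (wave_jet a b) x \<alpha> y =
    (if mi_order \<alpha> = 0 then wave_rem n a b x 0 0 y
     else wave_rem n a b x (mi_order \<alpha>) 0 y + (-1) ^ (\<alpha> $ 2) * wave_rem n a b x 0 (mi_order \<alpha>) y)"
proof -
  have "taylor_deriv n (wave_jet a b) x \<alpha> y = taylor_seq n (\<lambda>k. a k x) (x $ 1 + x $ 2) (mi_order \<alpha>) (y $ 1 + y $ 2)
    + (-1) ^ (\<alpha> $ 2) * taylor_seq n (\<lambda>k. b k x) (x $ 1 - x $ 2) (mi_order \<alpha>) (y $ 1 - y $ 2)"
    by (rule taylor_deriv_wave) (simp add: wave_jet_def)
  moreover have "\<alpha> $ 2 = 0" if "mi_order \<alpha> = 0" using that by (simp add: mi_order_eq)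
  ultimately show ?thesis
    using assms by (auto simp: whitney_rem_def wave_jet_def wave_rem_def wave_taylor_def uv_def const_seq_def taylor_seq_at algebra_simps)
qed

lemma wave_rem_mixed: "wave_rem n a b x (Suc i) (Suc j) y = 0"
  by (simp add: wave_rem_def wave_taylor_mixed)

text \<open>The multi-indices (k, 0) and (k - 1, 1) see the sum and the difference of the u part and
  the v part; each part is half of their sum or difference, so no constant is lost.\<close>

lemma wave_rem_bound:
  assumes rem: "\<And>\<alpha>. mi_order \<alpha> \<le> n \<Longrightarrow> norm (whitney_rem n (wave_jet a b) x \<alpha> y) \<le> c * r ^ (n - mi_order \<alpha>)"
    and "0 \<le> c" "0 \<le> r" "i + j \<le> n"
  shows "norm (wave_rem n a b x i j y) \<le> c * r ^ (n - (i + j))"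
proof -
  have o: "mi_order (mi k l) = k + l" for k l by (simp add: mi_order_eq)
  have "norm (wave_rem n a b x (Suc k) 0 y) \<le> c * r ^ (n - Suc k) \<and> norm (wave_rem n a b x 0 (Suc k) y) \<le> c * r ^ (n - Suc k)"
    if "Suc k \<le> n" for k
  proof -
    let ?p = "wave_rem n a b x (Suc k) 0 y" and ?q = "wave_rem n a b x 0 (Suc k) y"
    have "norm (?p + ?q) \<le> c * r ^ (n - Suc k)" "norm (?p - ?q) \<le> c * r ^ (n - Suc k)"
      using rem[of "mi (Suc k) 0"] rem[of "mi k 1"] that by (simp_all add: whitney_rem_wave_jet o)
    moreover have "2 * norm ?p \<le> norm (?p + ?q) + norm (?p - ?q)"
      using norm_triangle_ineq[of "?p + ?q" "?p - ?q"] by (simp add: norm_mult flip: mult_2)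
    moreover have "2 * norm ?q \<le> norm (?p + ?q) + norm (?p - ?q)"
      using norm_triangle_ineq4[of "?p + ?q" "?p - ?q"] by (simp add: norm_mult flip: mult_2)
    ultimately show ?thesis by simp
  qed
  moreover have "norm (wave_rem n a b x 0 0 y) \<le> c * r ^ n"
    using rem[of "mi 0 0"] by (simp add: whitney_rem_wave_jet o)
  moreover have "norm (wave_rem n a b x (Suc k) (Suc l) y) \<le> c * r ^ (n - (Suc k + Suc l))" for k l
    using assms by (simp add: wave_rem_mixed)
  ultimately show ?thesis using assms(4) by (cases i; cases j) auto
qed

section \<open>Remainder estimates and membership in the Whitney spaces\<close>

lemma whitney_compact_rem:
  assumes "f \<in> whitney_compact K" "0 < c"
  obtains t where "0 < t" "\<And>\<alpha> x y. mi_order \<alpha> \<le> n \<Longrightarrow> x \<in> K \<Longrightarrow> y \<in> K \<Longrightarrow> 0 < norm (x - y) \<Longrightarrow> norm (x - y) < t \<Longrightarrow>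
    norm (whitney_rem n f x \<alpha> y) \<le> c * norm (x - y) ^ (n - mi_order \<alpha>)"
proof -
  have "((\<lambda>t. whitney_q K n t f) \<longlongrightarrow> 0) (at_right 0)" using assms(1) by (simp add: whitney_compact_def)
  then have "\<forall>\<^sub>F t in at_right 0. whitney_q K n t f < ennreal c"
    using assms(2) by (intro order_tendstoD) auto
  then obtain s where s: "s > 0" "\<And>t. 0 < t \<Longrightarrow> t < s \<Longrightarrow> whitney_q K n t f < ennreal c"
    unfolding eventually_at_right_field by auto
  have "whitney_q K n (s / 2) f \<le> ennreal c" using s by (intro less_imp_le) auto
  from whitney_q_bound[OF this] show ?thesis
    using s assms by (intro that[of "s / 2"]) auto
qed

text \<open>One power of the distance more than the quotient divides by makes the quotient O(t).
  Close pairs are enough, as only the limit t -> 0 is tested.\<close>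

lemma in_whitneyI:
  assumes cont: "\<And>\<alpha>. continuous_on F (f \<alpha>)" and out: "\<And>\<alpha> x. x \<notin> F \<Longrightarrow> f \<alpha> x = 0"
    and rem: "\<And>K n. compact K \<Longrightarrow> K \<subseteq> F \<Longrightarrow> \<exists>C\<ge>0. \<exists>t0>0. \<forall>\<alpha> x y. mi_order \<alpha> \<le> n \<longrightarrow> x \<in> K \<longrightarrow> y \<in> K \<longrightarrow>
      norm (x - y) < t0 \<longrightarrow> norm (whitney_rem n f x \<alpha> y) \<le> C * norm (x - y) ^ Suc (n - mi_order \<alpha>)"
  shows "f \<in> whitney F"
proof -
  have "jet_restrict K f \<in> whitney_compact K" if K: "compact K" "K \<subseteq> F" for K
  proof -
    have "continuous_on K (jet_restrict K f \<alpha>)" for \<alpha>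
      using continuous_on_subset[OF cont[of \<alpha>] K(2)]
      by (rule continuous_on_eq) (simp add: jet_restrict_def)
    moreover have "((\<lambda>t. whitney_q K n t (jet_restrict K f)) \<longlongrightarrow> 0) (at_right 0)" for n
    proof -
      obtain C t0 where C: "0 \<le> C" "0 < t0" and rem: "\<And>\<alpha> x y. mi_order \<alpha> \<le> n \<Longrightarrow> x \<in> K \<Longrightarrow> y \<in> K \<Longrightarrow>
        norm (x - y) < t0 \<Longrightarrow> norm (whitney_rem n f x \<alpha> y) \<le> C * norm (x - y) ^ Suc (n - mi_order \<alpha>)"
        using rem[OF K, of n] by blast
      have q: "whitney_q K n t (jet_restrict K f) \<le> ennreal (C * t)" if "0 < t" "t < t0" for t
      proof (rule whitney_q_le)
        fix \<alpha> x y assume xy: "mi_order \<alpha> \<le> n" "x \<in> K" "y \<in> K" "norm (x - y) < t"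
        have "norm (whitney_rem n (jet_restrict K f) x \<alpha> y) = norm (whitney_rem n f x \<alpha> y)"
          by (subst whitney_rem_cong[of _ x f]) (simp_all add: jet_restrict_def xy)
        also have "\<dots> \<le> C * norm (x - y) ^ Suc (n - mi_order \<alpha>)"
          using xy that by (intro rem) auto
        also have "\<dots> = (C * norm (x - y)) * norm (x - y) ^ (n - mi_order \<alpha>)" by simp
        also have "\<dots> \<le> (C * t) * norm (x - y) ^ (n - mi_order \<alpha>)"
          using xy C by (intro mult_right_mono mult_left_mono) auto
        finally show "norm (whitney_rem n (jet_restrict K f) x \<alpha> y) \<le> (C * t) * norm (x - y) ^ (n - mi_order \<alpha>)" .
      qed
      have lim: "((\<lambda>t. ennreal (C * t)) \<longlongrightarrow> 0) (at_right 0)"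
      proof -
        have "((\<lambda>t. C * t) \<longlongrightarrow> C * 0) (at_right 0)" by (intro tendsto_intros)
        from tendsto_ennrealI[OF this] show ?thesis by simp
      qed
      have ev: "\<forall>\<^sub>F t in at_right 0. whitney_q K n t (jet_restrict K f) \<le> ennreal (C * t)"
        using C(2) q unfolding eventually_at_right_field by blast
      show ?thesis
        by (rule tendsto_sandwich[OF _ ev tendsto_const lim]) simp
    qed
    ultimately show ?thesis
      by (simp add: whitney_compact_def continuous_jets_def jet_restrict_def)
  qed
  then show ?thesis
    using cont out by (simp add: whitney_def continuous_jets_def)
qed

definition wave_solution :: "(nat \<Rightarrow> real \<Rightarrow> complex) \<Rightarrow> (nat \<Rightarrow> real \<Rightarrow> complex) \<Rightarrow> jet" where
  "wave_solution G H = wave_jet (\<lambda>k x. G k (fst (uv x))) (\<lambda>k x. H k (snd (uv x)))"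

lemma continuous_on_wave_solution:
  assumes "deriv_seq G" "deriv_seq H"
  shows "continuous_on S (wave_solution G H \<alpha>)"
proof -
  have GH: "continuous_on UNIV (G k)" "continuous_on UNIV (H k)" for k
    using assms by (auto intro!: continuous_at_imp_continuous_on deriv_seq_isCont)
  have "continuous_on S (\<lambda>x::real^2. G k (x $ 1 + x $ 2))" "continuous_on S (\<lambda>x::real^2. H k (x $ 1 - x $ 2))" for k
    by (rule continuous_on_compose2[OF GH(1)] continuous_on_compose2[OF GH(2)]; intro continuous_intros subset_UNIV)+
  then show ?thesis
    unfolding wave_solution_def wave_jet_def uv_def fst_conv snd_conv
    by (intro continuous_on_add continuous_on_mult continuous_on_const)
qed

lemma deriv_seq_rem_bound:
  assumes h: "deriv_seq h"
  obtains C where "0 \<le> C" "\<And>i s t. i \<le> n \<Longrightarrow> \<bar>s\<bar> \<le> R \<Longrightarrow> \<bar>t\<bar> \<le> R \<Longrightarrow>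
    norm (h i t - taylor_seq n (\<lambda>k. h k s) s i t) \<le> C * \<bar>t - s\<bar> ^ Suc (n - i)"
proof -
  have "compact (h (Suc n) ` {-R..R})"
    by (intro compact_continuous_image continuous_at_imp_continuous_on ballI deriv_seq_isCont[OF h]) auto
  then obtain C where C: "\<And>t. t \<in> {-R..R} \<Longrightarrow> norm (h (Suc n) t) \<le> C"
    by (meson bounded_iff compact_imp_bounded image_eqI)
  show ?thesis
  proof (rule that[of "\<bar>C\<bar>"])
    fix i s t assume i: "i \<le> n" and s: "\<bar>s\<bar> \<le> R" and t: "\<bar>t\<bar> \<le> R"
    have "norm (h (i + 0) t - (\<Sum>k\<le>n - i. h (i + k) s * of_real ((t - s) ^ k / fact k))) \<le> \<bar>C\<bar> * \<bar>t - s\<bar> ^ Suc (n - i)"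
    proof (rule taylor_bound_1[of "\<lambda>k. h (i + k)"])
      show "(h (i + k) has_vector_derivative h (i + Suc k) r) (at r)" for k r
        using deriv_seqD[OF h] by simp
      fix r assume "r \<in> closed_segment s t"
      then have "r \<in> {-R..R}" using s t by (auto simp: closed_segment_eq_real_ivl split: if_splits)
      from C[OF this] show "norm (h (i + Suc (n - i)) r) \<le> \<bar>C\<bar>" using i by simp
    qed
    then show "norm (h i t - taylor_seq n (\<lambda>k. h k s) s i t) \<le> \<bar>C\<bar> * \<bar>t - s\<bar> ^ Suc (n - i)"
      using i by (simp add: taylor_seq_shift)
  qed simp
qed

text \<open>By \<open>taylor_deriv_wave\<close> the remainder is a sum of two remainders in one
  variable, each with the spare power that \<open>in_whitneyI\<close> asks for.\<close>

lemma wave_solution_rem: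
  assumes "deriv_seq G" "deriv_seq H" "compact K"
  obtains C where "0 \<le> C" "\<And>\<alpha> x y. mi_order \<alpha> \<le> n \<Longrightarrow> x \<in> K \<Longrightarrow> y \<in> K \<Longrightarrow>
    norm (whitney_rem n (wave_solution G H) x \<alpha> y) \<le> C * norm (x - y) ^ Suc (n - mi_order \<alpha>)"
proof -
  obtain R where R: "\<And>x. x \<in> K \<Longrightarrow> \<bar>fst (uv x)\<bar> \<le> R" "\<And>x. x \<in> K \<Longrightarrow> \<bar>snd (uv x)\<bar> \<le> R"
  proof -
    have "compact (uv ` K)" by (intro compact_continuous_image continuous_on_uv assms)
    then obtain R where "\<And>x. x \<in> K \<Longrightarrow> norm (uv x) \<le> R"
      using compact_imp_bounded[of "uv ` K"] unfolding bounded_iff by auto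
    then show ?thesis
      by (intro that[of R]) (metis norm_fst_le norm_snd_le order_trans prod.collapse real_norm_def)+
  qed
  obtain CG where CG: "0 \<le> CG" "\<And>i s t. i \<le> n \<Longrightarrow> \<bar>s\<bar> \<le> R \<Longrightarrow> \<bar>t\<bar> \<le> R \<Longrightarrow>
    norm (G i t - taylor_seq n (\<lambda>k. G k s) s i t) \<le> CG * \<bar>t - s\<bar> ^ Suc (n - i)"
    using deriv_seq_rem_bound[OF assms(1)] by metis
  obtain CH where CH: "0 \<le> CH" "\<And>i s t. i \<le> n \<Longrightarrow> \<bar>s\<bar> \<le> R \<Longrightarrow> \<bar>t\<bar> \<le> R \<Longrightarrow>
    norm (H i t - taylor_seq n (\<lambda>k. H k s) s i t) \<le> CH * \<bar>t - s\<bar> ^ Suc (n - i)"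
    using deriv_seq_rem_bound[OF assms(2)] by metis
  show ?thesis
  proof (rule that[of "(CG + CH) * 2 ^ Suc n"])
    fix \<alpha> x y assume \<alpha>: "mi_order \<alpha> \<le> n" and x: "x \<in> K" and y: "y \<in> K"
    let ?m = "mi_order \<alpha>" and ?r = "norm (x - y)"
    have "whitney_rem n (wave_solution G H) x \<alpha> y =
       (G ?m (fst (uv y)) - taylor_seq n (\<lambda>k. G k (fst (uv x))) (fst (uv x)) ?m (fst (uv y)))
      + (-1) ^ (\<alpha> $ 2) * (H ?m (snd (uv y)) - taylor_seq n (\<lambda>k. H k (snd (uv x))) (snd (uv x)) ?m (snd (uv y)))"
    proof -
      have "taylor_deriv n (wave_solution G H) x \<alpha> y = taylor_seq n (\<lambda>k. G k (fst (uv x))) (x $ 1 + x $ 2) ?m (y $ 1 + y $ 2)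
        + (-1) ^ (\<alpha> $ 2) * taylor_seq n (\<lambda>k. H k (snd (uv x))) (x $ 1 - x $ 2) ?m (y $ 1 - y $ 2)"
        by (rule taylor_deriv_wave) (simp add: wave_solution_def wave_jet_def)
      then show ?thesis
        by (simp add: whitney_rem_def wave_solution_def wave_jet_def uv_def algebra_simps)
    qed
    also have "norm \<dots> \<le> CG * \<bar>fst (uv y) - fst (uv x)\<bar> ^ Suc (n - ?m) + CH * \<bar>snd (uv y) - snd (uv x)\<bar> ^ Suc (n - ?m)"
      by (intro order_trans[OF norm_triangle_ineq] add_mono)
        (simp_all add: norm_mult norm_power CG(2) CH(2) \<alpha> R x y del: power_Suc)
    also have "\<dots> \<le> CG * (2 * ?r) ^ Suc (n - ?m) + CH * (2 * ?r) ^ Suc (n - ?m)"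
      using maxdist_le_norm[of x y] CG(1) CH(1) unfolding maxdist_le_iff
      by (intro add_mono mult_left_mono power_mono) (auto simp: abs_minus_commute)
    also have "\<dots> = (CG + CH) * 2 ^ Suc (n - ?m) * ?r ^ Suc (n - ?m)"
      unfolding power_mult_distrib by (simp only: distrib_right mult.assoc)
    also have "\<dots> \<le> (CG + CH) * 2 ^ Suc n * ?r ^ Suc (n - ?m)"
      using CG(1) CH(1) by (intro mult_right_mono mult_left_mono power_increasing) auto
    finally show "norm (whitney_rem n (wave_solution G H) x \<alpha> y) \<le> (CG + CH) * 2 ^ Suc n * ?r ^ Suc (n - ?m)" .
  qed (use CG CH in auto)
qed

lemma wave_solution_kernel:
  assumes "deriv_seq G" "deriv_seq H"
  shows "wave_solution G H \<in> whitney_kernel wave_operator UNIV"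
proof -
  have "wave_solution G H \<in> whitney UNIV"
  proof (rule in_whitneyI[OF continuous_on_wave_solution[OF assms]])
    fix K :: "(real^2) set" and n assume "compact K"
    from wave_solution_rem[OF assms this, of n]
    obtain C where "0 \<le> C" "\<And>\<alpha> x y. mi_order \<alpha> \<le> n \<Longrightarrow> x \<in> K \<Longrightarrow> y \<in> K \<Longrightarrow>
      norm (whitney_rem n (wave_solution G H) x \<alpha> y) \<le> C * norm (x - y) ^ Suc (n - mi_order \<alpha>)"
      by blast
    then show "\<exists>C\<ge>0. \<exists>t0>0. \<forall>\<alpha> x y. mi_order \<alpha> \<le> n \<longrightarrow> x \<in> K \<longrightarrow> y \<in> K \<longrightarrow>
      norm (x - y) < t0 \<longrightarrow> norm (whitney_rem n (wave_solution G H) x \<alpha> y) \<le> C * norm (x - y) ^ Suc (n - mi_order \<alpha>)"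
      by (intro exI[of _ C] conjI exI[of _ 1]) auto
  qed auto
  then show ?thesis
    by (simp add: whitney_kernel_def wave_solution_def wave_operator_wave_jet)
qed

lemma jet_restrict_whitney:
  assumes "f \<in> whitney E" "F \<subseteq> E"
  shows "jet_restrict F f \<in> whitney F"
proof -
  have "continuous_on F (jet_restrict F f \<alpha>)" for \<alpha>
  proof -
    have "continuous_on F (f \<alpha>)"
      using assms continuous_on_subset unfolding whitney_def continuous_jets_def by blast
    then show ?thesis by (rule continuous_on_eq) (simp add: jet_restrict_def)
  qed
  moreover have "jet_restrict K (jet_restrict F f) = jet_restrict K f" if "K \<subseteq> F" for K
    using that by (auto simp: jet_restrict_def fun_eq_iff)
  ultimately show ?thesis
    using assms by (auto simp: whitney_def continuous_jets_def) (simp_all add: jet_restrict_def)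
qed

subsection \<open>Characteristic lines\<close>

lemma wave_characteristic_line_iff:
  "wave_characteristic_line L \<longleftrightarrow> (\<exists>\<sigma> c. (\<sigma> = 1 \<or> \<sigma> = -1) \<and> L = {x. x $ 1 + \<sigma> * x $ 2 = c})"
proof
  assume "wave_characteristic_line L"
  then obtain c and N :: "real^2" where N: "N \<noteq> 0" "(N $ 1)\<^sup>2 = (N $ 2)\<^sup>2"
    and L: "L = {x :: real^2. x $ 1 * N $ 1 + x $ 2 * N $ 2 = c}"
    by (auto simp: wave_characteristic_line_def)
  have N12: "N $ 2 = N $ 1 \<or> N $ 2 = - N $ 1" using N(2) by (auto simp: power2_eq_iff)
  then have "N $ 1 \<noteq> 0" using N(1) by (auto simp: vec_eq_iff forall_2)
  then have "L = {x. x $ 1 + (N $ 2 / N $ 1) * x $ 2 = c / N $ 1}"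
    unfolding L by (auto simp: field_simps)
  moreover have "N $ 2 / N $ 1 = 1 \<or> N $ 2 / N $ 1 = -1" using N12 \<open>N $ 1 \<noteq> 0\<close> by auto
  ultimately show "\<exists>\<sigma> c. (\<sigma> = 1 \<or> \<sigma> = -1) \<and> L = {x. x $ 1 + \<sigma> * x $ 2 = c}" by blast
next
  assume "\<exists>\<sigma> c. (\<sigma> = 1 \<or> \<sigma> = -1) \<and> L = {x. x $ 1 + \<sigma> * x $ 2 = c}"
  then obtain \<sigma> c where \<sigma>: "\<sigma> = 1 \<or> \<sigma> = -1" and L: "L = {x. x $ 1 + \<sigma> * x $ 2 = c}" by blast
  show "wave_characteristic_line L"
    unfolding wave_characteristic_line_def L
    by (rule exI[of _ c], rule exI[of _ "vector [1, \<sigma>]"]) (use \<sigma> in \<open>auto simp: vec_eq_iff forall_2 mult.commute\<close>)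
qed

text \<open>The parameter is the other characteristic coordinate: on u = c (\<sigma> = 1) it is v,
  on v = c (\<sigma> = -1) it is u.\<close>

definition line_point :: "real \<Rightarrow> real \<Rightarrow> real \<Rightarrow> real^2" where
  "line_point \<sigma> c t = vector [(c + t) / 2, \<sigma> * (c - t) / 2]"

lemma line_point:
  assumes "\<sigma> = 1 \<or> \<sigma> = -1"
  shows "line_point \<sigma> c t $ 1 + \<sigma> * line_point \<sigma> c t $ 2 = c"
    "line_point \<sigma> c t $ 1 - \<sigma> * line_point \<sigma> c t $ 2 = t"
    "x $ 1 + \<sigma> * x $ 2 = c \<Longrightarrow> line_point \<sigma> c (x $ 1 - \<sigma> * x $ 2) = x"
  using assms by (auto simp: line_point_def vec_eq_iff forall_2 field_simps)

lemma continuous_on_line_point: "continuous_on S (line_point \<sigma> c)"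
proof -
  have "line_point \<sigma> c = (\<lambda>t. \<chi> i. if i = 1 then (c + t) / 2 else \<sigma> * (c - t) / 2)"
    by (auto simp: line_point_def fun_eq_iff vec_eq_iff forall_2)
  moreover have "continuous_on S (\<lambda>t. if i = 1 then (c + t) / 2 else \<sigma> * (c - t) / 2)" for i :: 2
    by (cases "i = 1") (auto intro!: continuous_intros)
  ultimately show ?thesis by (simp add: continuous_on_vec_lambda)
qed

text \<open>A bounded component cannot contain a ray, so F blocks the line on both sides of any of
  its points. Conversely the parameters of the component through a point of the gap form a connected
  set that avoids the two parameters of points in F, so it stays between them.\<close>

lemma bounded_component_iff:
  fixes F :: "(real^2) set"
  assumes \<sigma>: "\<sigma> = 1 \<or> \<sigma> = -1" and L: "L = {x. x $ 1 + \<sigma> * x $ 2 = c}"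
  shows "(\<exists>C\<in>components (L \<inter> (UNIV - F)). bounded C) \<longleftrightarrow>
    (\<exists>r s t. r < s \<and> s < t \<and> line_point \<sigma> c r \<in> F \<and> line_point \<sigma> c s \<notin> F \<and> line_point \<sigma> c t \<in> F)"
proof
  define p where "p = (\<lambda>x::real^2. x $ 1 - \<sigma> * x $ 2)"
  note lp = line_point[OF \<sigma>]
  have p_lp: "p (line_point \<sigma> c t) = t" for t by (simp add: p_def lp)
  have lp_p: "line_point \<sigma> c (p x) = x" if "x \<in> L" for x using that by (simp add: p_def L lp)
  have lp_L: "line_point \<sigma> c t \<in> L" for t by (simp add: L lp)
  have unb: "\<not> bounded (line_point \<sigma> c ` S)" if "\<not> bounded S" for S
  proof
    assume "bounded (line_point \<sigma> c ` S)"
    then obtain B where B: "\<And>t. t \<in> S \<Longrightarrow> norm (line_point \<sigma> c t) \<le> B" unfolding bounded_iff by auto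
    have "\<bar>t\<bar> \<le> 2 * B" if "t \<in> S" for t
    proof -
      have "\<bar>line_point \<sigma> c t $ 1\<bar> \<le> B" "\<bar>line_point \<sigma> c t $ 2\<bar> \<le> B"
        using B[OF that] component_le_norm_cart order_trans by blast+
      with \<sigma> lp(2)[of c t] show ?thesis by auto
    qed
    then show False using that unfolding bounded_iff by auto
  qed
  {
    assume "\<exists>C\<in>components (L \<inter> (UNIV - F)). bounded C"
    then obtain C where C: "C \<in> components (L \<inter> (UNIV - F))" "bounded C" by blast
    obtain z where z: "z \<in> C" using in_components_nonempty[OF C(1)] by blast
    have zL: "z \<in> L" "z \<notin> F" using in_components_subset[OF C(1)] z by auto
    have ray: "\<exists>t\<in>S. line_point \<sigma> c t \<in> F" if S: "connected S" "\<not> bounded S" "p z \<in> S" for S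
    proof (rule ccontr)
      assume no: "\<not> (\<exists>t\<in>S. line_point \<sigma> c t \<in> F)"
      have "line_point \<sigma> c ` S \<subseteq> C"
      proof (rule components_maximal[OF C(1)])
        show "connected (line_point \<sigma> c ` S)"
          by (intro connected_continuous_image continuous_on_line_point S)
        show "line_point \<sigma> c ` S \<subseteq> L \<inter> (UNIV - F)" using no lp_L by auto
        have "z \<in> line_point \<sigma> c ` S" using S(3) lp_p[OF zL(1)] by (metis image_eqI)
        then show "C \<inter> line_point \<sigma> c ` S \<noteq> {}" using z by blast
      qed
      then show False using unb[OF S(2)] C(2) bounded_subset by blast
    qed
    have unb_rays: "\<not> bounded {p z..}" "\<not> bounded {..p z}"
    proof -
      have "\<exists>t\<ge>p z. B < \<bar>t\<bar>" "\<exists>t\<le>p z. B < \<bar>t\<bar>" for B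
        by (rule exI[of _ "max (p z) (\<bar>B\<bar> + 1)"], linarith) (rule exI[of _ "min (p z) (- \<bar>B\<bar> - 1)"], linarith)
      then show "\<not> bounded {p z..}" "\<not> bounded {..p z}"
        unfolding bounded_iff by (auto simp: not_le)
    qed
    obtain t where t: "p z \<le> t" "line_point \<sigma> c t \<in> F" using ray[of "{p z..}"] unb_rays by auto
    obtain r where r: "r \<le> p z" "line_point \<sigma> c r \<in> F" using ray[of "{..p z}"] unb_rays by auto
    have "t \<noteq> p z" "r \<noteq> p z" using t r lp_p zL by auto
    then show "\<exists>r s t. r < s \<and> s < t \<and> line_point \<sigma> c r \<in> F \<and> line_point \<sigma> c s \<notin> F \<and> line_point \<sigma> c t \<in> F"
      using t r lp_p zL by (intro exI[of _ r] exI[of _ "p z"] exI[of _ t]) auto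
  }
  {
    assume "\<exists>r s t. r < s \<and> s < t \<and> line_point \<sigma> c r \<in> F \<and> line_point \<sigma> c s \<notin> F \<and> line_point \<sigma> c t \<in> F"
    then obtain r s t where rst: "r < s" "s < t" "line_point \<sigma> c r \<in> F" "line_point \<sigma> c s \<notin> F" "line_point \<sigma> c t \<in> F"
      by blast
    define C where "C = connected_component_set (L \<inter> (UNIV - F)) (line_point \<sigma> c s)"
    have s: "line_point \<sigma> c s \<in> L \<inter> (UNIV - F)" using rst lp_L by auto
    have C: "C \<in> components (L \<inter> (UNIV - F))" using s by (auto simp: C_def components_def)
    have CL: "C \<subseteq> L \<inter> (UNIV - F)" using in_components_subset[OF C] .
    have "continuous_on C p" unfolding p_def by (intro continuous_intros)
    then have conn: "connected (p ` C)"
      using in_components_connected[OF C] connected_continuous_image by blast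
    have in_pC: "s \<in> p ` C"
      using p_lp[of s] s by (metis C_def connected_component_refl_eq image_eqI mem_Collect_eq)
    have not_in: "q \<notin> p ` C" if "line_point \<sigma> c q \<in> F" for q
      using that CL lp_p by (metis DiffD2 IntE image_iff subsetD)
    have "p ` C \<subseteq> {r..t}"
    proof
      fix q assume q: "q \<in> p ` C"
      show "q \<in> {r..t}"
      proof (rule ccontr)
        assume "q \<notin> {r..t}"
        then have "r \<in> p ` C \<or> t \<in> p ` C"
          using connectedD_interval[OF conn q in_pC, of r] connectedD_interval[OF conn in_pC q, of t] rst by auto
        then show False using not_in rst by blast
      qed
    qed
    then have "C \<subseteq> line_point \<sigma> c ` {r..t}"
      using CL lp_p by (force simp: image_iff)
    moreover have "bounded (line_point \<sigma> c ` {r..t})"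
      by (intro compact_imp_bounded compact_continuous_image continuous_on_line_point) auto
    ultimately show "\<exists>C\<in>components (L \<inter> (UNIV - F)). bounded C"
      using C bounded_subset by blast
  }
qed

subsection \<open>Neighbourhoods in the space of jets\<close>

text \<open>Subbasic sets are centred at arbitrary jets; the triangle inequality recentres them at
  f. Finite intersections take the union of the compact sets and the larger order, and all orders up
  to \<open>n0\<close> are tested so that no norm has to be compared with one of another
  order.\<close>

lemma whitney_topology_nhd:
  assumes "openin (whitney_topology F) U" "f \<in> U"
  shows "\<exists>n0 K e. compact K \<and> K \<subseteq> F \<and> 0 < e \<and>
    (\<forall>g\<in>whitney F. (\<forall>n\<le>n0. whitney_norm n K (\<lambda>\<alpha> x. g \<alpha> x - f \<alpha> x) < ennreal e) \<longrightarrow> g \<in> U)"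
proof -
  let ?B = "{{g \<in> whitney F. whitney_norm n K (jet_restrict K (\<lambda>\<alpha> x. g \<alpha> x - f \<alpha> x)) < ennreal e} | f n K e.
        f \<in> whitney F \<and> compact K \<and> K \<subseteq> F \<and> 0 < e}"
  let ?N = "\<lambda>U f n0 K e. \<forall>g\<in>whitney F. (\<forall>n\<le>n0. whitney_norm n K (\<lambda>\<alpha> x. g \<alpha> x - f \<alpha> x) < ennreal e) \<longrightarrow> g \<in> U"
  have "generate_topology_on ?B U"
    using assms(1) by (simp add: whitney_topology_def openin_topology_generated_by)
  then show ?thesis using assms(2)
  proof (induction arbitrary: f rule: generate_topology_on.induct)
    case Empty
    then show ?case by simp
  next
    case (Int a b)
    from Int.IH(1)[of f] Int.prems obtain n1 K1 e1 where
      1: "compact K1" "K1 \<subseteq> F" "0 < e1" "?N a f n1 K1 e1" by auto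
    from Int.IH(2)[of f] Int.prems obtain n2 K2 e2 where
      2: "compact K2" "K2 \<subseteq> F" "0 < e2" "?N b f n2 K2 e2" by auto
    have "g \<in> a \<inter> b" if g: "g \<in> whitney F"
      and less: "\<And>n. n \<le> max n1 n2 \<Longrightarrow> whitney_norm n (K1 \<union> K2) (\<lambda>\<alpha> x. g \<alpha> x - f \<alpha> x) < ennreal (min e1 e2)" for g
    proof -
      have "whitney_norm n K1 (\<lambda>\<alpha> x. g \<alpha> x - f \<alpha> x) < ennreal e1" if "n \<le> n1" for n
        using le_less_trans[OF whitney_norm_mono[of K1 "K1 \<union> K2"] less_le_trans[OF less[of n] ennreal_leI[OF min.cobounded1]]] that
        by simp
      moreover have "whitney_norm n K2 (\<lambda>\<alpha> x. g \<alpha> x - f \<alpha> x) < ennreal e2" if "n \<le> n2" for n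
        using le_less_trans[OF whitney_norm_mono[of K2 "K1 \<union> K2"] less_le_trans[OF less[of n] ennreal_leI[OF min.cobounded2]]] that
        by simp
      ultimately show ?thesis using g 1(4) 2(4) by blast
    qed
    then show ?case
      using 1 2 by (intro exI[of _ "max n1 n2"] exI[of _ "K1 \<union> K2"] exI[of _ "min e1 e2"]) auto
  next
    case (UN \<K>)
    then obtain k where k: "k \<in> \<K>" "f \<in> k" by blast
    from UN.IH[OF this] obtain n0 K e where "compact K" "K \<subseteq> F" "0 < e" "?N k f n0 K e" by auto
    then show ?case using k(1) by (intro exI[of _ n0] exI[of _ K] exI[of _ e]) blast
  next
    case (Basis s)
    then obtain f0 n K e where s: "s = {g \<in> whitney F. whitney_norm n K (jet_restrict K (\<lambda>\<alpha> x. g \<alpha> x - f0 \<alpha> x)) < ennreal e}"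
      and K: "compact K" "K \<subseteq> F" by auto
    define b where "b = whitney_norm n K (jet_restrict K (\<lambda>\<alpha> x. f \<alpha> x - f0 \<alpha> x))"
    have b: "b < ennreal e" using Basis.prems by (simp add: s b_def)
    then obtain b' where b': "b = ennreal b'" "0 \<le> b'" by (cases b) auto
    have d: "0 < e - b'" using b b' by (simp add: ennreal_less_iff)
    have "g \<in> s" if g: "g \<in> whitney F" and less: "whitney_norm n K (\<lambda>\<alpha> x. g \<alpha> x - f \<alpha> x) < ennreal (e - b')" for g
    proof -
      have "whitney_norm n K (jet_restrict K (\<lambda>\<alpha> x. g \<alpha> x - f0 \<alpha> x)) \<le> whitney_norm n K (\<lambda>\<alpha> x. g \<alpha> x - f \<alpha> x) + b"
        unfolding b_def by (rule whitney_norm_triangle) (simp add: jet_restrict_def)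
      also have "\<dots> < ennreal (e - b') + ennreal b'"
        unfolding b' using less by (simp add: ennreal_add_left_cancel_less add.commute)
      also have "\<dots> = ennreal e" using d b' by (simp flip: ennreal_plus)
      finally show ?thesis using g by (simp add: s)
    qed
    then show ?case using K d by (intro exI[of _ n] exI[of _ K] exI[of _ "e - b'"]) auto
  qed
qed

text \<open>On the empty compact set every norm is 0, so each jet lies in some subbasic set.\<close>

lemma topspace_whitney_topology: "topspace (whitney_topology F) = whitney F"
proof -
  have "f \<in> topspace (whitney_topology F)" if f: "f \<in> whitney F" for f
  proof -
    have "whitney_norm 0 {} h \<le> ennreal 0 + ennreal 0" for h
      by (rule whitney_norm_le) auto
    then have "whitney_norm 0 {} h < ennreal 1" for h by simp
    then show ?thesis
      unfolding whitney_topology_def topology_generated_by_topspace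
      using f by (intro UnionI[of "{g \<in> whitney F. whitney_norm 0 {} (jet_restrict {} (\<lambda>\<alpha> x. g \<alpha> x - f \<alpha> x)) < ennreal 1}"])
        (auto intro!: exI[of _ f] exI[of _ "0::nat"] exI[of _ "{}::(real^2) set"] exI[of _ "1::real"])
  qed
  moreover have "topspace (whitney_topology F) \<subseteq> whitney F"
    unfolding whitney_topology_def topology_generated_by_topspace by blast
  ultimately show ?thesis by blast
qed

subsection \<open>Density\<close>

lemma line_point_xy: "line_point 1 c t = xy (c, t)" "line_point (-1) c t = xy (t, c)"
  by (simp_all add: line_point_def xy_def vec_eq_iff forall_2 field_simps)

lemma wave_solution_dense:
  fixes F :: "(real^2) set"
  assumes F: "closed F" and f: "f \<in> whitney_kernel wave_operator F"
    and line: "\<And>\<sigma> c r s t. \<sigma> = 1 \<or> \<sigma> = -1 \<Longrightarrow> r < s \<Longrightarrow> s < t \<Longrightarrow>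
      line_point \<sigma> c r \<in> F \<Longrightarrow> line_point \<sigma> c t \<in> F \<Longrightarrow> line_point \<sigma> c s \<in> F"
    and K: "compact K" "K \<subseteq> F" and e: "0 < e"
  obtains G H where "deriv_seq G" "deriv_seq H"
    "\<And>n. n \<le> n0 \<Longrightarrow> whitney_norm n K (\<lambda>\<alpha> x. jet_restrict F (wave_solution G H) \<alpha> x - f \<alpha> x) < ennreal e"
proof -
  let ?a = "jet_u f" and ?b = "jet_v f"
  have fw: "f = wave_jet ?a ?b" and fF: "f \<in> whitney F"
    using f wave_jet_eq by (auto simp: whitney_kernel_def)
  obtain R where R: "\<And>x. x \<in> K \<Longrightarrow> norm (uv x) \<le> R"
  proof -
    have "compact (uv ` K)" by (intro compact_continuous_image continuous_on_uv K)
    then show ?thesis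
      using compact_imp_bounded[of "uv ` K"] that unfolding bounded_iff by auto
  qed
  \<comment> \<open>The sections of K may have holes. Those of L are sections of F cut by an
    interval, hence convex, and the square is large enough to contain the image of K.\<close>
  define L where "L = xy -` F \<inter> ({-R..R} \<times> {-R..R})"
  have cont_xy: "continuous_on S xy" for S
  proof -
    have eq: "xy = (\<lambda>p. \<chi> i. if i = 1 then (fst p + snd p) / 2 else (fst p - snd p) / 2)"
      by (auto simp: xy_def fun_eq_iff vec_eq_iff forall_2)
    have "continuous_on S (\<lambda>p. if i = 1 then (fst p + snd p) / 2 else (fst p - snd p) / 2)" for i :: 2
      by (cases "i = 1") (auto intro!: continuous_intros)
    then show ?thesis unfolding eq by (rule continuous_on_vec_lambda)
  qed
  have L: "compact L"
    unfolding L_def using F cont_xy[of UNIV]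
    by (intro closed_Int_compact compact_Times compact_Icc closed_vimage) auto
  have lineU: "xy (u, v) \<in> F" if "u1 \<le> u" "u \<le> u2" "xy (u1, v) \<in> F" "xy (u2, v) \<in> F" for u1 u u2 v
    using line[of "-1" u1 u u2 v] that by (cases "u1 = u \<or> u = u2") (auto simp: line_point_xy)
  have lineV: "xy (u, v) \<in> F" if "v1 \<le> v" "v \<le> v2" "xy (u, v1) \<in> F" "xy (u, v2) \<in> F" for v1 u v2 v
    using line[of "1" v1 v v2 u] that by (cases "v1 = v \<or> v = v2") (auto simp: line_point_xy)
  have convU: "convex {u. (u, v) \<in> L}" for v
    unfolding is_interval_convex_1[symmetric] is_interval_1 using lineU by (fastforce simp: L_def)
  have convV: "convex {v. (u, v) \<in> L}" for u
    unfolding is_interval_convex_1[symmetric] is_interval_1 using lineV by (fastforce simp: L_def)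
  have KL: "uv x \<in> L" if "x \<in> K" for x
  proof -
    have "\<bar>fst (uv x)\<bar> \<le> R" "\<bar>snd (uv x)\<bar> \<le> R"
      using R[OF that] norm_fst_le[of "fst (uv x)" "snd (uv x)"] norm_snd_le[of "snd (uv x)" "fst (uv x)"] by simp_all
    then have "fst (uv x) \<in> {-R..R}" "snd (uv x) \<in> {-R..R}" by auto
    then show ?thesis using that K(2) by (auto simp: L_def mem_Times_iff)
  qed
  have jet: "\<exists>t0>0. \<forall>x\<in>L. \<forall>y\<in>L. maxdist x y < t0 \<longrightarrow> (\<forall>i j. i + j \<le> N \<longrightarrow>
      norm (wave_taylor N (\<lambda>k. ?a k (xy x)) (\<lambda>k. ?b k (xy x)) x i j (fst y) (snd y)
        - wave_taylor N (\<lambda>k. ?a k (xy y)) (\<lambda>k. ?b k (xy y)) y i j (fst y) (snd y)) \<le> maxdist x y ^ (N - (i + j)))" for N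
  proof -
    have "compact (xy ` L)" "xy ` L \<subseteq> F"
      using compact_continuous_image[OF cont_xy L] by (auto simp: L_def)
    then have "jet_restrict (xy ` L) f \<in> whitney_compact (xy ` L)" using fF by (simp add: whitney_def)
    from whitney_compact_rem[OF this zero_less_one, of N] obtain t where t: "0 < t" and
      rem: "\<And>\<alpha> x y. mi_order \<alpha> \<le> N \<Longrightarrow> x \<in> xy ` L \<Longrightarrow> y \<in> xy ` L \<Longrightarrow> 0 < norm (x - y) \<Longrightarrow> norm (x - y) < t \<Longrightarrow>
        norm (whitney_rem N (jet_restrict (xy ` L) f) x \<alpha> y) \<le> 1 * norm (x - y) ^ (N - mi_order \<alpha>)"
      by metis
    have "norm (wave_taylor N (\<lambda>k. ?a k (xy x)) (\<lambda>k. ?b k (xy x)) x i j (fst y) (snd y)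
        - wave_taylor N (\<lambda>k. ?a k (xy y)) (\<lambda>k. ?b k (xy y)) y i j (fst y) (snd y)) \<le> maxdist x y ^ (N - (i + j))"
      if x: "x \<in> L" and y: "y \<in> L" and d: "maxdist x y < t" and ij: "i + j \<le> N" for x y i j
    proof (cases "x = y")
      case True
      then show ?thesis using maxdist_nonneg by simp
    next
      case False
      define r where "r = norm (xy x - xy y)"
      have r: "r \<le> maxdist x y" "0 \<le> r" using norm_le_maxdist[of "xy x" "xy y"] by (simp_all add: r_def)
      have "xy x \<noteq> xy y" using False by (metis uv_xy)
      then have r0: "0 < r" by (simp add: r_def)
      have "norm (whitney_rem N (wave_jet ?a ?b) (xy x) \<alpha> (xy y)) \<le> 1 * r ^ (N - mi_order \<alpha>)" if "mi_order \<alpha> \<le> N" for \<alpha>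
      proof -
        have "whitney_rem N (wave_jet ?a ?b) (xy x) \<alpha> (xy y) = whitney_rem N (jet_restrict (xy ` L) f) (xy x) \<alpha> (xy y)"
          by (rule whitney_rem_cong) (use x y fw in \<open>auto simp: jet_restrict_def\<close>)
        then show ?thesis using rem[OF that, of "xy x" "xy y"] x y r0 r d by (auto simp: r_def)
      qed
      from wave_rem_bound[OF this _ r(2) ij]
      have "norm (wave_rem N ?a ?b (xy x) i j (xy y)) \<le> 1 * r ^ (N - (i + j))" by simp
      also have "\<dots> \<le> maxdist x y ^ (N - (i + j))" using r by (simp add: power_mono)
      finally show ?thesis by (simp add: wave_rem_def norm_minus_commute)
    qed
    with t show ?thesis by blast
  qed
  \<comment> \<open>Values cost 2 e', one for each of the u and v parts. Remainders cost the same
    factor 2 and a further 2^n0 from comparing \<open>maxdist\<close> with the norm. The last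
    summand 1 makes the inequality strict.\<close>
  define e' where "e' = e / (2 + 2 * 2 ^ n0 + 1)"
  have e': "0 < e'" "2 * e' + (2 * 2 ^ n0) * e' < e"
  proof -
    have q: "0 < 2 + 2 * 2 ^ n0 + (1::real)" by (simp add: add_pos_pos)
    then show "0 < e'" using e by (simp add: e'_def)
    have "e = (2 + 2 * 2 ^ n0 + 1) * e'" using q by (simp add: e'_def)
    also have "\<dots> = 2 * e' + (2 * 2 ^ n0) * e' + e'" by (simp add: distrib_right)
    finally show "2 * e' + (2 * 2 ^ n0) * e' < e" using \<open>0 < e'\<close> by linarith
  qed
  obtain G H where G: "deriv_seq G" and H: "deriv_seq H"
    and val: "\<And>x i j. x \<in> L \<Longrightarrow> i + j \<le> n0 \<Longrightarrow>
      norm (wave_taylor n0 (\<lambda>k. ?a k (xy x) - G k (fst x)) (\<lambda>k. ?b k (xy x) - H k (snd x)) x i j (fst x) (snd x)) \<le> e'"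
    and rem: "\<And>n x y i j. n \<le> n0 \<Longrightarrow> x \<in> L \<Longrightarrow> y \<in> L \<Longrightarrow> i + j \<le> n \<Longrightarrow>
      norm (wave_taylor n (\<lambda>k. ?a k (xy y) - G k (fst y)) (\<lambda>k. ?b k (xy y) - H k (snd y)) y i j (fst y) (snd y)
        - wave_taylor n (\<lambda>k. ?a k (xy x) - G k (fst x)) (\<lambda>k. ?b k (xy x) - H k (snd x)) x i j (fst y) (snd y))
      \<le> e' * maxdist x y ^ (n - (i + j))"
    by (rule wave_jet_approx[OF L convU convV jet e'(1), of n0]) blast
  define a where "a = (\<lambda>k x. ?a k x - G k (fst (uv x)))"
  define b where "b = (\<lambda>k x. ?b k x - H k (snd (uv x)))"
  have diff: "jet_restrict F (wave_solution G H) \<alpha> x - f \<alpha> x = - wave_jet a b \<alpha> x" if "x \<in> K" for \<alpha> x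
    using that K(2) by (subst fw) (auto simp: jet_restrict_def wave_solution_def wave_jet_def a_def b_def algebra_simps)
  show ?thesis
  proof (rule that[OF G H])
    fix n assume n: "n \<le> n0"
    have "whitney_norm n K (\<lambda>\<alpha> x. jet_restrict F (wave_solution G H) \<alpha> x - f \<alpha> x)
      = whitney_norm n K (\<lambda>\<alpha> x. - wave_jet a b \<alpha> x)"
      by (rule whitney_norm_cong) (rule diff)
    also have "\<dots> \<le> ennreal (2 * e') + ennreal ((2 * 2 ^ n0) * e')"
    proof (rule whitney_norm_le)
      fix \<alpha> x assume x: "x \<in> K" and \<alpha>: "mi_order \<alpha> \<le> n"
      let ?m = "mi_order \<alpha>"
      have v: "norm (wave_taylor n0 (\<lambda>k. a k x) (\<lambda>k. b k x) (uv x) i j (fst (uv x)) (snd (uv x))) \<le> e'" if "i + j \<le> n0" for i j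
        using val[OF KL[OF x] that] by (simp add: a_def b_def)
      show "norm (- wave_jet a b \<alpha> x) \<le> 2 * e'"
      proof (cases "?m = 0")
        case True
        then have "\<alpha> $ 2 = 0" by (simp add: mi_order_eq)
        then have "norm (wave_jet a b \<alpha> x) \<le> 2 * e'" using v[of 0 0] True e'(1)
          by (simp add: wave_jet_def wave_taylor_def taylor_seq_at const_seq_def)
        then show ?thesis by (simp only: norm_minus_cancel)
      next
        case False
        then have "norm (a ?m x) \<le> e'" "norm (b ?m x) \<le> e'"
          using v[of ?m 0] v[of 0 ?m] \<alpha> n by (simp_all add: wave_taylor_def taylor_seq_at const_seq_def)
        then have "norm (a ?m x + (-1) ^ (\<alpha> $ 2) * b ?m x) \<le> e' + e'"
          by (intro order_trans[OF norm_triangle_ineq] add_mono) (simp_all add: norm_mult norm_power)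
        then show ?thesis unfolding norm_minus_cancel by (simp add: wave_jet_def)
      qed
    next
      fix \<alpha> x y assume \<alpha>: "mi_order \<alpha> \<le> n" and x: "x \<in> K" and y: "y \<in> K"
      let ?m = "mi_order \<alpha>"
      have wr: "norm (wave_rem n a b x i j y) \<le> e' * maxdist (uv x) (uv y) ^ (n - (i + j))" if "i + j \<le> n" for i j
        using rem[OF n KL[OF x] KL[OF y] that] by (simp add: a_def b_def wave_rem_def)
      have nonneg: "0 \<le> e' * maxdist (uv x) (uv y) ^ (n - ?m)" using e' maxdist_nonneg by simp
      have "norm (whitney_rem n (\<lambda>\<alpha> x. - wave_jet a b \<alpha> x) x \<alpha> y) = norm (whitney_rem n (wave_jet a b) x \<alpha> y)"
        by (simp add: whitney_rem_uminus)
      also have "\<dots> \<le> e' * maxdist (uv x) (uv y) ^ (n - ?m) + e' * maxdist (uv x) (uv y) ^ (n - ?m)"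
      proof (cases "?m = 0")
        case True
        then show ?thesis using wr[of 0 0] nonneg \<alpha> by (simp add: whitney_rem_wave_jet)
      next
        case False
        then have "norm (whitney_rem n (wave_jet a b) x \<alpha> y)
          = norm (wave_rem n a b x ?m 0 y + (-1) ^ (\<alpha> $ 2) * wave_rem n a b x 0 ?m y)"
          using \<alpha> by (simp add: whitney_rem_wave_jet)
        also have "\<dots> \<le> e' * maxdist (uv x) (uv y) ^ (n - ?m) + e' * maxdist (uv x) (uv y) ^ (n - ?m)"
          using wr[of ?m 0] wr[of 0 ?m] \<alpha>
          by (intro order_trans[OF norm_triangle_ineq] add_mono) (simp_all add: norm_mult norm_power)
        finally show ?thesis .
      qed
      also have "\<dots> = 2 * e' * maxdist (uv x) (uv y) ^ (n - ?m)" by simp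
      also have "\<dots> \<le> 2 * e' * (2 * norm (x - y)) ^ (n - ?m)"
        using e' by (intro mult_left_mono power_mono maxdist_le_norm maxdist_nonneg) auto
      also have "\<dots> = 2 * e' * 2 ^ (n - ?m) * norm (x - y) ^ (n - ?m)" by (simp add: power_mult_distrib)
      also have "\<dots> \<le> 2 * e' * 2 ^ n0 * norm (x - y) ^ (n - ?m)"
        using e' n by (intro mult_right_mono mult_left_mono power_increasing) auto
      finally show "norm (whitney_rem n (\<lambda>\<alpha> x. - wave_jet a b \<alpha> x) x \<alpha> y) \<le> (2 * 2 ^ n0) * e' * norm (x - y) ^ (n - ?m)"
        by (simp add: mult_ac)
    qed
    also have "\<dots> = ennreal (2 * e' + (2 * 2 ^ n0) * e')" using e' by (simp add: ennreal_plus)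
    also have "\<dots> < ennreal e" using e' e by (intro ennreal_lessI)
    finally show "whitney_norm n K (\<lambda>\<alpha> x. jet_restrict F (wave_solution G H) \<alpha> x - f \<alpha> x) < ennreal e" .
  qed
qed

subsection \<open>The obstruction\<close>

text \<open>Differentiation along the normal (1, \<sigma>) of the line: twice the derivative in u on
  a line u = c, twice the derivative in v on a line v = c.\<close>

definition transversal :: "real \<Rightarrow> jet \<Rightarrow> real^2 \<Rightarrow> complex" where
  "transversal \<sigma> f x = f (mi 1 0) x + of_real \<sigma> * f (mi 0 1) x"

text \<open>On a line u = c the Taylor polynomial of the u part is evaluated at its own base
  coordinate, so its first order remainder is exactly the increment of the u-derivative. The Whitney
  condition of order 2 makes it o(|x - y|), hence the derivative along the line is zero. The same
  holds for v.\<close>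

lemma transversal_const:
  assumes f: "f \<in> whitney_kernel wave_operator UNIV" and \<sigma>: "\<sigma> = 1 \<or> \<sigma> = -1"
  shows "transversal \<sigma> f (line_point \<sigma> c r) = transversal \<sigma> f (line_point \<sigma> c t)"
proof -
  let ?a = "jet_u f" and ?b = "jet_v f"
  have fw: "f = wave_jet ?a ?b" and fU: "f \<in> whitney UNIV"
    using f wave_jet_eq by (auto simp: whitney_kernel_def)
  define S where "S = {min r t..max r t}"
  define K where "K = line_point \<sigma> c ` S"
  have K: "compact K" unfolding K_def S_def by (intro compact_continuous_image continuous_on_line_point compact_Icc)
  have jr: "jet_restrict K f \<in> whitney_compact K" using fU K by (simp add: whitney_def)
  have lip: "norm (line_point \<sigma> c p - line_point \<sigma> c q) \<le> \<bar>p - q\<bar>" for p q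
  proof -
    have "norm (line_point \<sigma> c p - line_point \<sigma> c q) \<le> \<bar>(p - q) / 2\<bar> + \<bar>\<sigma> * ((q - p) / 2)\<bar>"
      using norm_le_l1_cart[of "line_point \<sigma> c p - line_point \<sigma> c q"]
      by (simp add: sum_2 line_point_def field_simps)
    also have "\<dots> = \<bar>p - q\<bar>" using \<sigma> by (auto simp: abs_if field_simps)
    finally show ?thesis .
  qed
  define h where "h = (\<lambda>q. transversal \<sigma> f (line_point \<sigma> c q))"
  have "(h has_derivative (\<lambda>_. 0)) (at p within S)" if p: "p \<in> S" for p
    unfolding has_derivative_within_alt
  proof (intro conjI allI impI bounded_linear_zero)
    fix e :: real assume e: "0 < e"
    obtain d where d: "0 < d" and rem: "\<And>\<alpha> x y. mi_order \<alpha> \<le> 2 \<Longrightarrow> x \<in> K \<Longrightarrow> y \<in> K \<Longrightarrow> 0 < norm (x - y) \<Longrightarrow> norm (x - y) < d \<Longrightarrow>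
        norm (whitney_rem 2 (jet_restrict K f) x \<alpha> y) \<le> (e / 2) * norm (x - y) ^ (2 - mi_order \<alpha>)"
      using whitney_compact_rem[OF jr, of "e / 2" 2] e by (metis half_gt_zero)
    show "\<exists>d>0. \<forall>q\<in>S. norm (q - p) < d \<longrightarrow> norm (h q - h p - 0) \<le> e * norm (q - p)"
    proof (intro exI[of _ d] conjI d ballI impI)
      fix q assume q: "q \<in> S" "norm (q - p) < d"
      define x where "x = line_point \<sigma> c p"
      define y where "y = line_point \<sigma> c q"
      have xy: "x \<in> K" "y \<in> K" using p q by (auto simp: x_def y_def K_def)
      have nxy: "norm (x - y) \<le> \<bar>q - p\<bar>" using lip[of p q] by (simp add: x_def y_def abs_minus_commute)
      show "norm (h q - h p - 0) \<le> e * norm (q - p)"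
      proof (cases "x = y")
        case True
        then show ?thesis using e by (simp add: h_def x_def y_def)
      next
        case False
        have "norm (whitney_rem 2 (wave_jet ?a ?b) x \<alpha> y) \<le> (e / 2) * norm (x - y) ^ (2 - mi_order \<alpha>)" if "mi_order \<alpha> \<le> 2" for \<alpha>
        proof -
          have "whitney_rem 2 (wave_jet ?a ?b) x \<alpha> y = whitney_rem 2 (jet_restrict K f) x \<alpha> y"
            by (rule whitney_rem_cong) (use xy fw in \<open>auto simp: jet_restrict_def\<close>)
          then show ?thesis using rem[OF that xy] False nxy q by simp
        qed
        from wave_rem_bound[OF this]
        have wr: "norm (wave_rem 2 ?a ?b x i j y) \<le> (e / 2) * norm (x - y) ^ (2 - (i + j))" if "i + j \<le> 2" for i j
          using e that by simp
        have "norm (h q - h p) = 2 * (if \<sigma> = 1 then norm (wave_rem 2 ?a ?b x 1 0 y) else norm (wave_rem 2 ?a ?b x 0 1 y))"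
        proof (cases "\<sigma> = 1")
          case True
          have "fst (uv x) = c" "fst (uv y) = c"
            using line_point(1)[OF \<sigma>, of c] True by (simp_all add: x_def y_def uv_def)
          then have "wave_rem 2 ?a ?b x 1 0 y = jet_u f 1 y - jet_u f 1 x"
            by (simp add: wave_rem_def wave_taylor_def const_seq_def taylor_seq_at)
          also have "\<dots> = (h q - h p) / 2"
            using True by (simp add: h_def transversal_def jet_u_def x_def y_def field_simps)
          finally have wr_eq: "wave_rem 2 ?a ?b x 1 0 y = (h q - h p) / 2" .
          have "h q - h p = 2 * wave_rem 2 ?a ?b x 1 0 y" unfolding wr_eq by simp
          then show ?thesis using True by (simp only: norm_mult norm_numeral simp_thms if_True)
        next
          case False
          then have s: "\<sigma> = -1" using \<sigma> by simp
          have "snd (uv x) = c" "snd (uv y) = c"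
            using line_point(1)[OF \<sigma>, of c] s by (simp_all add: x_def y_def uv_def)
          then have "wave_rem 2 ?a ?b x 0 1 y = jet_v f 1 y - jet_v f 1 x"
            by (simp add: wave_rem_def wave_taylor_def const_seq_def taylor_seq_at)
          also have "\<dots> = (h q - h p) / 2"
            using s by (simp add: h_def transversal_def jet_v_def x_def y_def field_simps)
          finally have wr_eq: "wave_rem 2 ?a ?b x 0 1 y = (h q - h p) / 2" .
          have "h q - h p = 2 * wave_rem 2 ?a ?b x 0 1 y" unfolding wr_eq by simp
          then show ?thesis using False by (simp only: norm_mult norm_numeral if_False)
        qed
        also have "\<dots> \<le> 2 * ((e / 2) * norm (x - y))" using wr[of 1 0] wr[of 0 1] by auto
        also have "\<dots> \<le> e * norm (q - p)" using nxy e by simp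
        finally show ?thesis by simp
      qed
    qed
  qed
  then obtain k where "\<forall>p\<in>S. h p = k"
    using has_derivative_zero_constant[of S h] by (auto simp: S_def)
  moreover have "r \<in> S" "t \<in> S" by (auto simp: S_def)
  ultimately show ?thesis by (simp add: h_def)
qed

text \<open>F misses a square around the point of parameter s, so a solution supported in the strip
  |l - c| < d vanishes on the part of F with |p - s| < d. Cutting it along p = s creates no
  singularity on F, and the equation survives because it is checked pointwise on the jet.\<close>

lemma broken_line_kernel:
  fixes F :: "(real^2) set"
  assumes F: "closed F" and \<sigma>: "\<sigma> = 1 \<or> \<sigma> = -1" and rst: "r < s" "s < t"
    and in_F: "line_point \<sigma> c r \<in> F" "line_point \<sigma> c s \<notin> F" "line_point \<sigma> c t \<in> F"
  obtains f where "f \<in> whitney_kernel wave_operator F"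
    "transversal \<sigma> f (line_point \<sigma> c r) = 0" "transversal \<sigma> f (line_point \<sigma> c t) \<noteq> 0"
proof -
  define l where "l = (\<lambda>x::real^2. x $ 1 + \<sigma> * x $ 2)"
  define p where "p = (\<lambda>x::real^2. x $ 1 - \<sigma> * x $ 2)"
  obtain d where d: "0 < d" and gap: "\<And>x. x \<in> F \<Longrightarrow> \<bar>p x - s\<bar> < d \<Longrightarrow> d \<le> \<bar>l x - c\<bar>"
  proof -
    have "open (- F)" using F by (simp add: open_Compl)
    then obtain e where e: "0 < e" "ball (line_point \<sigma> c s) e \<subseteq> - F"
      using in_F(2) open_contains_ball by blast
    show ?thesis
    proof (rule that[of "e / 2"])
      fix x assume x: "x \<in> F" "\<bar>p x - s\<bar> < e / 2"
      show "e / 2 \<le> \<bar>l x - c\<bar>"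
      proof (rule ccontr)
        assume less: "\<not> e / 2 \<le> \<bar>l x - c\<bar>"
        have c1: "(line_point \<sigma> c s - x) $ 1 = ((c - l x) + (s - p x)) / 2"
          "(line_point \<sigma> c s - x) $ 2 = \<sigma> * ((c - l x) - (s - p x)) / 2"
          using \<sigma> by (auto simp: line_point_def l_def p_def field_simps)
        have "norm (line_point \<sigma> c s - x) \<le> \<bar>((c - l x) + (s - p x)) / 2\<bar> + \<bar>\<sigma> * ((c - l x) - (s - p x)) / 2\<bar>"
          using norm_le_l1_cart[of "line_point \<sigma> c s - x"] unfolding sum_2 c1 .
        also have "\<dots> < e" using less x(2) \<sigma> by (auto simp: abs_if field_simps split: if_splits)
        finally have "x \<in> ball (line_point \<sigma> c s) e" by (simp add: dist_norm)
        then show False using e x by blast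
      qed
    qed (use e in simp)
  qed
  define \<kappa> where "\<kappa> = 2 / d"
  \<comment> \<open>The shift by 1/2 puts the line at the point where the slope of
    \<open>hat\<close> is known to be nonzero; the scale 2/d keeps the shifted support within
    distance d of c.\<close>
  define \<phi> where "\<phi> = (\<lambda>n v. of_real (\<kappa> ^ n) * hat n (\<kappa> * v + (1 / 2 - \<kappa> * c)))"
  have \<phi>: "deriv_seq \<phi>" unfolding \<phi>_def by (intro deriv_seq_affine deriv_seq_hat)
  have \<phi>_c: "\<phi> 1 c \<noteq> 0" using hat_deriv_nonzero d by (simp add: \<phi>_def \<kappa>_def)
  have \<phi>_0: "\<phi> n v = 0" if "d \<le> \<bar>v - c\<bar>" for n v
  proof -
    have "2 \<le> \<kappa> * \<bar>v - c\<bar>" using that d by (simp add: \<kappa>_def field_simps)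
    also have "\<dots> = \<bar>\<kappa> * v - \<kappa> * c\<bar>"
      unfolding right_diff_distrib[symmetric] abs_mult using d by (simp add: \<kappa>_def)
    finally have "1 \<le> \<bar>\<kappa> * v + (1 / 2 - \<kappa> * c)\<bar>" by linarith
    then show ?thesis by (simp add: \<phi>_def hat_eq_0)
  qed
  define G where "G = (if \<sigma> = 1 then \<phi> else const_seq 0)"
  define H where "H = (if \<sigma> = 1 then const_seq 0 else \<phi>)"
  have GH: "deriv_seq G" "deriv_seq H" using \<phi> deriv_seq_const by (auto simp: G_def H_def)
  let ?w = "wave_solution G H"
  have w: "?w \<alpha> x = of_real \<sigma> ^ (\<alpha> $ 2) * \<phi> (mi_order \<alpha>) (l x)" for \<alpha> x
    using \<sigma> by (auto simp: wave_solution_def wave_jet_def G_def H_def uv_def l_def const_seq_def)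
  have w0: "?w \<alpha> x = 0" if "x \<in> F" "\<bar>p x - s\<bar> < d" for \<alpha> x
    using gap[OF that] by (simp add: w \<phi>_0)
  define f where "f = jet_restrict F (\<lambda>\<alpha> x. if s < p x then ?w \<alpha> x else 0)"
  have "f \<in> whitney F"
  proof (rule in_whitneyI)
    fix \<alpha>
    \<comment> \<open>A piecewise linear cut-off in place of the jump gives the same function on F,
      since the solution vanishes on F where the two differ.\<close>
    have "continuous_on F (\<lambda>x. of_real (max 0 (min 1 ((p x - s) / d))) * ?w \<alpha> x)"
      unfolding p_def using d by (intro continuous_on_mult continuous_on_wave_solution GH continuous_intros) auto
    then show "continuous_on F (f \<alpha>)"
    proof (rule continuous_on_eq)
      fix x assume x: "x \<in> F"
      consider "p x \<le> s" | "s < p x" "p x < s + d" | "s + d \<le> p x" by linarith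
      then show "of_real (max 0 (min 1 ((p x - s) / d))) * ?w \<alpha> x = f \<alpha> x"
      proof cases
        case 1
        then have "(p x - s) / d \<le> 0" using d by (simp add: divide_le_0_iff)
        then show ?thesis using 1 by (simp add: f_def jet_restrict_def)
      next
        case 2
        then show ?thesis using w0[OF x, of \<alpha>] by (simp add: f_def jet_restrict_def)
      next
        case 3
        then have "1 \<le> (p x - s) / d" using d by (simp add: pos_le_divide_eq)
        then show ?thesis using 3 x d by (simp add: f_def jet_restrict_def)
      qed
    qed
  next
    fix K :: "(real^2) set" and n assume K: "compact K" "K \<subseteq> F"
    obtain C where C: "0 \<le> C" and rem: "\<And>\<alpha> x y. mi_order \<alpha> \<le> n \<Longrightarrow> x \<in> K \<Longrightarrow> y \<in> K \<Longrightarrow>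
      norm (whitney_rem n ?w x \<alpha> y) \<le> C * norm (x - y) ^ Suc (n - mi_order \<alpha>)"
      using wave_solution_rem[OF GH K(1), of n] by metis
    have "norm (whitney_rem n f x \<alpha> y) \<le> C * norm (x - y) ^ Suc (n - mi_order \<alpha>)"
      if \<alpha>: "mi_order \<alpha> \<le> n" and x: "x \<in> K" and y: "y \<in> K" and near: "norm (x - y) < d / 2" for \<alpha> x y
    proof (cases "s < p x \<and> s < p y")
      case True
      then have "whitney_rem n f x \<alpha> y = whitney_rem n ?w x \<alpha> y"
        using x y K(2) by (intro whitney_rem_cong) (auto simp: f_def jet_restrict_def)
      then show ?thesis using rem[OF \<alpha> x y] by simp
    next
      case False
      \<comment> \<open>At least one point lies on the zero side, so a point on the other side has
        |p - s| < d and its jet is zero as well; d/2 accounts for |p x - p y| \<le> 2 |x -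
        y|.\<close>
      have "\<bar>(x - y) $ 1\<bar> \<le> norm (x - y)" "\<bar>(x - y) $ 2\<bar> \<le> norm (x - y)"
        by (rule component_le_norm_cart)+
      then have "\<bar>p x - p y\<bar> < d" using near \<sigma> by (auto simp: p_def)
      then have "\<bar>p x - s\<bar> < d" if "s < p x" using that False by linarith
      moreover have "\<bar>p y - s\<bar> < d" if "s < p y" using that False \<open>\<bar>p x - p y\<bar> < d\<close> by linarith
      ultimately have "f \<beta> x = 0" "f \<beta> y = 0" for \<beta>
        using w0[of x \<beta>] w0[of y \<beta>] x y K(2) by (auto simp: f_def jet_restrict_def)
      then have "whitney_rem n f x \<alpha> y = 0" by (simp add: whitney_rem_def taylor_deriv_def)
      then show ?thesis using C by simp
    qed
    then show "\<exists>C\<ge>0. \<exists>t0>0. \<forall>\<alpha> x y. mi_order \<alpha> \<le> n \<longrightarrow> x \<in> K \<longrightarrow> y \<in> K \<longrightarrow>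
      norm (x - y) < t0 \<longrightarrow> norm (whitney_rem n f x \<alpha> y) \<le> C * norm (x - y) ^ Suc (n - mi_order \<alpha>)"
      using C d by (intro exI[of _ C] conjI exI[of _ "d / 2"]) auto
  qed (simp add: f_def jet_restrict_def)
  moreover have "wave_operator f = (\<lambda>\<alpha> x. 0)"
  proof (intro ext)
    fix \<alpha> x
    have "wave_operator ?w \<alpha> x = 0" by (simp add: wave_solution_def wave_operator_wave_jet)
    then show "wave_operator f \<alpha> x = 0"
      by (simp add: wave_operator_def jet_partial_def f_def jet_restrict_def)
  qed
  ultimately have "f \<in> whitney_kernel wave_operator F" by (simp add: whitney_kernel_def)
  moreover have "transversal \<sigma> f (line_point \<sigma> c r) = 0"
    using rst by (simp add: transversal_def f_def jet_restrict_def p_def line_point(2)[OF \<sigma>])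
  moreover have "transversal \<sigma> f (line_point \<sigma> c t) = 2 * \<phi> 1 c"
    using rst in_F \<sigma>
    by (auto simp: transversal_def f_def jet_restrict_def p_def l_def w line_point[OF \<sigma>] mi_order_eq)
  ultimately show ?thesis using \<phi>_c by (intro that[of f]) auto
qed

lemma Runge_pair_imp_line:
  fixes F :: "(real^2) set"
  assumes runge: "Runge_pair wave_operator F UNIV" and \<sigma>: "\<sigma> = 1 \<or> \<sigma> = -1" and rst: "r < s" "s < t"
    and in_F: "line_point \<sigma> c r \<in> F" "line_point \<sigma> c t \<in> F"
  shows "line_point \<sigma> c s \<in> F"
proof (rule ccontr)
  assume s: "line_point \<sigma> c s \<notin> F"
  have F: "closed F" using runge by (simp add: Runge_pair_def)
  define a where "a = line_point \<sigma> c r"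
  define b where "b = line_point \<sigma> c t"
  obtain f where f: "f \<in> whitney_kernel wave_operator F" and fa: "transversal \<sigma> f a = 0" and fb: "transversal \<sigma> f b \<noteq> 0"
    using broken_line_kernel[OF F \<sigma> rst in_F(1) s in_F(2)] unfolding a_def b_def by metis
  \<comment> \<open>Each of the two points contributes an error below 2 e, one e for each first
    order derivative, and 4 e is the jump of the transversal derivative.\<close>
  define e where "e = norm (transversal \<sigma> f b) / 4"
  have e: "0 < e" using fb by (simp add: e_def)
  have fF: "f \<in> whitney F" using f by (simp add: whitney_kernel_def)
  \<comment> \<open>Two points and order 1 suffice as a test, since the norm dominates the values of
    the first derivatives there.\<close>
  define U where "U = {g \<in> whitney F. whitney_norm 1 {a, b} (jet_restrict {a, b} (\<lambda>\<alpha> x. g \<alpha> x - f \<alpha> x)) < ennreal e}"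
  have "openin (whitney_topology F) U"
    unfolding whitney_topology_def openin_topology_generated_by_iff
    by (rule generate_topology_on.Basis)
      (use fF e in_F in \<open>auto simp: U_def a_def b_def intro!: exI[of _ f] exI[of _ "1::nat"] exI[of _ "{a, b}"] exI[of _ e]\<close>)
  moreover have "f \<in> U"
  proof -
    have "whitney_norm 1 {a, b} (jet_restrict {a, b} (\<lambda>\<alpha> x. f \<alpha> x - f \<alpha> x)) \<le> ennreal 0 + ennreal 0"
      by (rule whitney_norm_le) (auto simp: jet_restrict_def whitney_rem_def taylor_deriv_def)
    then show ?thesis using fF e by (simp add: U_def)
  qed
  moreover have "f \<in> whitney_topology F closure_of (jet_restrict F ` whitney_kernel wave_operator UNIV)"
    using runge f by (auto simp: Runge_pair_def)
  ultimately obtain g where g: "g \<in> whitney_kernel wave_operator UNIV" "jet_restrict F g \<in> U"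
    unfolding in_closure_of by blast
  have close: "norm (g \<alpha> x - f \<alpha> x) < e" if "x \<in> {a, b}" "mi_order \<alpha> \<le> 1" for \<alpha> x
  proof -
    let ?h = "jet_restrict {a, b} (\<lambda>\<alpha> x. jet_restrict F g \<alpha> x - f \<alpha> x)"
    have "ennreal (norm (?h \<alpha> x)) \<le> Sup {ennreal (norm (?h \<alpha> x)) | \<alpha> x. x \<in> {a, b} \<and> mi_order \<alpha> \<le> 1}"
      by (rule Sup_upper) (use that in blast)
    also have "\<dots> \<le> whitney_norm 1 {a, b} ?h"
      unfolding whitney_norm_def by (rule add_increasing2) auto
    also have "\<dots> < ennreal e" using g(2) by (simp add: U_def)
    finally have "norm (?h \<alpha> x) < e" by (simp add: ennreal_less_iff)
    then show ?thesis using that in_F by (auto simp: jet_restrict_def a_def b_def)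
  qed
  have tr: "norm (transversal \<sigma> g x - transversal \<sigma> f x) < 2 * e" if "x \<in> {a, b}" for x
  proof -
    have "transversal \<sigma> g x - transversal \<sigma> f x
      = (g (mi 1 0) x - f (mi 1 0) x) + of_real \<sigma> * (g (mi 0 1) x - f (mi 0 1) x)"
      by (simp add: transversal_def algebra_simps)
    also have "norm \<dots> \<le> norm (g (mi 1 0) x - f (mi 1 0) x) + norm (g (mi 0 1) x - f (mi 0 1) x)"
      using norm_triangle_ineq[of "g (mi 1 0) x - f (mi 1 0) x" "of_real \<sigma> * (g (mi 0 1) x - f (mi 0 1) x)"] \<sigma>
      by (auto simp: norm_mult)
    also have "\<dots> < e + e"
      using close[OF that, of "mi 1 0"] close[OF that, of "mi 0 1"] by (intro add_strict_mono) (simp_all add: mi_order_eq)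
    finally show ?thesis by simp
  qed
  have "transversal \<sigma> g a = transversal \<sigma> g b"
    unfolding a_def b_def by (rule transversal_const[OF g(1) \<sigma>])
  then have "norm (transversal \<sigma> f b) = norm ((transversal \<sigma> g a - transversal \<sigma> f a) - (transversal \<sigma> g b - transversal \<sigma> f b))"
    by (simp add: fa)
  also have "\<dots> \<le> norm (transversal \<sigma> g a - transversal \<sigma> f a) + norm (transversal \<sigma> g b - transversal \<sigma> f b)"
    by (rule norm_triangle_ineq4)
  also have "\<dots> < 2 * e + 2 * e" by (intro add_strict_mono tr) auto
  finally show False by (simp add: e_def)
qed

lemma Runge_pair_iff_lines:
  fixes F :: "(real^2) set"
  assumes F: "closed F"
  shows "Runge_pair wave_operator F UNIV \<longleftrightarrow>
    (\<forall>\<sigma> c r s t. (\<sigma> = 1 \<or> \<sigma> = -1) \<longrightarrow> r < s \<longrightarrow> s < t \<longrightarrow>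
      line_point \<sigma> c r \<in> F \<longrightarrow> line_point \<sigma> c t \<in> F \<longrightarrow> line_point \<sigma> c s \<in> F)"
    (is "_ \<longleftrightarrow> ?lines")
proof
  assume "Runge_pair wave_operator F UNIV"
  then show ?lines using Runge_pair_imp_line by blast
next
  assume lines: ?lines
  have "f \<in> whitney_topology F closure_of (jet_restrict F ` whitney_kernel wave_operator UNIV)"
    if f: "f \<in> whitney_kernel wave_operator F" for f
    unfolding in_closure_of
  proof (intro conjI allI impI)
    show "f \<in> topspace (whitney_topology F)"
      using f by (simp add: topspace_whitney_topology whitney_kernel_def)
    fix U assume U: "f \<in> U \<and> openin (whitney_topology F) U"
    then obtain n0 K e where K: "compact K" "K \<subseteq> F" "0 < e"
      and nhd: "\<And>g. g \<in> whitney F \<Longrightarrow> (\<And>n. n \<le> n0 \<Longrightarrow> whitney_norm n K (\<lambda>\<alpha> x. g \<alpha> x - f \<alpha> x) < ennreal e) \<Longrightarrow> g \<in> U"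
      using whitney_topology_nhd[of F U f] by blast
    obtain G H where GH: "deriv_seq G" "deriv_seq H"
      and approx: "\<And>n. n \<le> n0 \<Longrightarrow> whitney_norm n K (\<lambda>\<alpha> x. jet_restrict F (wave_solution G H) \<alpha> x - f \<alpha> x) < ennreal e"
      by (rule wave_solution_dense[OF F f _ K, of n0]) (use lines in blast)+
    have "wave_solution G H \<in> whitney_kernel wave_operator UNIV" by (rule wave_solution_kernel[OF GH])
    moreover have "jet_restrict F (wave_solution G H) \<in> U"
      using calculation by (intro nhd approx jet_restrict_whitney) (auto simp: whitney_kernel_def)
    ultimately show "\<exists>y. y \<in> jet_restrict F ` whitney_kernel wave_operator UNIV \<and> y \<in> U" by blast
  qed
  then show "Runge_pair wave_operator F UNIV" using F by (auto simp: Runge_pair_def)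
qed

theorem corollary24:
  fixes F :: "(real^2) set"
  assumes "closed F" and "F \<noteq> UNIV" and "continuous_boundary F"
    and "\<And>\<xi> U. \<xi> \<in> frontier F \<Longrightarrow> \<xi> \<in> interior U \<Longrightarrow>
           U \<inter> frontier F \<inter> {x. x $ 1 + x $ 2 < \<xi> $ 1 + \<xi> $ 2} \<noteq> {} \<and>
           U \<inter> frontier F \<inter> {x. x $ 1 - x $ 2 < \<xi> $ 1 - \<xi> $ 2} \<noteq> {}"
    and "\<And>\<xi> U. \<xi> \<in> frontier F \<Longrightarrow> \<xi> \<in> interior U \<Longrightarrow>
           U \<inter> frontier F \<inter> {x. x $ 1 + x $ 2 > \<xi> $ 1 + \<xi> $ 2} \<noteq> {} \<and>
           U \<inter> frontier F \<inter> {x. x $ 1 - x $ 2 > \<xi> $ 1 - \<xi> $ 2} \<noteq> {}"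
  shows "Runge_pair wave_operator F UNIV \<longleftrightarrow>
         \<not> (\<exists>L. wave_characteristic_line L \<and> (\<exists>C\<in>components (L \<inter> (UNIV - F)). bounded C))"
proof -
  have "(\<exists>L. wave_characteristic_line L \<and> (\<exists>C\<in>components (L \<inter> (UNIV - F)). bounded C)) \<longleftrightarrow>
    (\<exists>\<sigma> c. (\<sigma> = 1 \<or> \<sigma> = -1) \<and> (\<exists>C\<in>components ({x. x $ 1 + \<sigma> * x $ 2 = c} \<inter> (UNIV - F)). bounded C))"
    unfolding wave_characteristic_line_iff by blast
  also have "\<dots> \<longleftrightarrow> (\<exists>\<sigma> c. (\<sigma> = 1 \<or> \<sigma> = -1) \<and>
    (\<exists>r s t. r < s \<and> s < t \<and> line_point \<sigma> c r \<in> F \<and> line_point \<sigma> c s \<notin> F \<and> line_point \<sigma> c t \<in> F))"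
    by (intro ex_cong1 conj_cong refl bounded_component_iff)
  finally show ?thesis
    unfolding Runge_pair_iff_lines[OF \<open>closed F\<close>] by blast
qed

end
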